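(* Let $F:M\to\mathbb{R}^3$ be a connected, umbilic-free Bonnet surface whose mean curvature is not constant. Then $F$ is flat (i.e. its Gaussian curvature $K$ vanishes identically) if and only if its Möbius curvature $K_{\mathcal{M}}$ is constant or its ratio of principal curvatures is constant.
   Context: Let $F:M\to\mathbb{R}^3$ be an immersed surface with first fundamental form $\mathrm{I}$, mean curvature $H$ and Gaussian curvature $K$. A Bonnet surface is such a surface that admits a non-trivial (not all members congruent under isometries of $\mathbb{R}^3$) one-parameter family of isometric deformations preserving the mean curvature. The Möbius metric of $F$ is $\mathrm{I}_{\mathcal{M}}=(H^2-K)\,\mathrm{I}$, which is a Riemannian metric away from umbilic points (the points where $H^2=K$). The Möbius curvature $K_{\mathcal{M}}$ of $F$ is the Gaussian curvature of $(M,\mathrm{I}_{\mathcal{M}})$. Constancy of the ratio of principal curvatures means that $K/H^2$ is constant, i.e. that $K=\rho H^2$ on $M$ for some constant $\rho\in\mathbb{R}$. *)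

theory Defs
  imports "HOL-Analysis.Analysis"
begin

section \<open>Smooth maps and smooth oriented surfaces\<close>

text \<open>
  Continuous differentiability of order \<open>n\<close>; only meant for open \<open>S\<close>, since the derivative is
  taken in the full space.
\<close>

primrec Ck_on :: "nat \<Rightarrow> 'a::real_normed_vector set \<Rightarrow> ('a \<Rightarrow> 'b::real_normed_vector) \<Rightarrow> bool" where
  "Ck_on 0 S f \<longleftrightarrow> continuous_on S f"
| "Ck_on (Suc n) S f \<longleftrightarrow>
     (\<forall>x\<in>S. f differentiable (at x)) \<and> (\<forall>v. Ck_on n S (\<lambda>x. frechet_derivative f (at x) v))"

definition smooth_on :: "'a::real_normed_vector set \<Rightarrow> ('a \<Rightarrow> 'b::real_normed_vector) \<Rightarrow> bool" where
  "smooth_on S f \<longleftrightarrow> (\<forall>n. Ck_on n S f)"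

text \<open>
  A surface is given by a topological space \<open>M\<close> and an atlas of local parametrizations \<open>(V, x)\<close>,
  where \<open>x\<close> maps the open set \<open>V\<close> of the plane homeomorphically onto an open subset of \<open>M\<close>.
  The sign of the mean curvature depends on the choice of a unit normal, so surfaces
  are oriented: coordinate changes have positive Jacobian determinant.
\<close>

type_synonym 'a atlas = "((real^2) set \<times> (real^2 \<Rightarrow> 'a)) set"

definition oriented_surface :: "'a topology \<Rightarrow> 'a atlas \<Rightarrow> bool" where
  "oriented_surface M A \<longleftrightarrow>
     Hausdorff_space M \<and> second_countable M \<and>
     (\<forall>(V, x)\<in>A. open V \<and> openin M (x ` V) \<and> embedding_map (top_of_set V) M x) \<and>
     (\<Union>(V, x)\<in>A. x ` V) = topspace M \<and>
     (\<forall>(V, x)\<in>A. \<forall>(W, y)\<in>A.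
        smooth_on {u\<in>V. x u \<in> y ` W} (inv_into W y \<circ> x) \<and>
        (\<forall>u\<in>V. x u \<in> y ` W \<longrightarrow>
           det (matrix (frechet_derivative (inv_into W y \<circ> x) (at u))) > 0))"


section \<open>Local theory of parametrized surfaces\<close>

definition pd :: "2 \<Rightarrow> (real^2 \<Rightarrow> 'b::real_normed_vector) \<Rightarrow> real^2 \<Rightarrow> 'b" where
  "pd i f u = frechet_derivative f (at u) (axis i 1)"

definition fund_form1 :: "(real^2 \<Rightarrow> real^3) \<Rightarrow> real^2 \<Rightarrow> real^2^2" where
  "fund_form1 f u = (\<chi> i j. pd i f u \<bullet> pd j f u)"

definition unit_normal :: "(real^2 \<Rightarrow> real^3) \<Rightarrow> real^2 \<Rightarrow> real^3" where
  "unit_normal f u = sgn (cross3 (pd 1 f u) (pd 2 f u))"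

definition fund_form2 :: "(real^2 \<Rightarrow> real^3) \<Rightarrow> real^2 \<Rightarrow> real^2^2" where
  "fund_form2 f u = (\<chi> i j. pd i (pd j f) u \<bullet> unit_normal f u)"

definition shape_operator :: "(real^2 \<Rightarrow> real^3) \<Rightarrow> real^2 \<Rightarrow> real^2^2" where
  "shape_operator f u = matrix_inv (fund_form1 f u) ** fund_form2 f u"

definition mean_curvature :: "(real^2 \<Rightarrow> real^3) \<Rightarrow> real^2 \<Rightarrow> real" where
  "mean_curvature f u = trace (shape_operator f u) / 2"

definition gauss_curvature :: "(real^2 \<Rightarrow> real^3) \<Rightarrow> real^2 \<Rightarrow> real" where
  "gauss_curvature f u = det (shape_operator f u)"

text \<open>
  Intrinsic Gaussian curvature of a Riemannian metric \<open>g\<close> on a plane domain.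
  \<open>christoffel g k i j\<close> is \<open>\<Gamma>\<^sup>k\<^bsub>ij\<^esub>\<close>, and \<open>riemann g l i j k\<close> is the \<open>l\<close>-th component of
  \<open>R(\<partial>\<^sub>i, \<partial>\<^sub>j) \<partial>\<^sub>k\<close>, where \<open>R(X, Y) Z = \<nabla>\<^sub>X \<nabla>\<^sub>Y Z - \<nabla>\<^sub>Y \<nabla>\<^sub>X Z - \<nabla>\<^bsub>[X,Y]\<^esub> Z\<close>.
\<close>

definition christoffel :: "(real^2 \<Rightarrow> real^2^2) \<Rightarrow> 2 \<Rightarrow> 2 \<Rightarrow> 2 \<Rightarrow> real^2 \<Rightarrow> real" where
  "christoffel g k i j u =
     (\<Sum>l\<in>UNIV. matrix_inv (g u) $ k $ l *
        (pd i (\<lambda>w. g w $ j $ l) u + pd j (\<lambda>w. g w $ i $ l) u - pd l (\<lambda>w. g w $ i $ j) u)) / 2"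

definition riemann :: "(real^2 \<Rightarrow> real^2^2) \<Rightarrow> 2 \<Rightarrow> 2 \<Rightarrow> 2 \<Rightarrow> 2 \<Rightarrow> real^2 \<Rightarrow> real" where
  "riemann g l i j k u =
     pd i (christoffel g l j k) u - pd j (christoffel g l i k) u +
     (\<Sum>m\<in>UNIV. christoffel g l i m u * christoffel g m j k u
              - christoffel g l j m u * christoffel g m i k u)"

definition metric_curvature :: "(real^2 \<Rightarrow> real^2^2) \<Rightarrow> real^2 \<Rightarrow> real" where
  "metric_curvature g u = (\<Sum>l\<in>UNIV. g u $ 1 $ l * riemann g l 1 2 2 u) / det (g u)"

definition moebius_metric :: "(real^2 \<Rightarrow> real^3) \<Rightarrow> real^2 \<Rightarrow> real^2^2" where
  "moebius_metric f u = ((mean_curvature f u)\<^sup>2 - gauss_curvature f u) *\<^sub>R fund_form1 f u"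

definition moebius_curvature :: "(real^2 \<Rightarrow> real^3) \<Rightarrow> real^2 \<Rightarrow> real" where
  "moebius_curvature f = metric_curvature (moebius_metric f)"


section \<open>Immersed surfaces\<close>

text \<open>
  Properties of the first fundamental form and of the curvature functions of \<open>F\<close> on the
  surface are expressed in all parametrizations of the atlas.
\<close>

definition immersion :: "'a atlas \<Rightarrow> ('a \<Rightarrow> real^3) \<Rightarrow> bool" where
  "immersion A F \<longleftrightarrow>
     (\<forall>(V, x)\<in>A. smooth_on V (F \<circ> x) \<and> (\<forall>u\<in>V. inj (frechet_derivative (F \<circ> x) (at u))))"

definition umbilic_free :: "'a atlas \<Rightarrow> ('a \<Rightarrow> real^3) \<Rightarrow> bool" where
  "umbilic_free A F \<longleftrightarrow>
     (\<forall>(V, x)\<in>A. \<forall>u\<in>V. (mean_curvature (F \<circ> x) u)\<^sup>2 \<noteq> gauss_curvature (F \<circ> x) u)"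

definition flat :: "'a atlas \<Rightarrow> ('a \<Rightarrow> real^3) \<Rightarrow> bool" where
  "flat A F \<longleftrightarrow> (\<forall>(V, x)\<in>A. \<forall>u\<in>V. gauss_curvature (F \<circ> x) u = 0)"

definition constant_mean_curvature :: "'a atlas \<Rightarrow> ('a \<Rightarrow> real^3) \<Rightarrow> bool" where
  "constant_mean_curvature A F \<longleftrightarrow>
     (\<exists>c. \<forall>(V, x)\<in>A. \<forall>u\<in>V. mean_curvature (F \<circ> x) u = c)"

definition constant_moebius_curvature :: "'a atlas \<Rightarrow> ('a \<Rightarrow> real^3) \<Rightarrow> bool" where
  "constant_moebius_curvature A F \<longleftrightarrow>
     (\<exists>c. \<forall>(V, x)\<in>A. \<forall>u\<in>V. moebius_curvature (F \<circ> x) u = c)"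

definition constant_curvature_ratio :: "'a atlas \<Rightarrow> ('a \<Rightarrow> real^3) \<Rightarrow> bool" where
  "constant_curvature_ratio A F \<longleftrightarrow>
     (\<exists>\<rho>. \<forall>(V, x)\<in>A. \<forall>u\<in>V.
        gauss_curvature (F \<circ> x) u = \<rho> * (mean_curvature (F \<circ> x) u)\<^sup>2)"

definition isometric :: "'a atlas \<Rightarrow> ('a \<Rightarrow> real^3) \<Rightarrow> ('a \<Rightarrow> real^3) \<Rightarrow> bool" where
  "isometric A F G \<longleftrightarrow> (\<forall>(V, x)\<in>A. \<forall>u\<in>V. fund_form1 (F \<circ> x) u = fund_form1 (G \<circ> x) u)"

definition same_mean_curvature :: "'a atlas \<Rightarrow> ('a \<Rightarrow> real^3) \<Rightarrow> ('a \<Rightarrow> real^3) \<Rightarrow> bool" where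
  "same_mean_curvature A F G \<longleftrightarrow>
     (\<forall>(V, x)\<in>A. \<forall>u\<in>V. mean_curvature (F \<circ> x) u = mean_curvature (G \<circ> x) u)"

text \<open>
  Congruence of immersions as maps: corresponding points are matched by one (possibly
  orientation reversing) isometry of Euclidean space.
\<close>

definition congruent_on :: "'a set \<Rightarrow> ('a \<Rightarrow> real^3) \<Rightarrow> ('a \<Rightarrow> real^3) \<Rightarrow> bool" where
  "congruent_on S F G \<longleftrightarrow>
     (\<exists>\<Phi> :: real^3 \<Rightarrow> real^3. (\<forall>a b. dist (\<Phi> a) (\<Phi> b) = dist a b) \<and> (\<forall>p\<in>S. G p = \<Phi> (F p)))"

definition bonnet_surface :: "'a topology \<Rightarrow> 'a atlas \<Rightarrow> ('a \<Rightarrow> real^3) \<Rightarrow> bool" where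
  "bonnet_surface M A F \<longleftrightarrow>
     immersion A F \<and>
     (\<exists>J (G :: real \<Rightarrow> 'a \<Rightarrow> real^3).
        open J \<and> is_interval J \<and> 0 \<in> J \<and>
        (\<forall>p\<in>topspace M. G 0 p = F p) \<and>
        (\<forall>(V, x)\<in>A. smooth_on (J \<times> V) (\<lambda>(t, u). G t (x u))) \<and>
        (\<forall>t\<in>J. immersion A (G t) \<and> isometric A F (G t) \<and> same_mean_curvature A F (G t)) \<and>
        (\<exists>s\<in>J. \<exists>t\<in>J. \<not> congruent_on (topspace M) (G s) (G t)))"

end

theory Submission
  imports Defs
begin

text \<open>
  A flat surface has curvature ratio \<open>0\<close>, so only the converse needs an argument.  It rests on the fact
  that a Bonnet surface is, away from the critical points of \<open>H\<close>, governed by ordinary differential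
  equations.

  The computations use an orthonormal frame \<open>e\<^sub>1, e\<^sub>2\<close> of the first fundamental form, the derivations
  \<open>D = e\<^sub>1 - \<i> e\<^sub>2\<close> and \<open>Db = e\<^sub>1 + \<i> e\<^sub>2\<close>, and the coefficient \<open>q\<close> of the Hopf differential, for which
  \<open>\<bar>q\<bar>\<^sup>2 = H\<^sup>2 - K\<close>.  With \<open>c\<close> the complex form of the bracket \<open>[e\<^sub>1, e\<^sub>2]\<close> the Codazzi equations read
  \<open>Db q = D H + 2 cnj c q\<close> (\<open>codazzi\<close>).  Two members of the family share the frame, \<open>H\<close> and, by the Gauss
  equation, \<open>\<bar>q\<bar>\<close>, so their Hopf coefficients have a unimodular quotient \<open>g\<close>, and
  \<open>Db g = (1 - g) \<beta>\<close> with \<open>\<beta> = D H / q\<close>.  As \<open>\<bar>g\<bar> = 1\<close> this determines the whole differential of \<open>g\<close>.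
  Hence two members that agree to second order at one point are congruent near it, and on the
  connected surface two members agree to second order everywhere, and are then congruent, or nowhere
  (\<open>agree_everywhere_or_nowhere\<close>, \<open>congruent_if_agree\<close>).  By continuity in the parameter a
  noncongruent pair yields three members that differ pairwise at every point (\<open>three_members\<close>).

  In terms of the real function \<open>T = \<i> (g + 1) / (g - 1)\<close> the equation becomes the linear one
  \<open>Db T = \<beta> (T - \<i>)\<close>.  Two distinct real solutions exist, so its integrability condition holds:
  \<open>D \<beta> = c \<beta> + \<bar>\<beta>\<bar>\<^sup>2\<close> (\<open>structure_equation\<close>).  Where \<open>d H\<close> does not vanish, it implies that the metric
  \<open>P I\<close> with \<open>P = \<bar>\<beta>\<bar>\<^sup>2\<close> has curvature \<open>-1\<close> and, together with Codazzi, that the Moebius gradient \<open>X\<close>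
  of \<open>H\<close> commutes with its rotation \<open>Y\<close>.  These fields replace isothermal coordinates: \<open>X H = P\<close> and
  \<open>Y H = 0\<close>, hence \<open>Y P = 0\<close>, and with \<open>m = H\<^sup>2 - K\<close> the Moebius metric, \<open>I\<close> and \<open>P I\<close> have conformal
  factors \<open>P\<close>, \<open>P / m\<close> and \<open>P\<^sup>2 / m\<close>.  Their curvatures give \<open>K\<^sub>M = - X (X P / P) / (2 P)\<close>, the Gauss
  equation \<open>H\<^sup>2 + P = m (1 - K\<^sub>M)\<close>, then \<open>Y m = 0\<close>, and Liouville's equation for \<open>P\<^sup>2 / m\<close>
  (\<open>moebius\<close>, \<open>gauss_P\<close>, \<open>liouville\<close>).

  If \<open>K = \<rho> H\<^sup>2\<close>, these equations are incompatible unless \<open>\<rho> = 0\<close> (\<open>curvature_ratio_zero\<close>).  If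
  \<open>K\<^sub>M = k\<close> is constant, \<open>P\<close> is a quadratic polynomial in \<open>H\<close>, and Liouville's equation leaves only
  \<open>P = - k H\<^sup>2\<close> and \<open>K = 0\<close> (\<open>constant_moebius_curvature_imp_flat\<close>).  In the latter case a critical point
  of \<open>H\<close> that is a limit of noncritical ones would satisfy \<open>H = K = 0\<close>, which is impossible on an
  umbilic-free surface; so the critical set is open and closed, hence empty because \<open>H\<close> is not constant,
  and the surface is flat everywhere.
\<close>

section \<open>Calculus of smooth functions\<close>

lemma Ck_on_cong:
  assumes "open S" "\<And>x. x \<in> S \<Longrightarrow> f x = g x" "Ck_on n S f"
  shows "Ck_on n S g"
  using assms(2,3)
proof (induction n arbitrary: f g)
  case 0 then show ?case by (simp cong: continuous_on_cong)
next
  case (Suc n)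
  have d: "f differentiable (at x)" "g differentiable (at x)"
     "frechet_derivative g (at x) = frechet_derivative f (at x)" if "x \<in> S" for x
  proof -
    show fd: "f differentiable (at x)" using Suc.prems that by simp
    then show "frechet_derivative g (at x) = frechet_derivative f (at x)"
      using frechet_derivative_transform_within_open[OF fd assms(1) that, of g] Suc.prems(1) by auto
    have "(g has_derivative frechet_derivative f (at x)) (at x)"
      using has_derivative_transform_within_open[OF fd[unfolded frechet_derivative_works] assms(1) that, of g] Suc.prems(1) by auto
    then show "g differentiable (at x)" unfolding differentiable_def by blast
  qed
  show ?case
    using Suc.IH[of "\<lambda>x. frechet_derivative f (at x) v" "\<lambda>x. frechet_derivative g (at x) v" for v] Suc.prems(2) d
    by auto
qed

lemma Ck_on_SucI:
  assumes "open S" "\<And>x. x \<in> S \<Longrightarrow> (f has_derivative D x) (at x)" "\<And>v. Ck_on n S (\<lambda>x. D x v)"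
  shows "Ck_on (Suc n) S f"
proof -
  have eq: "frechet_derivative f (at x) = D x" if "x \<in> S" for x
    using frechet_derivative_at[OF assms(2)[OF that]] by simp
  have "Ck_on n S (\<lambda>x. frechet_derivative f (at x) v)" for v
    by (rule Ck_on_cong[OF assms(1) _ assms(3)[of v]]) (simp add: eq)
  moreover have "f differentiable (at x)" if "x \<in> S" for x
    using assms(2)[OF that] by (auto simp: differentiable_def)
  ultimately show ?thesis by simp
qed

lemma Ck_on_Suc_lower: "Ck_on (Suc n) S f \<Longrightarrow> Ck_on n S f"
proof (induction n arbitrary: f)
  case 0 then show ?case
    by (auto simp: intro!: differentiable_imp_continuous_on differentiable_at_imp_differentiable_on)
next
  case (Suc n) then show ?case by (metis Ck_on.simps(2))
qed

lemma smooth_on_iff_derivative: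
  "smooth_on S f \<longleftrightarrow> (\<forall>x\<in>S. f differentiable (at x)) \<and> (\<forall>v. smooth_on S (\<lambda>x. frechet_derivative f (at x) v))"
proof
  assume "smooth_on S f"
  then have "Ck_on (Suc n) S f" for n unfolding smooth_on_def by blast
  then show "(\<forall>x\<in>S. f differentiable (at x)) \<and> (\<forall>v. smooth_on S (\<lambda>x. frechet_derivative f (at x) v))"
    unfolding smooth_on_def by auto
next
  assume R: "(\<forall>x\<in>S. f differentiable (at x)) \<and> (\<forall>v. smooth_on S (\<lambda>x. frechet_derivative f (at x) v))"
  then have "Ck_on (Suc n) S f" for n unfolding smooth_on_def by simp
  then show "smooth_on S f" unfolding smooth_on_def using Ck_on_Suc_lower by blast
qed

lemma smooth_on_differentiable: "smooth_on S f \<Longrightarrow> x \<in> S \<Longrightarrow> f differentiable (at x)"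
  using smooth_on_iff_derivative by blast

lemma smooth_on_continuous: "smooth_on S f \<Longrightarrow> continuous_on S f"
  unfolding smooth_on_def using Ck_on.simps(1) by blast

lemma smooth_on_cong:
  assumes "open S" "\<And>x. x \<in> S \<Longrightarrow> f x = g x" "smooth_on S f"
  shows "smooth_on S g"
  using assms Ck_on_cong unfolding smooth_on_def by blast

lemma smooth_on_subset:
  assumes "smooth_on S f" "T \<subseteq> S" shows "smooth_on T f"
proof -
  have "Ck_on n S f \<Longrightarrow> Ck_on n T f" for n and f :: "'a \<Rightarrow> 'b"
    using assms(2) by (induction n arbitrary: f) (auto intro: continuous_on_subset)
  then show ?thesis using assms(1) unfolding smooth_on_def by blast
qed

lemma Ck_on_const: "Ck_on n S (\<lambda>x. c)"
  by (induction n arbitrary: c) auto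

lemma smooth_on_const: "smooth_on S (\<lambda>x. c)"
  by (simp add: smooth_on_def Ck_on_const)

lemma Ck_on_bounded_linear:
  assumes "open S" "bounded_linear L" "Ck_on n S f"
  shows "Ck_on n S (\<lambda>x. L (f x))"
  using assms(3)
proof (induction n arbitrary: f)
  case 0 then show ?case
    using assms(2) by (simp add: linear_continuous_on_compose bounded_linear.continuous_on)
next
  case (Suc n)
  have *: "((\<lambda>x. L (f x)) has_derivative (\<lambda>v. L (frechet_derivative f (at x) v))) (at x)" if "x \<in> S" for x
    using Suc.prems that bounded_linear.has_derivative[OF assms(2)] frechet_derivative_works by fastforce
  show ?case using Suc by (intro Ck_on_SucI[OF assms(1) *]) auto
qed

lemma Ck_on_add:
  assumes "open S" "Ck_on n S f" "Ck_on n S g"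
  shows "Ck_on n S (\<lambda>x. f x + g x)"
  using assms(2,3)
proof (induction n arbitrary: f g)
  case 0 then show ?case by (simp add: continuous_on_add)
next
  case (Suc n)
  have *: "((\<lambda>x. f x + g x) has_derivative (\<lambda>v. frechet_derivative f (at x) v + frechet_derivative g (at x) v)) (at x)"
    if "x \<in> S" for x
    using Suc.prems that by (auto intro!: has_derivative_add simp: frechet_derivative_works[symmetric])
  show ?case using Suc by (intro Ck_on_SucI[OF assms(1) *]) auto
qed

lemma Ck_on_bilinear:
  assumes "open S" "bounded_bilinear B" "Ck_on n S f" "Ck_on n S g"
  shows "Ck_on n S (\<lambda>x. B (f x) (g x))"
  using assms(3,4)
proof (induction n arbitrary: f g)
  case 0 then show ?case using bounded_bilinear.continuous_on[OF assms(2)] by simp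
next
  case (Suc n)
  let ?D = "\<lambda>x v. B (f x) (frechet_derivative g (at x) v) + B (frechet_derivative f (at x) v) (g x)"
  have *: "((\<lambda>x. B (f x) (g x)) has_derivative ?D x) (at x)" if "x \<in> S" for x
    using Suc.prems that by (auto intro!: bounded_bilinear.FDERIV[OF assms(2)] simp: frechet_derivative_works[symmetric])
  have "Ck_on n S f" "Ck_on n S g" using Suc.prems by (auto intro: Ck_on_Suc_lower simp del: Ck_on.simps)
  then have "Ck_on n S (\<lambda>x. ?D x v)" for v using Suc
    by (intro Ck_on_add assms Suc.IH) auto
  then show ?case by (intro Ck_on_SucI[OF assms(1) *])
qed

lemma smooth_on_bounded_linear:
  "open S \<Longrightarrow> bounded_linear L \<Longrightarrow> smooth_on S f \<Longrightarrow> smooth_on S (\<lambda>x. L (f x))"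
  unfolding smooth_on_def using Ck_on_bounded_linear by blast

lemma smooth_on_bilinear:
  "open S \<Longrightarrow> bounded_bilinear B \<Longrightarrow> smooth_on S f \<Longrightarrow> smooth_on S g \<Longrightarrow> smooth_on S (\<lambda>x. B (f x) (g x))"
  unfolding smooth_on_def using Ck_on_bilinear by blast

lemma smooth_on_add: "open S \<Longrightarrow> smooth_on S f \<Longrightarrow> smooth_on S g \<Longrightarrow> smooth_on S (\<lambda>x. f x + g x)"
  unfolding smooth_on_def using Ck_on_add by blast

lemma smooth_on_minus: "open S \<Longrightarrow> smooth_on S f \<Longrightarrow> smooth_on S (\<lambda>x. - f x)"
  using smooth_on_bounded_linear[OF _ bounded_linear_minus[OF bounded_linear_ident]] by blast

lemma smooth_on_diff: "open S \<Longrightarrow> smooth_on S f \<Longrightarrow> smooth_on S g \<Longrightarrow> smooth_on S (\<lambda>x. f x - g x)"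
  using smooth_on_add[of S f "\<lambda>x. - g x"] smooth_on_minus[of S g] by simp

lemma smooth_on_mult:
  fixes f g :: "'a::real_normed_vector \<Rightarrow> 'b::real_normed_algebra"
  shows "open S \<Longrightarrow> smooth_on S f \<Longrightarrow> smooth_on S g \<Longrightarrow> smooth_on S (\<lambda>x. f x * g x)"
  by (rule smooth_on_bilinear[OF _ bounded_bilinear_mult])

lemma smooth_on_power2:
  fixes f :: "'a::real_normed_vector \<Rightarrow> 'b::real_normed_algebra_1"
  shows "open S \<Longrightarrow> smooth_on S f \<Longrightarrow> smooth_on S (\<lambda>x. (f x)\<^sup>2)"
  unfolding power2_eq_square by (rule smooth_on_mult)

lemma smooth_on_scaleR: "open S \<Longrightarrow> smooth_on S f \<Longrightarrow> smooth_on S g \<Longrightarrow> smooth_on S (\<lambda>x. f x *\<^sub>R g x)"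
  by (rule smooth_on_bilinear[OF _ bounded_bilinear_scaleR])

lemma smooth_on_inner: "open S \<Longrightarrow> smooth_on S f \<Longrightarrow> smooth_on S g \<Longrightarrow> smooth_on S (\<lambda>x. f x \<bullet> g x)"
  by (rule smooth_on_bilinear[OF _ bounded_bilinear_inner])

lemma bounded_bilinear_cross3: "bounded_bilinear cross3"
  using bilinear_cross bilinear_conv_bounded_bilinear by blast

lemma smooth_on_cross3: "open S \<Longrightarrow> smooth_on S f \<Longrightarrow> smooth_on S g \<Longrightarrow> smooth_on S (\<lambda>x. cross3 (f x) (g x))"
  by (rule smooth_on_bilinear[OF _ bounded_bilinear_cross3])

lemma smooth_on_nth: "open S \<Longrightarrow> smooth_on S f \<Longrightarrow> smooth_on S (\<lambda>x. f x $ i)"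
  by (rule smooth_on_bounded_linear[OF _ bounded_linear_vec_nth])

lemma smooth_on_cnj: "open S \<Longrightarrow> smooth_on S f \<Longrightarrow> smooth_on S (\<lambda>x. cnj (f x))"
  by (rule smooth_on_bounded_linear[OF _ bounded_linear_cnj])

lemma smooth_on_Re: "open S \<Longrightarrow> smooth_on S f \<Longrightarrow> smooth_on S (\<lambda>x. Re (f x))"
  by (rule smooth_on_bounded_linear[OF _ bounded_linear_Re])

lemma smooth_on_Im: "open S \<Longrightarrow> smooth_on S f \<Longrightarrow> smooth_on S (\<lambda>x. Im (f x))"
  by (rule smooth_on_bounded_linear[OF _ bounded_linear_Im])

lemma smooth_on_complex_of_real: "open S \<Longrightarrow> smooth_on S f \<Longrightarrow> smooth_on S (\<lambda>x. complex_of_real (f x))"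
  by (rule smooth_on_bounded_linear[OF _ bounded_linear_of_real])

lemma smooth_on_inverse:
  fixes f :: "'a::real_normed_vector \<Rightarrow> 'b::real_normed_field"
  assumes "open S" "smooth_on S f" and nz: "\<And>x. x \<in> S \<Longrightarrow> f x \<noteq> 0"
  shows "smooth_on S (\<lambda>x. inverse (f x))"
proof -
  have "Ck_on n S (\<lambda>x. inverse (f x))" for n
  proof (induction n)
    case 0 then show ?case using smooth_on_continuous[OF assms(2)] nz
      by (auto intro!: continuous_on_inverse)
  next
    case (Suc n)
    let ?D = "\<lambda>x v. - (inverse (f x) * frechet_derivative f (at x) v * inverse (f x))"
    have *: "((\<lambda>x. inverse (f x)) has_derivative ?D x) (at x)" if "x \<in> S" for x
      using smooth_on_differentiable[OF assms(2) that] nz[OF that]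
      by (auto intro!: has_derivative_inverse simp: frechet_derivative_works[symmetric])
    have "Ck_on n S (\<lambda>x. frechet_derivative f (at x) v)" for v
      using assms(2) smooth_on_iff_derivative[of S f] unfolding smooth_on_def by blast
    then have "Ck_on n S (\<lambda>x. ?D x v)" for v using Suc
      by (intro Ck_on_bounded_linear[OF assms(1) bounded_linear_minus[OF bounded_linear_ident]]
          Ck_on_bilinear[OF assms(1) bounded_bilinear_mult]) auto
    then show ?case by (intro Ck_on_SucI[OF assms(1) *])
  qed
  then show ?thesis by (simp add: smooth_on_def)
qed

lemma smooth_on_divide:
  fixes f g :: "'a::real_normed_vector \<Rightarrow> 'b::real_normed_field"
  assumes "open S" "smooth_on S f" "smooth_on S g" "\<And>x. x \<in> S \<Longrightarrow> g x \<noteq> 0"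
  shows "smooth_on S (\<lambda>x. f x / g x)"
  unfolding divide_inverse by (intro smooth_on_mult smooth_on_inverse assms)

lemma smooth_on_sqrt:
  fixes f :: "'a::real_normed_vector \<Rightarrow> real"
  assumes "open S" "smooth_on S f" and pos: "\<And>x. x \<in> S \<Longrightarrow> f x > 0"
  shows "smooth_on S (\<lambda>x. sqrt (f x))"
proof -
  have "Ck_on n S (\<lambda>x. sqrt (f x))" for n
  proof (induction n)
    case 0 then show ?case using smooth_on_continuous[OF assms(2)]
      by (auto intro!: continuous_on_real_sqrt)
  next
    case (Suc n)
    \<comment> \<open>The derivative is written with the square root itself, so that its differentiability
      class is the induction hypothesis.\<close>
    let ?D = "\<lambda>x v. sqrt (f x) * (frechet_derivative f (at x) v * inverse (2 * f x))"
    have *: "((\<lambda>x. sqrt (f x)) has_derivative ?D x) (at x)" if "x \<in> S" for x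
    proof -
      have "((\<lambda>x. sqrt (f x)) has_derivative (\<lambda>v. frechet_derivative f (at x) v * (inverse (sqrt (f x)) / 2))) (at x)"
        by (rule DERIV_compose_FDERIV[where g=f and f=sqrt, OF DERIV_real_sqrt[OF pos[OF that]]])
          (use smooth_on_differentiable[OF assms(2) that] frechet_derivative_works in blast)
      moreover have "inverse (sqrt (f x)) / 2 = sqrt (f x) * inverse (2 * f x)"
        using pos[OF that] by (simp add: field_simps)
      ultimately show ?thesis by (simp add: ac_simps)
    qed
    have "Ck_on n S (\<lambda>x. frechet_derivative f (at x) v)" for v
      using assms(2) smooth_on_iff_derivative[of S f] unfolding smooth_on_def by blast
    moreover have "smooth_on S (\<lambda>x. inverse (2 * f x))"
      using pos by (intro smooth_on_inverse smooth_on_mult assms smooth_on_const) force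
    then have "Ck_on n S (\<lambda>x. inverse (2 * f x))" unfolding smooth_on_def by blast
    ultimately have "Ck_on n S (\<lambda>x. ?D x v)" for v using Suc
      by (intro Ck_on_bilinear[OF assms(1) bounded_bilinear_mult]) auto
    then show ?case by (intro Ck_on_SucI[OF assms(1) *])
  qed
  then show ?thesis by (simp add: smooth_on_def)
qed

lemma second_difference_mean_value:
  fixes f :: "'a::real_normed_vector \<Rightarrow> real"
  assumes "0 < h"
    and in_S: "\<And>s t. 0 \<le> s \<Longrightarrow> s \<le> h \<Longrightarrow> 0 \<le> t \<Longrightarrow> t \<le> h \<Longrightarrow> u + s *\<^sub>R a + t *\<^sub>R b \<in> S"
    and f: "\<And>x. x \<in> S \<Longrightarrow> f differentiable (at x)"
    and fa: "\<And>x. x \<in> S \<Longrightarrow> (\<lambda>x. frechet_derivative f (at x) a) differentiable (at x)"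
  shows "\<exists>s t. 0 < s \<and> s < h \<and> 0 < t \<and> t < h \<and>
     f (u + h *\<^sub>R a + h *\<^sub>R b) - f (u + h *\<^sub>R a) - f (u + h *\<^sub>R b) + f u =
     h * h * frechet_derivative (\<lambda>x. frechet_derivative f (at x) a) (at (u + s *\<^sub>R a + t *\<^sub>R b)) b"
proof -
  let ?fa = "\<lambda>x. frechet_derivative f (at x) a"
  have line: "((\<lambda>s. g (w + s *\<^sub>R d)) has_real_derivative frechet_derivative g (at (w + s *\<^sub>R d)) d) (at s)"
    if "g differentiable (at (w + s *\<^sub>R d))" for g :: "'a \<Rightarrow> real" and w d s
  proof -
    have lin: "linear (frechet_derivative g (at (w + s *\<^sub>R d)))" using linear_frechet_derivative that by blast
    have "((\<lambda>s. w + s *\<^sub>R d) has_derivative (\<lambda>z. z *\<^sub>R d)) (at s)"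
      by (auto intro!: derivative_eq_intros)
    from has_derivative_compose[OF this that[unfolded frechet_derivative_works]]
    have "((\<lambda>s. g (w + s *\<^sub>R d)) has_derivative (\<lambda>z. frechet_derivative g (at (w + s *\<^sub>R d)) (z *\<^sub>R d))) (at s)" .
    then show ?thesis
      by (simp add: has_field_derivative_def linear_cmul[OF lin] mult.commute[of _ "frechet_derivative g (at (w + s *\<^sub>R d)) d"])
  qed
  let ?\<phi> = "\<lambda>s. f (u + h *\<^sub>R b + s *\<^sub>R a) - f (u + s *\<^sub>R a)"
  have d1: "(?\<phi> has_real_derivative ?fa (u + h *\<^sub>R b + s *\<^sub>R a) - ?fa (u + s *\<^sub>R a)) (at s)"
    if "0 \<le> s" "s \<le> h" for s
  proof (intro DERIV_diff line f)
    show "u + h *\<^sub>R b + s *\<^sub>R a \<in> S" "u + s *\<^sub>R a \<in> S"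
      using that in_S[of s h] in_S[of s 0] assms(1) by (simp_all add: algebra_simps)
  qed
  obtain s where s: "0 < s" "s < h" "?\<phi> h - ?\<phi> 0 = h * (?fa (u + h *\<^sub>R b + s *\<^sub>R a) - ?fa (u + s *\<^sub>R a))"
    using MVT2[of 0 h ?\<phi> "\<lambda>s. ?fa (u + h *\<^sub>R b + s *\<^sub>R a) - ?fa (u + s *\<^sub>R a)"] assms(1) d1 by auto
  let ?\<psi> = "\<lambda>t. ?fa (u + s *\<^sub>R a + t *\<^sub>R b)"
  have d2: "(?\<psi> has_real_derivative frechet_derivative ?fa (at (u + s *\<^sub>R a + t *\<^sub>R b)) b) (at t)"
    if "0 \<le> t" "t \<le> h" for t
    using that in_S[of s t] s by (intro line fa) auto
  obtain t where t: "0 < t" "t < h" "?\<psi> h - ?\<psi> 0 = h * frechet_derivative ?fa (at (u + s *\<^sub>R a + t *\<^sub>R b)) b"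
    using MVT2[of 0 h ?\<psi> "\<lambda>t. frechet_derivative ?fa (at (u + s *\<^sub>R a + t *\<^sub>R b)) b"] assms(1) d2 by auto
  show ?thesis
    using s t by (intro exI[of _ s] exI[of _ t]) (auto simp: algebra_simps)
qed

text \<open>
  Schwarz's theorem.  Each of the two mixed derivatives, at some point of the parallelogram spanned
  by \<open>h *\<^sub>R a\<close> and \<open>h *\<^sub>R b\<close>, equals the same second difference quotient; let \<open>h\<close> tend to \<open>0\<close>.
\<close>

lemma mixed_derivatives_commute_real:
  fixes f :: "'a::real_normed_vector \<Rightarrow> real"
  assumes S: "open S" "u \<in> S" and f: "smooth_on S f"
  shows "frechet_derivative (\<lambda>x. frechet_derivative f (at x) a) (at u) b =
         frechet_derivative (\<lambda>x. frechet_derivative f (at x) b) (at u) a"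
proof (rule ccontr)
  let ?F = "\<lambda>a b x. frechet_derivative (\<lambda>x. frechet_derivative f (at x) a) (at x) b"
  assume ne: "?F a b u \<noteq> ?F b a u"
  define \<epsilon> where "\<epsilon> = \<bar>?F a b u - ?F b a u\<bar> / 2"
  have e: "\<epsilon> > 0" using ne by (simp add: \<epsilon>_def)
  have sm: "smooth_on S (\<lambda>x. frechet_derivative f (at x) c)" for c
    using f smooth_on_iff_derivative by blast
  then have sm2: "smooth_on S (?F c d)" for c d using smooth_on_iff_derivative by blast
  have near: "\<exists>\<delta>>0. \<forall>x. dist x u < \<delta> \<longrightarrow> x \<in> S \<and> \<bar>?F c d x - ?F c d u\<bar> < \<epsilon>" for c d
  proof -
    have "isCont (?F c d) u"
      using smooth_on_continuous[OF sm2] S continuous_on_eq_continuous_at by blast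
    then obtain \<delta> where \<delta>: "\<delta> > 0" "\<And>x. dist x u < \<delta> \<Longrightarrow> dist (?F c d x) (?F c d u) < \<epsilon>"
      using e unfolding continuous_at_eps_delta by blast
    obtain \<delta>' where \<delta>': "\<delta>' > 0" "\<And>x. dist x u < \<delta>' \<Longrightarrow> x \<in> S"
      using S open_dist by metis
    show ?thesis using \<delta> \<delta>' by (intro exI[of _ "min \<delta> \<delta>'"]) (auto simp: dist_real_def)
  qed
  obtain \<delta>1 where \<delta>1: "\<delta>1 > 0" "\<And>x. dist x u < \<delta>1 \<Longrightarrow> x \<in> S \<and> \<bar>?F a b x - ?F a b u\<bar> < \<epsilon>"
    using near[of a b] by blast
  obtain \<delta>2 where \<delta>2: "\<delta>2 > 0" "\<And>x. dist x u < \<delta>2 \<Longrightarrow> x \<in> S \<and> \<bar>?F b a x - ?F b a u\<bar> < \<epsilon>"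
    using near[of b a] by blast
  define \<delta> where "\<delta> = min \<delta>1 \<delta>2"
  define h where "h = \<delta> / (2 * (norm a + norm b + 1))"
  have nn: "norm a + norm b + 1 > 0" by (simp add: add_nonneg_pos)
  have \<delta>: "\<delta> > 0" using \<delta>1(1) \<delta>2(1) by (simp add: \<delta>_def)
  have h: "h > 0" unfolding h_def by (intro divide_pos_pos mult_pos_pos \<delta> nn) simp
  have close: "dist (u + s *\<^sub>R a + t *\<^sub>R b) u < \<delta>" if "0 \<le> s" "s \<le> h" "0 \<le> t" "t \<le> h" for s t
  proof -
    have "dist (u + s *\<^sub>R a + t *\<^sub>R b) u = norm (s *\<^sub>R a + t *\<^sub>R b)" by (simp add: dist_norm algebra_simps)
    also have "\<dots> \<le> norm (s *\<^sub>R a) + norm (t *\<^sub>R b)" by (rule norm_triangle_ineq)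
    also have "\<dots> \<le> h * norm a + h * norm b"
      using that by (intro add_mono) (auto intro!: mult_right_mono)
    also have "\<dots> = h * (norm a + norm b)" by (simp add: algebra_simps)
    also have "\<dots> \<le> h * (norm a + norm b + 1)" using h by (intro mult_left_mono) auto
    also have "\<dots> = \<delta> / 2" using nn by (simp add: h_def field_simps)
    also have "\<dots> < \<delta>" using \<delta> by simp
    finally show ?thesis .
  qed
  have in1: "u + s *\<^sub>R a + t *\<^sub>R b \<in> S" "u + s *\<^sub>R b + t *\<^sub>R a \<in> S"
    if "0 \<le> s" "s \<le> h" "0 \<le> t" "t \<le> h" for s t
    using close[of s t] close[of t s] that \<delta>1(2) by (auto simp: \<delta>_def algebra_simps)
  note diff = smooth_on_differentiable[OF f] smooth_on_differentiable[OF sm]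
  obtain s t where 1: "0 < s" "s < h" "0 < t" "t < h"
    "f (u + h *\<^sub>R a + h *\<^sub>R b) - f (u + h *\<^sub>R a) - f (u + h *\<^sub>R b) + f u = h * h * ?F a b (u + s *\<^sub>R a + t *\<^sub>R b)"
    using second_difference_mean_value[OF h in1(1) diff] by auto
  obtain s' t' where 2: "0 < s'" "s' < h" "0 < t'" "t' < h"
    "f (u + h *\<^sub>R b + h *\<^sub>R a) - f (u + h *\<^sub>R b) - f (u + h *\<^sub>R a) + f u = h * h * ?F b a (u + s' *\<^sub>R b + t' *\<^sub>R a)"
    using second_difference_mean_value[OF h in1(2) diff] by auto
  have "h * h * ?F a b (u + s *\<^sub>R a + t *\<^sub>R b) = h * h * ?F b a (u + s' *\<^sub>R b + t' *\<^sub>R a)"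
    using 1(5) 2(5) by (simp add: algebra_simps)
  then have "?F a b (u + s *\<^sub>R a + t *\<^sub>R b) = ?F b a (u + s' *\<^sub>R b + t' *\<^sub>R a)" using h by simp
  moreover have "\<bar>?F a b (u + s *\<^sub>R a + t *\<^sub>R b) - ?F a b u\<bar> < \<epsilon>"
    using close[of s t] 1 \<delta>1(2) by (simp add: \<delta>_def)
  moreover have "\<bar>?F b a (u + s' *\<^sub>R b + t' *\<^sub>R a) - ?F b a u\<bar> < \<epsilon>"
    using close[of t' s'] 2 \<delta>2(2) by (simp add: \<delta>_def algebra_simps)
  ultimately show False unfolding \<epsilon>_def by (smt (verit) field_sum_of_halves)
qed

lemma mixed_derivatives_commute:
  fixes f :: "'a::real_normed_vector \<Rightarrow> 'b::euclidean_space"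
  assumes S: "open S" "u \<in> S" and f: "smooth_on S f"
  shows "frechet_derivative (\<lambda>x. frechet_derivative f (at x) a) (at u) b =
         frechet_derivative (\<lambda>x. frechet_derivative f (at x) b) (at u) a"
proof (rule euclidean_eqI)
  fix i :: 'b assume "i \<in> Basis"
  have comp: "frechet_derivative (\<lambda>x. g x \<bullet> i) (at x) c = frechet_derivative g (at x) c \<bullet> i"
    if "g differentiable (at x)" for g :: "'a \<Rightarrow> 'b" and x c
    using frechet_derivative_at[OF bounded_linear.has_derivative[OF bounded_linear_inner_left
      that[unfolded frechet_derivative_works], of i]] by metis
  have sm: "smooth_on S (\<lambda>x. frechet_derivative f (at x) c)" for c
    using f smooth_on_iff_derivative by blast
  have "frechet_derivative (\<lambda>x. frechet_derivative f (at x) c) (at u) d \<bullet> i =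
      frechet_derivative (\<lambda>x. frechet_derivative (\<lambda>x. f x \<bullet> i) (at x) c) (at u) d" for c d
  proof -
    have "frechet_derivative (\<lambda>x. frechet_derivative f (at x) c \<bullet> i) (at u) =
       frechet_derivative (\<lambda>x. frechet_derivative (\<lambda>x. f x \<bullet> i) (at x) c) (at u)"
    proof (rule frechet_derivative_transform_within_open[OF _ S])
      show "(\<lambda>x. frechet_derivative f (at x) c \<bullet> i) differentiable at u"
        using smooth_on_differentiable[OF smooth_on_inner[OF S(1) sm smooth_on_const] S(2)] by blast
      show "\<And>x. x \<in> S \<Longrightarrow> frechet_derivative f (at x) c \<bullet> i = frechet_derivative (\<lambda>x. f x \<bullet> i) (at x) c"
        using comp smooth_on_differentiable[OF f] by metis
    qed
    then show ?thesis using comp[of "\<lambda>x. frechet_derivative f (at x) c"] smooth_on_differentiable[OF sm S(2)] by metis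
  qed
  then show "frechet_derivative (\<lambda>x. frechet_derivative f (at x) a) (at u) b \<bullet> i =
         frechet_derivative (\<lambda>x. frechet_derivative f (at x) b) (at u) a \<bullet> i"
    using mixed_derivatives_commute_real[OF S smooth_on_inner[OF S(1) f smooth_on_const]] by metis
qed

section \<open>Derivatives along vector fields in the plane\<close>

definition dd :: "(real^2 \<Rightarrow> real^2) \<Rightarrow> (real^2 \<Rightarrow> 'b::real_normed_vector) \<Rightarrow> real^2 \<Rightarrow> 'b" where
  "dd v f u = frechet_derivative f (at u) (v u)"

abbreviation wedge :: "('a \<Rightarrow> real^2) \<Rightarrow> ('a \<Rightarrow> real^2) \<Rightarrow> 'a \<Rightarrow> real" where
  "wedge v w u \<equiv> v u $ 1 * w u $ 2 - v u $ 2 * w u $ 1"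

lemma pd_eq_dd: "pd i f = dd (\<lambda>u. axis i 1) f"
  by (simp add: fun_eq_iff pd_def dd_def)

lemma dd_eqI: "(f has_derivative f') (at u) \<Longrightarrow> dd v f u = f' (v u)"
  unfolding dd_def using frechet_derivative_at by metis

lemma dd_bounded_bilinear:
  assumes "bounded_bilinear B" "f differentiable (at u)" "g differentiable (at u)"
  shows "dd v (\<lambda>x. B (f x) (g x)) u = B (f u) (dd v g u) + B (dd v f u) (g u)"
  by (rule dd_eqI[THEN trans, OF bounded_bilinear.FDERIV[OF assms(1)
        assms(2)[unfolded frechet_derivative_works] assms(3)[unfolded frechet_derivative_works]]]) (simp add: dd_def)

lemma dd_bounded_linear:
  assumes "bounded_linear L" "f differentiable (at u)"
  shows "dd v (\<lambda>x. L (f x)) u = L (dd v f u)"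
  by (rule dd_eqI[THEN trans, OF bounded_linear.has_derivative[OF assms(1)
        assms(2)[unfolded frechet_derivative_works]]]) (simp add: dd_def)

locale plane_domain =
  fixes V :: "(real^2) set"
  assumes open_V: "open V"
begin

abbreviation sm :: "(real^2 \<Rightarrow> 'b::real_normed_vector) \<Rightarrow> bool" where "sm \<equiv> smooth_on V"

lemmas sm_simps =
  smooth_on_const[of V] smooth_on_add[OF open_V] smooth_on_minus[OF open_V] smooth_on_diff[OF open_V]
  smooth_on_mult[OF open_V] smooth_on_power2[OF open_V] smooth_on_scaleR[OF open_V]
  smooth_on_inner[OF open_V] smooth_on_cross3[OF open_V] smooth_on_nth[OF open_V]
  smooth_on_cnj[OF open_V] smooth_on_Re[OF open_V] smooth_on_Im[OF open_V]
  smooth_on_complex_of_real[OF open_V] smooth_on_inverse[OF open_V] smooth_on_divide[OF open_V]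
  smooth_on_sqrt[OF open_V]

lemma sm_differentiable: "sm f \<Longrightarrow> u \<in> V \<Longrightarrow> f differentiable (at u)"
  by (rule smooth_on_differentiable)

context
  fixes v :: "real^2 \<Rightarrow> real^2" and u assumes u: "u \<in> V"
begin

lemma dd_const: "dd v (\<lambda>x. c) u = 0"
  by (simp add: dd_def)

lemma dd_add: "sm f \<Longrightarrow> sm g \<Longrightarrow> dd v (\<lambda>x. f x + g x) u = dd v f u + dd v g u"
  by (rule dd_eqI[THEN trans, OF has_derivative_add]) (auto simp: dd_def frechet_derivative_works[symmetric] sm_differentiable u)

lemma dd_diff: "sm f \<Longrightarrow> sm g \<Longrightarrow> dd v (\<lambda>x. f x - g x) u = dd v f u - dd v g u"
  by (rule dd_eqI[THEN trans, OF has_derivative_diff]) (auto simp: dd_def frechet_derivative_works[symmetric] sm_differentiable u)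

lemma dd_minus: "sm f \<Longrightarrow> dd v (\<lambda>x. - f x) u = - dd v f u"
  by (rule dd_bounded_linear[OF bounded_linear_minus[OF bounded_linear_ident]]) (simp add: sm_differentiable u)

lemma dd_mult:
  fixes f g :: "_ \<Rightarrow> 'b::real_normed_algebra"
  shows "sm f \<Longrightarrow> sm g \<Longrightarrow> dd v (\<lambda>x. f x * g x) u = f u * dd v g u + dd v f u * g u"
  by (rule dd_bounded_bilinear[OF bounded_bilinear_mult]) (simp_all add: sm_differentiable u)

lemma dd_power2:
  fixes f :: "_ \<Rightarrow> 'b::real_normed_field"
  shows "sm f \<Longrightarrow> dd v (\<lambda>x. (f x)\<^sup>2) u = 2 * f u * dd v f u"
  by (simp add: power2_eq_square dd_mult)

lemma dd_scaleR: "sm f \<Longrightarrow> sm g \<Longrightarrow> dd v (\<lambda>x. f x *\<^sub>R g x) u = f u *\<^sub>R dd v g u + dd v f u *\<^sub>R g u"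
  by (rule dd_bounded_bilinear[OF bounded_bilinear_scaleR]) (simp_all add: sm_differentiable u)

lemma dd_inner: "sm f \<Longrightarrow> sm g \<Longrightarrow> dd v (\<lambda>x. f x \<bullet> g x) u = f u \<bullet> dd v g u + dd v f u \<bullet> g u"
  by (rule dd_bounded_bilinear[OF bounded_bilinear_inner]) (simp_all add: sm_differentiable u)

lemma dd_nth: "sm f \<Longrightarrow> dd v (\<lambda>x. f x $ i) u = dd v f u $ i"
  by (rule dd_bounded_linear[OF bounded_linear_vec_nth]) (simp add: sm_differentiable u)

lemma dd_cnj: "sm f \<Longrightarrow> dd v (\<lambda>x. cnj (f x)) u = cnj (dd v f u)"
  by (rule dd_bounded_linear[OF bounded_linear_cnj]) (simp add: sm_differentiable u)

lemma dd_Re: "sm f \<Longrightarrow> dd v (\<lambda>x. Re (f x)) u = Re (dd v f u)"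
  by (rule dd_bounded_linear[OF bounded_linear_Re]) (simp add: sm_differentiable u)

lemma dd_Im: "sm f \<Longrightarrow> dd v (\<lambda>x. Im (f x)) u = Im (dd v f u)"
  by (rule dd_bounded_linear[OF bounded_linear_Im]) (simp add: sm_differentiable u)

lemma dd_complex_of_real: "sm f \<Longrightarrow> dd v (\<lambda>x. complex_of_real (f x)) u = complex_of_real (dd v f u)"
  by (rule dd_bounded_linear[OF bounded_linear_of_real]) (simp add: sm_differentiable u)

lemma dd_divide:
  fixes f g :: "_ \<Rightarrow> 'b::real_normed_field"
  assumes "sm f" "sm g" "\<And>x. x \<in> V \<Longrightarrow> g x \<noteq> 0"
  shows "dd v (\<lambda>x. f x / g x) u = (dd v f u * g u - f u * dd v g u) / (g u)\<^sup>2"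
  by (rule dd_eqI[THEN trans, OF has_derivative_divide'[of f _ u UNIV g]])
    (use u assms in \<open>auto simp: dd_def frechet_derivative_works[symmetric] sm_differentiable power2_eq_square\<close>)

lemma dd_sqrt:
  assumes "sm f" "\<And>x. x \<in> V \<Longrightarrow> f x > 0"
  shows "dd v (\<lambda>x. sqrt (f x)) u = dd v f u / (2 * sqrt (f u))"
proof -
  have "((\<lambda>x. sqrt (f x)) has_derivative (\<lambda>w. frechet_derivative f (at u) w * (inverse (sqrt (f u)) / 2))) (at u)"
    by (rule DERIV_compose_FDERIV[where g=f and f=sqrt, OF DERIV_real_sqrt[OF assms(2)[OF u]]])
      (use sm_differentiable[OF assms(1) u] frechet_derivative_works in blast)
  from dd_eqI[OF this] show ?thesis by (simp add: dd_def field_simps)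
qed

lemma dd_cong: "sm f \<Longrightarrow> (\<And>x. x \<in> V \<Longrightarrow> f x = g x) \<Longrightarrow> dd v g u = dd v f u"
  unfolding dd_def using frechet_derivative_transform_within_open[OF sm_differentiable[OF _ u] open_V u] by metis

lemma dd_add_field: "sm f \<Longrightarrow> dd (\<lambda>x. v x + w x) f u = dd v f u + dd w f u"
  unfolding dd_def using linear_frechet_derivative[OF sm_differentiable[OF _ u]] linear_add by blast

lemma dd_diff_field: "sm f \<Longrightarrow> dd (\<lambda>x. v x - w x) f u = dd v f u - dd w f u"
  unfolding dd_def using linear_frechet_derivative[OF sm_differentiable[OF _ u]] linear_diff by blast

lemma dd_scaleR_field: "sm f \<Longrightarrow> dd (\<lambda>x. a x *\<^sub>R v x) f u = a u *\<^sub>R dd v f u"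
  unfolding dd_def using linear_frechet_derivative[OF sm_differentiable[OF _ u]] linear_cmul by blast

lemma dd_minus_field: "sm f \<Longrightarrow> dd (\<lambda>x. - v x) f u = - dd v f u"
  unfolding dd_def using linear_frechet_derivative[OF sm_differentiable[OF _ u]] linear_neg by blast

lemma dd_coords: "sm f \<Longrightarrow> dd v f u = v u $ 1 *\<^sub>R pd 1 f u + v u $ 2 *\<^sub>R pd 2 f u"
proof -
  assume f: "sm f"
  have "v u = v u $ 1 *\<^sub>R axis 1 1 + v u $ 2 *\<^sub>R axis 2 1"
    by (simp add: vec_eq_iff forall_2 axis_def)
  then have "dd v f u = dd (\<lambda>x. v u $ 1 *\<^sub>R axis 1 1 + v u $ 2 *\<^sub>R axis 2 1) f u" by (simp add: dd_def)
  then show ?thesis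
    using linear_frechet_derivative[OF sm_differentiable[OF f u]] by (simp add: dd_def pd_def linear_add linear_cmul)
qed

end

lemmas dd_simps = dd_const dd_add dd_diff dd_minus dd_mult dd_power2 dd_scaleR dd_inner dd_nth
  dd_cnj dd_Re dd_Im dd_complex_of_real dd_divide dd_sqrt

lemmas dd_field_simps = dd_add_field dd_diff_field dd_scaleR_field dd_minus_field

lemma sm_pd: "sm f \<Longrightarrow> sm (pd i f)"
  unfolding pd_def[abs_def] using smooth_on_iff_derivative by blast

lemma sm_dd: "sm v \<Longrightarrow> sm f \<Longrightarrow> sm (dd v f)"
  by (rule smooth_on_cong[OF open_V dd_coords[symmetric]]) (simp_all add: sm_simps sm_pd)

lemma dd_dd_coords:
  assumes u: "u \<in> V" and w: "sm w" and f: "sm f"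
  shows "dd v (dd w f) u = w u $ 1 *\<^sub>R dd v (pd 1 f) u + dd v w u $ 1 *\<^sub>R pd 1 f u
     + (w u $ 2 *\<^sub>R dd v (pd 2 f) u + dd v w u $ 2 *\<^sub>R pd 2 f u)"
proof -
  have "dd v (dd w f) u = dd v (\<lambda>x. w x $ 1 *\<^sub>R pd 1 f x + w x $ 2 *\<^sub>R pd 2 f x) u"
    by (rule dd_cong[OF u]) (simp_all add: sm_simps sm_pd f w dd_coords[OF _ f])
  then show ?thesis
    using u by (simp add: dd_simps sm_simps sm_pd f w)
qed

lemma pd_commute:
  fixes f :: "_ \<Rightarrow> 'b::euclidean_space"
  shows "sm f \<Longrightarrow> u \<in> V \<Longrightarrow> pd i (pd j f) u = pd j (pd i f) u"
  unfolding pd_def[abs_def] using mixed_derivatives_commute[OF open_V] by metis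

text \<open>
  The second derivatives cancel by symmetry, so the commutator of the derivations along \<open>v\<close> and
  \<open>w\<close> is the derivation along the Lie bracket of the two fields.
\<close>

lemma dd_commutator:
  fixes f :: "_ \<Rightarrow> 'b::euclidean_space"
  assumes u: "u \<in> V" and v: "sm v" and w: "sm w" and f: "sm f"
  shows "dd v (dd w f) u - dd w (dd v f) u = dd (\<lambda>x. dd v w x - dd w v x) f u"
  unfolding dd_dd_coords[OF u w f] dd_dd_coords[OF u v f]
  using u v w f pd_commute[OF f u, of 2 1]
  by (simp add: sm_dd dd_diff_field dd_coords[of u "pd i f" for i] sm_pd dd_coords[of u f] algebra_simps)

end

section \<open>Curvature of a metric in an orthonormal frame\<close>

lemma matrix_inv_eqI:
  fixes A B :: "real^'n^'n"
  assumes "A ** B = mat 1" shows "matrix_inv A = B"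
proof -
  have BA: "B ** A = mat 1" using assms matrix_left_right_inverse by blast
  have "matrix_inv A ** A = mat 1"
    unfolding matrix_inv_def using someI[of "\<lambda>A'. A ** A' = mat 1 \<and> A' ** A = mat 1" B] assms BA by blast
  then have "matrix_inv A ** (A ** B) = B" by (simp add: matrix_mul_assoc)
  then show ?thesis by (simp add: assms)
qed

context plane_domain
begin

text \<open>
  Cartan's structure equations.  In terms of the connection form \<open>s = - (p \<alpha> + r \<beta>)\<close> the
  Levi-Civita connection is \<open>\<Gamma>\<^sup>k\<^bsub>ij\<^esub> = a\<^sup>k A\<^bsub>ij\<^esub> + b\<^sup>k B\<^bsub>ij\<^esub>\<close>, where \<open>a, b\<close> is the frame dual to
  \<open>\<alpha>, \<beta>\<close>; contracting the curvature tensor with \<open>\<alpha>\<close> and \<open>\<beta>\<close> leaves only \<open>d s\<close>.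
\<close>

lemma metric_curvature_coframe:
  fixes g :: "real^2 \<Rightarrow> real^2^2" and \<alpha> \<beta> :: "real^2 \<Rightarrow> real^2" and p r :: "real^2 \<Rightarrow> real"
  defines "\<Delta> \<equiv> \<lambda>w. \<alpha> w $ 1 * \<beta> w $ 2 - \<alpha> w $ 2 * \<beta> w $ 1"
  assumes sm: "sm \<alpha>" "sm \<beta>" "sm p" "sm r"
    and g: "\<And>w i j. w \<in> V \<Longrightarrow> g w $ i $ j = \<alpha> w $ i * \<alpha> w $ j + \<beta> w $ i * \<beta> w $ j"
    and \<Delta>: "\<And>w. w \<in> V \<Longrightarrow> \<Delta> w \<noteq> 0"
    and d\<alpha>: "\<And>w. w \<in> V \<Longrightarrow> pd 1 (\<lambda>w. \<alpha> w $ 2) w - pd 2 (\<lambda>w. \<alpha> w $ 1) w = - p w * \<Delta> w"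
    and d\<beta>: "\<And>w. w \<in> V \<Longrightarrow> pd 1 (\<lambda>w. \<beta> w $ 2) w - pd 2 (\<lambda>w. \<beta> w $ 1) w = - r w * \<Delta> w"
    and u: "u \<in> V"
  shows "metric_curvature g u =
     (pd 1 (\<lambda>w. p w * \<alpha> w $ 2 + r w * \<beta> w $ 2) u - pd 2 (\<lambda>w. p w * \<alpha> w $ 1 + r w * \<beta> w $ 1) u) / \<Delta> u"
proof -
  define s where "s i w = - (p w * \<alpha> w $ i + r w * \<beta> w $ i)" for i w
  define A where "A i j w = pd i (\<lambda>w. \<alpha> w $ j) w - s i w * \<beta> w $ j" for i j w
  define B where "B i j w = pd i (\<lambda>w. \<beta> w $ j) w + s i w * \<alpha> w $ j" for i j w
  define a where "a k w = (if k = (1::2) then \<beta> w $ 2 else - \<beta> w $ 1) / \<Delta> w" for k w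
  define b where "b k w = (if k = (1::2) then - \<alpha> w $ 2 else \<alpha> w $ 1) / \<Delta> w" for k w
  define G where "G k i j w = a k w * A i j w + b k w * B i j w" for k i j w
  have sm\<Delta>: "sm \<Delta>" unfolding \<Delta>_def by (simp add: sm_simps sm)
  have sms: "sm (s i)" for i unfolding s_def[abs_def] by (simp add: sm_simps sm)
  have smA: "sm (A i j)" "sm (B i j)" for i j unfolding A_def[abs_def] B_def[abs_def]
    by (simp_all add: sm_simps sm sm_pd sms)
  have smab: "sm (a k)" "sm (b k)" for k
    using \<Delta> by (cases "k = 1"; simp add: a_def[abs_def] b_def[abs_def] sm_simps sm sm\<Delta>)+
  have smG: "sm (G k i j)" for k i j unfolding G_def[abs_def] by (simp add: sm_simps smab smA)
  have dual: "\<alpha> w $ 1 * a 1 w + \<alpha> w $ 2 * a 2 w = 1" "\<alpha> w $ 1 * b 1 w + \<alpha> w $ 2 * b 2 w = 0"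
    "\<beta> w $ 1 * a 1 w + \<beta> w $ 2 * a 2 w = 0" "\<beta> w $ 1 * b 1 w + \<beta> w $ 2 * b 2 w = 1" if "w \<in> V" for w
    using \<Delta>[OF that] by (simp_all add: a_def b_def field_simps) (simp_all add: \<Delta>_def algebra_simps)
  have \<alpha>G: "\<alpha> w $ 1 * G 1 i j w + \<alpha> w $ 2 * G 2 i j w = A i j w"
   and \<beta>G: "\<beta> w $ 1 * G 1 i j w + \<beta> w $ 2 * G 2 i j w = B i j w" if "w \<in> V" for w i j
    using dual[OF that] unfolding G_def by algebra+
  have symA: "A 1 2 w = A 2 1 w" and symB: "B 1 2 w = B 2 1 w" if "w \<in> V" for w
    using d\<alpha>[OF that] d\<beta>[OF that] unfolding A_def B_def s_def \<Delta>_def by algebra+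
  have inv: "matrix_inv (g w) $ k $ l = a k w * a l w + b k w * b l w" if w: "w \<in> V" for w k l
  proof -
    have dual': "a i w * \<alpha> w $ j + b i w * \<beta> w $ j = (if i = j then 1 else 0)" for i j
      using \<Delta>[OF w] by (cases rule: exhaust_2[of i, THEN disjE]; cases rule: exhaust_2[of j, THEN disjE])
        (simp_all add: a_def b_def field_simps, simp_all add: \<Delta>_def algebra_simps)
    have "(\<alpha> w $ i * \<alpha> w $ 1 + \<beta> w $ i * \<beta> w $ 1) * (a 1 w * a j w + b 1 w * b j w) +
        (\<alpha> w $ i * \<alpha> w $ 2 + \<beta> w $ i * \<beta> w $ 2) * (a 2 w * a j w + b 2 w * b j w) =
        a j w * \<alpha> w $ i + b j w * \<beta> w $ i" for i j
      using dual[OF w] by algebra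
    then have "g w ** (\<chi> k l. a k w * a l w + b k w * b l w) = mat 1"
      using dual' by (simp add: vec_eq_iff matrix_matrix_mult_def sum_2 mat_def g[OF w])
    from matrix_inv_eqI[OF this] show ?thesis by simp
  qed
  have pdg: "pd i (\<lambda>w. g w $ j $ l) w = A i j w * \<alpha> w $ l + B i j w * \<beta> w $ l + A i l w * \<alpha> w $ j + B i l w * \<beta> w $ j"
    if w: "w \<in> V" for w i j l
  proof -
    have "pd i (\<lambda>w. g w $ j $ l) w = pd i (\<lambda>w. \<alpha> w $ j * \<alpha> w $ l + \<beta> w $ j * \<beta> w $ l) w"
      unfolding pd_eq_dd by (rule dd_cong[OF w]) (simp_all add: g sm sm_simps)
    then show ?thesis
      using w by (simp add: pd_eq_dd dd_simps sm sm_simps A_def B_def algebra_simps)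
  qed
  have chr: "christoffel g k i j w = G k i j w" if w: "w \<in> V" for w k i j
  proof -
    have sym: "A i j w = A j i w" "B i j w = B j i w" for i j
      using symA[OF w] symB[OF w] exhaust_2[of i] exhaust_2[of j] by auto
    have br: "(pd i (\<lambda>w. g w $ j $ l) w + pd j (\<lambda>w. g w $ i $ l) w - pd l (\<lambda>w. g w $ i $ j) w)
        = 2 * (A i j w * \<alpha> w $ l + B i j w * \<beta> w $ l)" for l
      unfolding pdg[OF w] using sym[of i j] sym[of i l] sym[of j l] by (simp add: algebra_simps)
    show ?thesis
      unfolding christoffel_def br sum_2 inv[OF w] G_def using dual[OF w] by algebra
  qed
  have pdc: "pd m (christoffel g k i j) u = pd m (G k i j) u" for m k i j
    unfolding pd_eq_dd by (rule dd_cong[OF u smG]) (simp add: chr)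
  define R where "R l = riemann g l 1 2 2 u" for l
  have R: "R l = pd 1 (G l 2 2) u - pd 2 (G l 1 2) u
       + (G l 1 1 u * G 1 2 2 u - G l 2 1 u * G 1 1 2 u + (G l 1 2 u * G 2 2 2 u - G l 2 2 u * G 2 1 2 u))" for l
    unfolding R_def riemann_def pdc sum_2 chr[OF u] by simp
  define ds where "ds = pd 1 (s 2) u - pd 2 (s 1) u"
  \<comment> \<open>used for \<open>(\<gamma>, \<delta>, \<sigma>) = (\<alpha>, \<beta>, 1)\<close> and \<open>(\<beta>, \<alpha>, -1)\<close>\<close>
  have contract: "\<gamma> u $ 1 * R 1 + \<gamma> u $ 2 * R 2 = - \<sigma> * ds * \<delta> u $ 2"
    if sm': "sm \<gamma>" "sm \<delta>"
      and \<gamma>G: "\<And>w i j. w \<in> V \<Longrightarrow> \<gamma> w $ 1 * G 1 i j w + \<gamma> w $ 2 * G 2 i j w = pd i (\<lambda>w. \<gamma> w $ j) w - \<sigma> * s i w * \<delta> w $ j"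
      and \<delta>G: "\<And>i j. \<delta> u $ 1 * G 1 i j u + \<delta> u $ 2 * G 2 i j u = pd i (\<lambda>w. \<delta> w $ j) u + \<sigma> * s i u * \<gamma> u $ j"
    for \<gamma> \<delta> :: "real^2 \<Rightarrow> real^2" and \<sigma> :: real
  proof -
    define C where "C i j w = pd i (\<lambda>w. \<gamma> w $ j) w - \<sigma> * s i w * \<delta> w $ j" for i j w
    have smC: "sm (C i j)" for i j unfolding C_def[abs_def] by (simp add: sm_simps sm' sm_pd sms)
    have dC: "\<gamma> u $ 1 * pd m (G 1 i j) u + \<gamma> u $ 2 * pd m (G 2 i j) u =
        pd m (C i j) u - pd m (\<lambda>w. \<gamma> w $ 1) u * G 1 i j u - pd m (\<lambda>w. \<gamma> w $ 2) u * G 2 i j u" for m i j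
    proof -
      have "pd m (C i j) u = pd m (\<lambda>w. \<gamma> w $ 1 * G 1 i j w + \<gamma> w $ 2 * G 2 i j w) u"
        unfolding pd_eq_dd[of m] by (rule dd_cong[OF u]) (simp_all add: \<gamma>G C_def sm' sm_simps smG)
      then show ?thesis
        using u by (simp add: pd_eq_dd dd_simps sm' sm_simps smG)
    qed
    have pdC: "pd m (C i j) u = pd m (pd i (\<lambda>w. \<gamma> w $ j)) u
        - \<sigma> * (s i u * pd m (\<lambda>w. \<delta> w $ j) u + pd m (s i) u * \<delta> u $ j)" for m i j
      using u unfolding C_def[abs_def] pd_eq_dd by (simp add: dd_simps sm' sm_simps sms sm_dd algebra_simps)
    have "\<gamma> u $ 1 * R 1 + \<gamma> u $ 2 * R 2 =
       (\<gamma> u $ 1 * pd 1 (G 1 2 2) u + \<gamma> u $ 2 * pd 1 (G 2 2 2) u)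
       - (\<gamma> u $ 1 * pd 2 (G 1 1 2) u + \<gamma> u $ 2 * pd 2 (G 2 1 2) u)
       + (\<gamma> u $ 1 * G 1 1 1 u + \<gamma> u $ 2 * G 2 1 1 u) * G 1 2 2 u
       - (\<gamma> u $ 1 * G 1 2 1 u + \<gamma> u $ 2 * G 2 2 1 u) * G 1 1 2 u
       + (\<gamma> u $ 1 * G 1 1 2 u + \<gamma> u $ 2 * G 2 1 2 u) * G 2 2 2 u
       - (\<gamma> u $ 1 * G 1 2 2 u + \<gamma> u $ 2 * G 2 2 2 u) * G 2 1 2 u"
      unfolding R by algebra
    also have "\<dots> = pd 1 (C 2 2) u - pd 2 (C 1 2) u
       - \<sigma> * s 1 u * (\<delta> u $ 1 * G 1 2 2 u + \<delta> u $ 2 * G 2 2 2 u) + \<sigma> * s 2 u * (\<delta> u $ 1 * G 1 1 2 u + \<delta> u $ 2 * G 2 1 2 u)"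
      unfolding dC \<gamma>G[OF u] by algebra
    also have "\<dots> = - \<sigma> * ds * \<delta> u $ 2"
      unfolding \<delta>G pdC ds_def
      using pd_commute[of "\<lambda>w. \<gamma> w $ 2" u 1 2] u by (simp add: sm' sm_simps algebra_simps)
    finally show ?thesis .
  qed
  have \<alpha>R: "\<alpha> u $ 1 * R 1 + \<alpha> u $ 2 * R 2 = - ds * \<beta> u $ 2"
    using contract[of \<alpha> \<beta> 1] sm(1,2) u by (simp add: \<alpha>G \<beta>G A_def B_def)
  have \<beta>R: "\<beta> u $ 1 * R 1 + \<beta> u $ 2 * R 2 = ds * \<alpha> u $ 2"
    using contract[of \<beta> \<alpha> "- 1"] sm(1,2) u by (simp add: \<alpha>G \<beta>G A_def B_def)
  have det: "det (g u) = \<Delta> u * \<Delta> u" by (simp add: det_2 g[OF u] \<Delta>_def algebra_simps)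
  have "g u $ 1 $ 1 * R 1 + g u $ 1 $ 2 * R 2 = - ds * \<Delta> u"
    unfolding g[OF u] \<Delta>_def using \<alpha>R \<beta>R by algebra
  then have "metric_curvature g u = - ds / \<Delta> u"
    unfolding metric_curvature_def sum_2 R_def[symmetric] det using \<Delta>[OF u] by simp
  moreover have "ds = - (pd 1 (\<lambda>w. p w * \<alpha> w $ 2 + r w * \<beta> w $ 2) u - pd 2 (\<lambda>w. p w * \<alpha> w $ 1 + r w * \<beta> w $ 1) u)"
    unfolding ds_def s_def[abs_def] pd_eq_dd using u by (simp add: dd_simps sm sm_simps)
  ultimately show ?thesis by simp
qed

text \<open>
  The dual forms have \<open>d \<alpha> = - p \<alpha> \<and> \<beta>\<close> and \<open>d \<beta> = - r \<alpha> \<and> \<beta>\<close>, which turns the structure equations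
  into a formula in the bracket coefficients.
\<close>

lemma metric_curvature_frame:
  fixes g :: "real^2 \<Rightarrow> real^2^2" and e1 e2 :: "real^2 \<Rightarrow> real^2" and p r :: "real^2 \<Rightarrow> real"
  assumes sm: "sm e1" "sm e2" "sm p" "sm r"
    and independent: "\<And>w. w \<in> V \<Longrightarrow> wedge e1 e2 w \<noteq> 0"
    and orthonormal: "\<And>w. w \<in> V \<Longrightarrow> e1 w \<bullet> (g w *v e1 w) = 1" "\<And>w. w \<in> V \<Longrightarrow> e1 w \<bullet> (g w *v e2 w) = 0"
      "\<And>w. w \<in> V \<Longrightarrow> e2 w \<bullet> (g w *v e1 w) = 0" "\<And>w. w \<in> V \<Longrightarrow> e2 w \<bullet> (g w *v e2 w) = 1"
    and bracket: "\<And>w. w \<in> V \<Longrightarrow> dd e1 e2 w - dd e2 e1 w = p w *\<^sub>R e1 w + r w *\<^sub>R e2 w"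
    and u: "u \<in> V"
  shows "metric_curvature g u = dd e1 r u - dd e2 p u - (p u)\<^sup>2 - (r u)\<^sup>2"
proof -
  define d where "d w = wedge e1 e2 w" for w
  define \<alpha> :: "real^2 \<Rightarrow> real^2" where "\<alpha> w = (e2 w $ 2 / d w) *\<^sub>R axis 1 1 + (- e2 w $ 1 / d w) *\<^sub>R axis 2 1" for w
  define \<beta> :: "real^2 \<Rightarrow> real^2" where "\<beta> w = (- e1 w $ 2 / d w) *\<^sub>R axis 1 1 + (e1 w $ 1 / d w) *\<^sub>R axis 2 1" for w
  have d: "d w \<noteq> 0" if "w \<in> V" for w using independent[OF that] by (simp add: d_def)
  have smd: "sm d" unfolding d_def[abs_def] by (simp add: sm_simps sm)
  have sm\<alpha>: "sm \<alpha>" "sm \<beta>" unfolding \<alpha>_def[abs_def] \<beta>_def[abs_def] using d by (simp_all add: sm_simps sm smd)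
  have comps: "\<alpha> w $ 1 = e2 w $ 2 / d w" "\<alpha> w $ 2 = - e2 w $ 1 / d w"
    "\<beta> w $ 1 = - e1 w $ 2 / d w" "\<beta> w $ 2 = e1 w $ 1 / d w" for w
    by (simp_all add: \<alpha>_def \<beta>_def axis_def)
  have dual: "\<alpha> w \<bullet> e1 w = 1" "\<alpha> w \<bullet> e2 w = 0" "\<beta> w \<bullet> e1 w = 0" "\<beta> w \<bullet> e2 w = 1" if "w \<in> V" for w
    using d[OF that] by (simp_all add: inner_vec_def sum_2 comps field_simps) (simp_all add: d_def algebra_simps)
  have det: "\<alpha> w $ 1 * \<beta> w $ 2 - \<alpha> w $ 2 * \<beta> w $ 1 = 1 / d w" if "w \<in> V" for w
    using d[OF that] by (simp add: comps field_simps) (simp add: d_def algebra_simps)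
  have g: "g w $ i $ j = \<alpha> w $ i * \<alpha> w $ j + \<beta> w $ i * \<beta> w $ j" if w: "w \<in> V" for w i j
  proof -
    have ax: "axis i 1 = \<alpha> w $ i *\<^sub>R e1 w + \<beta> w $ i *\<^sub>R e2 w" for i
      using d[OF w] exhaust_2[of i]
      by (auto simp: vec_eq_iff forall_2 axis_def comps field_simps) (auto simp: d_def algebra_simps)
    have "g w $ i $ j = axis i 1 \<bullet> (g w *v axis j 1)"
      by (simp add: matrix_vector_mul_component inner_axis' inner_axis)
    then show ?thesis unfolding ax
      by (simp add: inner_add_left inner_add_right matrix_vector_right_distrib orthonormal[OF w]
          matrix_vector_mult_scaleR)
  qed
  \<comment> \<open>\<open>d\<alpha>(e\<^sub>1, e\<^sub>2) = - \<alpha>([e\<^sub>1, e\<^sub>2])\<close> for a form with constant values on the frame\<close>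
  have curl: "pd 1 (\<lambda>w. \<gamma> w $ 2) w - pd 2 (\<lambda>w. \<gamma> w $ 1) w = - (p w * a1 + r w * a2) * (1 / d w)"
    if w: "w \<in> V" and \<gamma>: "sm \<gamma>" and c: "\<And>w. w \<in> V \<Longrightarrow> \<gamma> w \<bullet> e1 w = a1" "\<And>w. w \<in> V \<Longrightarrow> \<gamma> w \<bullet> e2 w = a2"
    for \<gamma> :: "real^2 \<Rightarrow> real^2" and w a1 a2
  proof -
    have z: "dd v (\<lambda>x. \<gamma> x \<bullet> e x) w = 0" if "\<And>w. w \<in> V \<Longrightarrow> \<gamma> w \<bullet> e w = a" for v e a
      using dd_cong[OF w, of "\<lambda>x. a" "\<lambda>x. \<gamma> x \<bullet> e x" v] that by (simp add: smooth_on_const dd_const[OF w])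
    have 1: "\<gamma> w \<bullet> dd e2 e1 w + dd e2 \<gamma> w \<bullet> e1 w = 0" "\<gamma> w \<bullet> dd e1 e2 w + dd e1 \<gamma> w \<bullet> e2 w = 0"
      using z[of e1 a1 e2] z[of e2 a2 e1] c by (simp_all add: dd_inner[OF w \<gamma>] sm)
    have "\<gamma> w \<bullet> (dd e1 e2 w - dd e2 e1 w) = p w * a1 + r w * a2"
      unfolding bracket[OF w] by (simp add: inner_add_right c[OF w])
    then have "dd e1 \<gamma> w \<bullet> e2 w - dd e2 \<gamma> w \<bullet> e1 w = - (p w * a1 + r w * a2)"
      using 1 by (simp add: inner_diff_right)
    moreover have "dd e1 \<gamma> w \<bullet> e2 w - dd e2 \<gamma> w \<bullet> e1 w = d w * (pd 1 (\<lambda>w. \<gamma> w $ 2) w - pd 2 (\<lambda>w. \<gamma> w $ 1) w)"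
      unfolding dd_coords[OF w \<gamma>, of e1] dd_coords[OF w \<gamma>, of e2]
      by (simp add: inner_vec_def sum_2 pd_eq_dd dd_nth[OF w \<gamma>] d_def algebra_simps)
    ultimately show ?thesis using d[OF w] by (simp add: field_simps)
  qed
  have curls: "pd 1 (\<lambda>w. \<alpha> w $ 2) w - pd 2 (\<lambda>w. \<alpha> w $ 1) w = - p w * (1 / d w)"
     "pd 1 (\<lambda>w. \<beta> w $ 2) w - pd 2 (\<lambda>w. \<beta> w $ 1) w = - r w * (1 / d w)" if "w \<in> V" for w
    using curl[OF that sm\<alpha>(1) dual(1,2)] curl[OF that sm\<alpha>(2) dual(3,4)] by simp_all
  have "metric_curvature g u =
     (pd 1 (\<lambda>w. p w * \<alpha> w $ 2 + r w * \<beta> w $ 2) u - pd 2 (\<lambda>w. p w * \<alpha> w $ 1 + r w * \<beta> w $ 1) u) / (\<alpha> u $ 1 * \<beta> u $ 2 - \<alpha> u $ 2 * \<beta> u $ 1)"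
    using d curls
    by (intro metric_curvature_coframe[OF sm\<alpha> sm(3,4) g _ _ _ u]) (simp_all add: det)
  also have "\<dots> = d u * (p u * (pd 1 (\<lambda>w. \<alpha> w $ 2) u - pd 2 (\<lambda>w. \<alpha> w $ 1) u)
      + r u * (pd 1 (\<lambda>w. \<beta> w $ 2) u - pd 2 (\<lambda>w. \<beta> w $ 1) u)
      + (pd 1 p u * \<alpha> u $ 2 - pd 2 p u * \<alpha> u $ 1) + (pd 1 r u * \<beta> u $ 2 - pd 2 r u * \<beta> u $ 1))"
    unfolding det[OF u] pd_eq_dd using u by (simp add: dd_simps sm sm_simps sm\<alpha> algebra_simps)
  also have "\<dots> = dd e1 r u - dd e2 p u - (p u)\<^sup>2 - (r u)\<^sup>2"
    unfolding curls[OF u] unfolding comps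
    unfolding dd_coords[OF u sm(4), of e1] dd_coords[OF u sm(3), of e2]
    using d[OF u] by (simp add: field_simps power2_eq_square)
  finally show ?thesis .
qed

end

section \<open>Frames in the plane and complex derivations\<close>

text \<open>
  The functions \<open>p\<close> and \<open>r\<close> carry the connection: in the metric that makes the frame orthonormal, with
  dual forms \<open>\<omega>\<^sub>1, \<omega>\<^sub>2\<close>, the connection form is \<open>- (p \<omega>\<^sub>1 + r \<omega>\<^sub>2)\<close>.
\<close>

locale plane_frame = plane_domain +
  fixes e1 e2 :: "real^2 \<Rightarrow> real^2" and p r :: "real^2 \<Rightarrow> real"
  assumes sm_frame: "smooth_on V e1" "smooth_on V e2" "smooth_on V p" "smooth_on V r"
    and oriented: "\<And>u. u \<in> V \<Longrightarrow> wedge e1 e2 u > 0"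
    and bracket: "\<And>u. u \<in> V \<Longrightarrow> dd e1 e2 u - dd e2 e1 u = p u *\<^sub>R e1 u + r u *\<^sub>R e2 u"
begin

lemma independent: "u \<in> V \<Longrightarrow> wedge e1 e2 u \<noteq> 0"
  using oriented by force

lemma sm_dd_frame: "sm f \<Longrightarrow> sm (dd e1 f)" "sm f \<Longrightarrow> sm (dd e2 f)"
  by (simp_all add: sm_dd sm_frame)

lemma frame_commutator:
  fixes f :: "_ \<Rightarrow> 'b::euclidean_space"
  assumes u: "u \<in> V" and f: "sm f"
  shows "dd e1 (dd e2 f) u - dd e2 (dd e1 f) u = p u *\<^sub>R dd e1 f u + r u *\<^sub>R dd e2 f u"
proof -
  have "dd e1 (dd e2 f) u - dd e2 (dd e1 f) u = dd (\<lambda>x. dd e1 e2 x - dd e2 e1 x) f u"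
    by (rule dd_commutator[OF u sm_frame(1,2) f])
  also have "\<dots> = dd (\<lambda>x. p x *\<^sub>R e1 x + r x *\<^sub>R e2 x) f u"
    unfolding dd_def[of _ f] using bracket[OF u] by simp
  finally show ?thesis by (simp add: dd_field_simps u f)
qed

definition D :: "(real^2 \<Rightarrow> complex) \<Rightarrow> real^2 \<Rightarrow> complex" where
  "D f u = dd e1 f u - \<i> * dd e2 f u"

definition Db :: "(real^2 \<Rightarrow> complex) \<Rightarrow> real^2 \<Rightarrow> complex" where
  "Db f u = dd e1 f u + \<i> * dd e2 f u"

definition c :: "real^2 \<Rightarrow> complex" where
  "c u = Complex (r u) (p u)"

lemma sm_D: "sm f \<Longrightarrow> sm (D f)" "sm f \<Longrightarrow> sm (Db f)"
  unfolding D_def[abs_def] Db_def[abs_def] by (simp_all add: sm_simps sm_dd_frame)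

context
  fixes u assumes u: "u \<in> V"
begin

lemma D_const: "D (\<lambda>x. a) u = 0" "Db (\<lambda>x. a) u = 0"
  by (simp_all add: D_def Db_def dd_simps u)

lemma D_add: "sm f \<Longrightarrow> sm g \<Longrightarrow> D (\<lambda>x. f x + g x) u = D f u + D g u"
   "sm f \<Longrightarrow> sm g \<Longrightarrow> Db (\<lambda>x. f x + g x) u = Db f u + Db g u"
  by (simp_all add: D_def Db_def dd_simps u algebra_simps)

lemma D_diff: "sm f \<Longrightarrow> sm g \<Longrightarrow> D (\<lambda>x. f x - g x) u = D f u - D g u"
   "sm f \<Longrightarrow> sm g \<Longrightarrow> Db (\<lambda>x. f x - g x) u = Db f u - Db g u"
  by (simp_all add: D_def Db_def dd_simps u algebra_simps)

lemma D_mult: "sm f \<Longrightarrow> sm g \<Longrightarrow> D (\<lambda>x. f x * g x) u = f u * D g u + D f u * g u"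
   "sm f \<Longrightarrow> sm g \<Longrightarrow> Db (\<lambda>x. f x * g x) u = f u * Db g u + Db f u * g u"
  by (simp_all add: D_def Db_def dd_simps u algebra_simps)

lemma D_divide:
  assumes "sm f" "sm g" "\<And>x. x \<in> V \<Longrightarrow> g x \<noteq> 0"
  shows "D (\<lambda>x. f x / g x) u = (D f u * g u - f u * D g u) / (g u)\<^sup>2"
   "Db (\<lambda>x. f x / g x) u = (Db f u * g u - f u * Db g u) / (g u)\<^sup>2"
  using assms(3)[OF u] by (simp_all add: D_def Db_def dd_divide u assms field_simps)

lemma D_cnj: "sm f \<Longrightarrow> D (\<lambda>x. cnj (f x)) u = cnj (Db f u)" "sm f \<Longrightarrow> Db (\<lambda>x. cnj (f x)) u = cnj (D f u)"
  by (simp_all add: D_def Db_def dd_simps u)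

lemma D_cong: "sm f \<Longrightarrow> (\<And>x. x \<in> V \<Longrightarrow> f x = g x) \<Longrightarrow> D g u = D f u"
    "sm f \<Longrightarrow> (\<And>x. x \<in> V \<Longrightarrow> f x = g x) \<Longrightarrow> Db g u = Db f u"
  unfolding D_def Db_def using dd_cong[OF u, of f g] by metis+

lemma Db_of_real: "sm f \<Longrightarrow> D (\<lambda>x. complex_of_real (f x)) u = Complex (dd e1 f u) (- dd e2 f u)"
    "sm f \<Longrightarrow> Db (\<lambda>x. complex_of_real (f x)) u = Complex (dd e1 f u) (dd e2 f u)"
  by (simp_all add: D_def Db_def dd_simps u complex_eq_iff)

end

lemmas D_simps = D_const D_add D_diff D_mult D_divide D_cnj

text \<open>
  Through this identity \<open>c\<close> plays the role of the Christoffel symbols in all complex equations below.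
\<close>

lemma D_commutator:
  assumes u: "u \<in> V" and f: "sm f"
  shows "D (Db f) u - Db (D f) u = c u * Db f u - cnj (c u) * D f u"
proof -
  have "D (Db f) u - Db (D f) u = 2 * \<i> * (dd e1 (dd e2 f) u - dd e2 (dd e1 f) u)"
    unfolding D_def Db_def using u f by (simp add: dd_simps sm_simps sm_dd_frame algebra_simps)
  also have "\<dots> = c u * Db f u - cnj (c u) * D f u"
    unfolding frame_commutator[OF u f] D_def Db_def
    by (simp add: scaleR_conv_of_real complex_eq_iff c_def algebra_simps)
  finally show ?thesis .
qed

text \<open>
  The frame rotated and scaled by a complex function \<open>\<kappa>\<close>, so that the derivation \<open>X - \<i> Y\<close> is
  \<open>\<kappa> (e\<^sub>1 - \<i> e\<^sub>2)\<close>.  Its bracket vanishes iff the dual form \<open>\<kappa>\<^sup>-\<^sup>1 (\<omega>\<^sub>1 + \<i> \<omega>\<^sub>2)\<close> is closed.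
\<close>

definition rot1 :: "(real^2 \<Rightarrow> complex) \<Rightarrow> real^2 \<Rightarrow> real^2" where
  "rot1 \<kappa> u = Re (\<kappa> u) *\<^sub>R e1 u + Im (\<kappa> u) *\<^sub>R e2 u"

definition rot2 :: "(real^2 \<Rightarrow> complex) \<Rightarrow> real^2 \<Rightarrow> real^2" where
  "rot2 \<kappa> u = - Im (\<kappa> u) *\<^sub>R e1 u + Re (\<kappa> u) *\<^sub>R e2 u"

lemma sm_rot: "sm \<kappa> \<Longrightarrow> sm (rot1 \<kappa>)" "sm \<kappa> \<Longrightarrow> sm (rot2 \<kappa>)"
  unfolding rot1_def[abs_def] rot2_def[abs_def] by (simp_all add: sm_simps sm_frame)

lemma dd_rot:
  assumes "u \<in> V" "sm f"
  shows "dd (rot1 \<kappa>) f u = Re (\<kappa> u) *\<^sub>R dd e1 f u + Im (\<kappa> u) *\<^sub>R dd e2 f u"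
    "dd (rot2 \<kappa>) f u = - Im (\<kappa> u) *\<^sub>R dd e1 f u + Re (\<kappa> u) *\<^sub>R dd e2 f u"
  unfolding rot1_def[abs_def] rot2_def[abs_def] by (simp_all only: dd_field_simps assms)

lemma rot_bracket:
  assumes u: "u \<in> V" and \<kappa>: "sm \<kappa>" and w: "w = cnj (\<kappa> u) * (Db \<kappa> u + cnj (c u) * \<kappa> u)"
  shows "dd (rot1 \<kappa>) (rot2 \<kappa>) u - dd (rot2 \<kappa>) (rot1 \<kappa>) u = - Im w *\<^sub>R e1 u + Re w *\<^sub>R e2 u"
proof -
  have Re_w: "Re w = Re (\<kappa> u) * (dd e1 (\<lambda>x. Re (\<kappa> x)) u - dd e2 (\<lambda>x. Im (\<kappa> x)) u)
      + Im (\<kappa> u) * (dd e1 (\<lambda>x. Im (\<kappa> x)) u + dd e2 (\<lambda>x. Re (\<kappa> x)) u) + ((Re (\<kappa> u))\<^sup>2 + (Im (\<kappa> u))\<^sup>2) * r u"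
   and Im_w: "Im w = Re (\<kappa> u) * (dd e1 (\<lambda>x. Im (\<kappa> x)) u + dd e2 (\<lambda>x. Re (\<kappa> x)) u)
      - Im (\<kappa> u) * (dd e1 (\<lambda>x. Re (\<kappa> x)) u - dd e2 (\<lambda>x. Im (\<kappa> x)) u) - ((Re (\<kappa> u))\<^sup>2 + (Im (\<kappa> u))\<^sup>2) * p u"
    by (simp_all add: w Db_def c_def dd_Re[OF u \<kappa>] dd_Im[OF u \<kappa>] power2_eq_square algebra_simps)
  have e2: "dd e1 e2 u = dd e2 e1 u + p u *\<^sub>R e1 u + r u *\<^sub>R e2 u" using bracket[OF u] by (simp add: algebra_simps)
  show ?thesis
    unfolding dd_rot[OF u sm_rot(1)[OF \<kappa>]] dd_rot[OF u sm_rot(2)[OF \<kappa>]]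
    unfolding rot1_def[abs_def] rot2_def[abs_def] Re_w Im_w
    using u by (simp add: dd_simps sm_simps sm_frame \<kappa> e2) (simp add: algebra_simps power2_eq_square)
qed

end

text \<open>
  The classical formula \<open>K = - \<Delta> log \<rho> / (2 \<rho>)\<close>; a pair of commuting fields does the work of isothermal
  coordinates.
\<close>

lemma (in plane_domain) metric_curvature_conformal:
  fixes g :: "real^2 \<Rightarrow> real^2^2" and X Y :: "real^2 \<Rightarrow> real^2" and \<rho> :: "real^2 \<Rightarrow> real"
  assumes sm: "sm X" "sm Y" "sm \<rho>" and \<rho>: "\<And>w. w \<in> V \<Longrightarrow> \<rho> w > 0"
    and oriented: "\<And>w. w \<in> V \<Longrightarrow> wedge X Y w > 0"
    and conformal: "\<And>w. w \<in> V \<Longrightarrow> X w \<bullet> (g w *v X w) = \<rho> w" "\<And>w. w \<in> V \<Longrightarrow> X w \<bullet> (g w *v Y w) = 0"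
      "\<And>w. w \<in> V \<Longrightarrow> Y w \<bullet> (g w *v X w) = 0" "\<And>w. w \<in> V \<Longrightarrow> Y w \<bullet> (g w *v Y w) = \<rho> w"
    and commute: "\<And>w. w \<in> V \<Longrightarrow> dd X Y w = dd Y X w"
    and u: "u \<in> V"
  shows "metric_curvature g u =
    - (dd X (\<lambda>w. dd X \<rho> w / \<rho> w) u + dd Y (\<lambda>w. dd Y \<rho> w / \<rho> w) u) / (2 * \<rho> u)"
proof -
  interpret XY: plane_frame V X Y "\<lambda>_. 0" "\<lambda>_. 0"
    using oriented by unfold_locales (simp_all add: sm smooth_on_const commute)
  define k where "k w = 1 / sqrt (\<rho> w)" for w
  have \<rho>0: "\<rho> w \<noteq> 0" "sqrt (\<rho> w) \<noteq> 0" if "w \<in> V" for w using \<rho>[OF that] by auto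
  have smk: "sm k" unfolding k_def[abs_def] using \<rho> \<rho>0 by (simp add: sm_simps sm)
  have kpos: "k w > 0" "k w * k w * \<rho> w = 1" if "w \<in> V" for w
    using \<rho>[OF that] by (simp_all add: k_def)
  have smkc: "sm (\<lambda>w. complex_of_real (k w))" by (simp add: sm_simps smk)
  define E1 where "E1 = (\<lambda>w. k w *\<^sub>R X w)"
  define E2 where "E2 = (\<lambda>w. k w *\<^sub>R Y w)"
  have E: "XY.rot1 (\<lambda>w. complex_of_real (k w)) = E1" "XY.rot2 (\<lambda>w. complex_of_real (k w)) = E2"
    by (simp_all add: XY.rot1_def XY.rot2_def E1_def E2_def fun_eq_iff)
  have smE: "sm E1" "sm E2" unfolding E1_def E2_def by (simp_all add: sm_simps sm smk)
  have br: "dd E1 E2 w - dd E2 E1 w = - dd Y k w *\<^sub>R E1 w + dd X k w *\<^sub>R E2 w" if w: "w \<in> V" for w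
    using XY.rot_bracket[OF w smkc refl] unfolding E
    by (simp add: XY.Db_of_real[OF w smk] XY.c_def E1_def E2_def mult.commute)
  have "metric_curvature g u = dd E1 (dd X k) u - dd E2 (\<lambda>w. - dd Y k w) u - (- dd Y k u)\<^sup>2 - (dd X k u)\<^sup>2"
  proof (rule metric_curvature_frame[OF smE _ _ _ _ _ _ _ br u])
    show "sm (\<lambda>w. - dd Y k w)" "sm (dd X k)" by (simp_all add: sm_simps sm_dd sm smk)
    fix w assume w: "w \<in> V"
    have "wedge E1 E2 w = k w * k w * (wedge X Y w)"
      by (simp add: E1_def E2_def algebra_simps)
    then show "wedge E1 E2 w \<noteq> 0"
      using oriented[OF w] kpos[OF w] by simp
    show "E1 w \<bullet> (g w *v E1 w) = 1" "E1 w \<bullet> (g w *v E2 w) = 0" "E2 w \<bullet> (g w *v E1 w) = 0" "E2 w \<bullet> (g w *v E2 w) = 1"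
      using conformal[OF w] kpos[OF w] by (simp_all add: E1_def E2_def matrix_vector_mult_scaleR)
  qed
  also have "\<dots> = k u * dd X (dd X k) u - (dd X k u)\<^sup>2 + (k u * dd Y (dd Y k) u - (dd Y k u)\<^sup>2)"
    unfolding E1_def E2_def using u by (simp add: dd_scaleR_field dd_minus sm_simps sm sm_dd smk)
  finally have 3: "metric_curvature g u = k u * dd X (dd X k) u - (dd X k u)\<^sup>2 + (k u * dd Y (dd Y k) u - (dd Y k u)\<^sup>2)" .
  have 4: "k u * dd v (dd v k) u - (dd v k u)\<^sup>2 = - (dd v (\<lambda>w. dd v \<rho> w / \<rho> w) u) / (2 * \<rho> u)" if v: "sm v" for v
  proof -
    define y where "y w = dd v \<rho> w / \<rho> w" for w
    have smy: "sm y" unfolding y_def[abs_def] using \<rho>0 by (simp add: sm_simps sm_dd v sm)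
    have 1: "dd v k w = - (k w * y w) / 2" if w: "w \<in> V" for w
      using \<rho>[OF w] \<rho> \<rho>0
      by (simp add: k_def[abs_def] dd_divide[OF w] dd_sqrt[OF w] dd_const[OF w] sm_simps sm y_def field_simps)
    have "dd v (dd v k) u = dd v (\<lambda>w. - (k w * y w) / 2) u"
      by (rule dd_cong[OF u]) (simp_all add: 1 sm_simps smk smy)
    also have "\<dots> = - (k u * dd v y u + dd v k u * y u) / 2"
      using u smy by (simp only: dd_divide dd_minus dd_mult dd_const smk sm_simps) simp
    finally have 2: "dd v (dd v k) u = - (k u * dd v y u + dd v k u * y u) / 2" .
    have "k u * dd v (dd v k) u - (dd v k u)\<^sup>2 = - (k u * k u) * dd v y u / 2"
      unfolding 2 1[OF u] by (simp add: power2_eq_square field_simps)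
    moreover have "k u * k u = 1 / \<rho> u" using kpos[OF u] \<rho>0[OF u] by (simp add: field_simps)
    ultimately show ?thesis by (simp add: y_def[abs_def])
  qed
  show ?thesis unfolding 3 4[OF sm(1)] 4[OF sm(2)] by (simp add: add_divide_distrib diff_divide_distrib)
qed

section \<open>Moving frames on surfaces in space\<close>

lemma matrix_mult_transpose_nth:
  fixes A B :: "real^'n^'m"
  shows "(A ** transpose B) $ i $ j = A $ i \<bullet> B $ j"
  by (simp add: matrix_matrix_mult_def transpose_def inner_vec_def)

lemma matrix_sandwich_nth:
  fixes A C :: "real^'n^'m" and B :: "real^'n^'n"
  shows "(A ** (B ** transpose C)) $ i $ j = A $ i \<bullet> (B *v C $ j)"
  by (simp add: matrix_matrix_mult_def matrix_vector_mult_def transpose_def inner_vec_def)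

lemma orthonormal_expand:
  fixes a b x y :: "real^3"
  assumes "a \<bullet> a = 1" "b \<bullet> b = 1" "a \<bullet> b = 0"
  shows "x = (x \<bullet> a) *\<^sub>R a + (x \<bullet> b) *\<^sub>R b + (x \<bullet> cross3 a b) *\<^sub>R cross3 a b"
    and "x \<bullet> y = (x \<bullet> a) * (y \<bullet> a) + (x \<bullet> b) * (y \<bullet> b) + (x \<bullet> cross3 a b) * (y \<bullet> cross3 a b)"
    and "cross3 a b \<bullet> cross3 a b = 1"
proof -
  let ?n = "cross3 a b"
  show nn: "?n \<bullet> ?n = 1"
    using norm_cross_dot[of a b] assms by (simp add: power2_norm_eq_inner norm_eq_sqrt_inner)
  define A :: "real^3^3" where "A = vector [a, b, ?n]"
  have rows: "A $ 1 = a" "A $ 2 = b" "A $ 3 = ?n" by (simp_all add: A_def vector_3)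
  have "A ** transpose A = mat 1"
    using assms nn
    by (simp add: vec_eq_iff forall_3 matrix_mult_transpose_nth mat_def rows dot_cross_self inner_commute[of b a])
  then have tA: "transpose A ** A = mat 1" using matrix_left_right_inverse by blast
  have Ax: "A *v x = vector [x \<bullet> a, x \<bullet> b, x \<bullet> ?n]" for x
    by (simp add: vec_eq_iff forall_3 matrix_vector_mul_component rows vector_3 inner_commute)
  have "transpose A *v (A *v x) = (x \<bullet> a) *\<^sub>R a + (x \<bullet> b) *\<^sub>R b + (x \<bullet> ?n) *\<^sub>R ?n" for x
    unfolding Ax by (simp add: vec_eq_iff forall_3 matrix_vector_mult_def transpose_def sum_3 rows vector_3 mult.commute)
  then show ex: "x = (x \<bullet> a) *\<^sub>R a + (x \<bullet> b) *\<^sub>R b + (x \<bullet> ?n) *\<^sub>R ?n" for x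
    by (simp add: matrix_vector_mul_assoc tA)
  show "x \<bullet> y = (x \<bullet> a) * (y \<bullet> a) + (x \<bullet> b) * (y \<bullet> b) + (x \<bullet> ?n) * (y \<bullet> ?n)"
    by (subst ex[of x]) (simp add: inner_add_left inner_commute[of y])
qed

lemma inner_real2: "x \<bullet> y = x $ 1 * y $ 1 + x $ 2 * y $ 2" for x y :: "real^2"
  by (simp add: inner_vec_def sum_2)

lemma cross3_combination:
  "cross3 (a *\<^sub>R x + b *\<^sub>R y) (a' *\<^sub>R x + b' *\<^sub>R y) = (a * b' - b * a') *\<^sub>R cross3 x y"
  by (simp add: vec_eq_iff forall_3 cross_components algebra_simps)

lemma (in plane_domain) dd_inner_dd:
  assumes "u \<in> V" "sm f"
  shows "dd v f u \<bullet> dd w f u = v u \<bullet> (fund_form1 f u *v w u)"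
  unfolding dd_coords[OF assms]
  by (simp add: fund_form1_def inner_real2 sum_2 matrix_vector_mult_def inner_add_left inner_add_right algebra_simps)

locale framed_surface = plane_frame +
  fixes f :: "real^2 \<Rightarrow> real^3"
  assumes sm_f: "smooth_on V f"
    and orthonormal: "\<And>u. u \<in> V \<Longrightarrow> e1 u \<bullet> (fund_form1 f u *v e1 u) = 1"
      "\<And>u. u \<in> V \<Longrightarrow> e1 u \<bullet> (fund_form1 f u *v e2 u) = 0"
      "\<And>u. u \<in> V \<Longrightarrow> e2 u \<bullet> (fund_form1 f u *v e2 u) = 1"
begin

definition E1 :: "real^2 \<Rightarrow> real^3" where "E1 = dd e1 f"
definition E2 :: "real^2 \<Rightarrow> real^3" where "E2 = dd e2 f"
definition N :: "real^2 \<Rightarrow> real^3" where "N = (\<lambda>u. cross3 (E1 u) (E2 u))"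
definition h11 :: "real^2 \<Rightarrow> real" where "h11 = (\<lambda>u. dd e1 E1 u \<bullet> N u)"
definition h12 :: "real^2 \<Rightarrow> real" where "h12 = (\<lambda>u. dd e1 E2 u \<bullet> N u)"
definition h22 :: "real^2 \<Rightarrow> real" where "h22 = (\<lambda>u. dd e2 E2 u \<bullet> N u)"

text \<open>The coefficient \<open>q\<close> of the Hopf differential: the trace-free part of the second fundamental
  form is the real part of \<open>q (\<omega>\<^sub>1 + \<i> \<omega>\<^sub>2)\<^sup>2\<close>.\<close>

definition q :: "real^2 \<Rightarrow> complex" where
  "q = (\<lambda>u. complex_of_real ((h11 u - h22 u) / 2) - \<i> * complex_of_real (h12 u))"

lemma sm_E: "sm E1" "sm E2" "sm N"
  by (simp_all add: E1_def E2_def N_def sm_simps sm_dd_frame sm_f)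

lemma sm_h: "sm h11" "sm h12" "sm h22"
  by (simp_all add: h11_def h12_def h22_def sm_simps sm_dd_frame sm_E)

lemma sm_q: "sm q"
  by (simp add: q_def sm_simps sm_h)

lemma inner_E: assumes "u \<in> V" shows "E1 u \<bullet> E1 u = 1" "E1 u \<bullet> E2 u = 0" "E2 u \<bullet> E1 u = 0" "E2 u \<bullet> E2 u = 1"
  using orthonormal[OF assms] unfolding E1_def E2_def by (simp_all add: dd_inner_dd[OF assms sm_f, symmetric] inner_commute)

lemma inner_N: assumes "u \<in> V"
  shows "E1 u \<bullet> N u = 0" "E2 u \<bullet> N u = 0" "N u \<bullet> E1 u = 0" "N u \<bullet> E2 u = 0" "N u \<bullet> N u = 1"
  using orthonormal_expand(3)[OF inner_E(1,4,2)[OF assms]] by (simp_all add: N_def dot_cross_self)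

lemma expand: "u \<in> V \<Longrightarrow> x = (x \<bullet> E1 u) *\<^sub>R E1 u + (x \<bullet> E2 u) *\<^sub>R E2 u + (x \<bullet> N u) *\<^sub>R N u"
  unfolding N_def using orthonormal_expand(1)[OF inner_E(1,4,2)] .

lemma inner_expand: "u \<in> V \<Longrightarrow> x \<bullet> y = (x \<bullet> E1 u) * (y \<bullet> E1 u) + (x \<bullet> E2 u) * (y \<bullet> E2 u) + (x \<bullet> N u) * (y \<bullet> N u)"
  unfolding N_def using orthonormal_expand(2)[OF inner_E(1,4,2)] .

lemma dd_inner_const:
  assumes u: "u \<in> V" and sm: "sm a" "sm b" and const: "\<And>w. w \<in> V \<Longrightarrow> a w \<bullet> b w = k"
  shows "dd v a u \<bullet> b u = - (dd v b u \<bullet> a u)"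
proof -
  have "dd v (\<lambda>w. a w \<bullet> b w) u = dd v (\<lambda>w. k) u"
    by (rule dd_cong[OF u]) (simp_all add: sm_simps const)
  then show ?thesis by (simp add: dd_inner[OF u sm] dd_const[OF u] inner_commute)
qed

lemma torsion_free: assumes u: "u \<in> V" shows "dd e1 E2 u - dd e2 E1 u = p u *\<^sub>R E1 u + r u *\<^sub>R E2 u"
  unfolding E1_def E2_def by (rule frame_commutator[OF u sm_f])

lemma dd_frame_skew:
  assumes u: "u \<in> V"
  shows "dd v E1 u \<bullet> E1 u = 0" "dd v E2 u \<bullet> E2 u = 0" "dd v N u \<bullet> N u = 0"
      "dd v E1 u \<bullet> E2 u = - (dd v E2 u \<bullet> E1 u)" "dd v N u \<bullet> E1 u = - (dd v E1 u \<bullet> N u)" "dd v N u \<bullet> E2 u = - (dd v E2 u \<bullet> N u)"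
  using dd_inner_const[OF u sm_E(1,1) inner_E(1), of v] dd_inner_const[OF u sm_E(2,2) inner_E(4), of v]
    dd_inner_const[OF u sm_E(3,3) inner_N(5), of v] dd_inner_const[OF u sm_E(1,2) inner_E(2), of v]
    dd_inner_const[OF u sm_E(3,1) inner_N(3), of v] dd_inner_const[OF u sm_E(3,2) inner_N(4), of v] by simp_all

lemma connection_torsion_free:
  assumes u: "u \<in> V"
  shows "dd e1 E2 u \<bullet> E1 u = p u" "dd e2 E1 u \<bullet> E2 u = - r u" "dd e2 E1 u \<bullet> N u = dd e1 E2 u \<bullet> N u"
proof -
  note t = torsion_free[OF u, THEN arg_cong[where f="\<lambda>x. x \<bullet> y" for y], unfolded inner_diff_left inner_add_left inner_scaleR_left]
  show "dd e1 E2 u \<bullet> E1 u = p u" "dd e2 E1 u \<bullet> E2 u = - r u" "dd e2 E1 u \<bullet> N u = dd e1 E2 u \<bullet> N u"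
    using t[of "E1 u"] t[of "E2 u"] t[of "N u"] dd_frame_skew[OF u] inner_E[OF u] inner_N[OF u] by simp_all
qed

lemma frame_structure:
  assumes u: "u \<in> V"
  shows "dd e1 E1 u \<bullet> E1 u = 0" "dd e1 E1 u \<bullet> E2 u = - p u" "dd e1 E1 u \<bullet> N u = h11 u"
    "dd e1 E2 u \<bullet> E1 u = p u" "dd e1 E2 u \<bullet> E2 u = 0" "dd e1 E2 u \<bullet> N u = h12 u"
    "dd e2 E1 u \<bullet> E1 u = 0" "dd e2 E1 u \<bullet> E2 u = - r u" "dd e2 E1 u \<bullet> N u = h12 u"
    "dd e2 E2 u \<bullet> E1 u = r u" "dd e2 E2 u \<bullet> E2 u = 0" "dd e2 E2 u \<bullet> N u = h22 u"
    "dd e1 N u \<bullet> E1 u = - h11 u" "dd e1 N u \<bullet> E2 u = - h12 u" "dd e1 N u \<bullet> N u = 0"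
    "dd e2 N u \<bullet> E1 u = - h12 u" "dd e2 N u \<bullet> E2 u = - h22 u" "dd e2 N u \<bullet> N u = 0"
  using connection_torsion_free[OF u] dd_frame_skew[OF u] by (simp_all add: h11_def h12_def h22_def)

text \<open>The tangential component of the commutator identity for \<open>E2\<close> is the Gauss equation; the normal
  components of those for \<open>E1\<close> and \<open>E2\<close> are the Codazzi equations.\<close>

lemma gauss_equation:
  assumes u: "u \<in> V"
  shows "h11 u * h22 u - (h12 u)\<^sup>2 = dd e1 r u - dd e2 p u - (p u)\<^sup>2 - (r u)\<^sup>2"
proof -
  have sm': "sm (dd e1 E2)" "sm (dd e2 E2)" by (simp_all add: sm_dd_frame sm_E)
  have 1: "dd e1 r u = dd e1 (\<lambda>w. dd e2 E2 w \<bullet> E1 w) u" "dd e2 p u = dd e2 (\<lambda>w. dd e1 E2 w \<bullet> E1 w) u"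
    by (rule dd_cong[OF u]; simp add: frame_structure sm_simps sm_dd_frame sm_E)+
  have 2: "dd e1 (dd e2 E2) u \<bullet> E1 u - dd e2 (dd e1 E2) u \<bullet> E1 u = (p u)\<^sup>2 + (r u)\<^sup>2"
    using frame_commutator[OF u sm_E(2), THEN arg_cong[where f="\<lambda>x. x \<bullet> E1 u"]]
    by (simp add: inner_diff_left inner_add_left frame_structure[OF u] power2_eq_square)
  have 3: "dd e2 E2 u \<bullet> dd e1 E1 u = h11 u * h22 u" "dd e1 E2 u \<bullet> dd e2 E1 u = (h12 u)\<^sup>2"
    by (subst inner_expand[OF u]; simp add: frame_structure[OF u] power2_eq_square)+
  show ?thesis
    unfolding 1 dd_inner[OF u sm'(1) sm_E(1)] dd_inner[OF u sm'(2) sm_E(1)] using 2 3 by simp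
qed

lemma codazzi_equations:
  assumes u: "u \<in> V"
  shows "dd e1 h12 u - dd e2 h11 u = p u * (h11 u - h22 u) + 2 * r u * h12 u"
    and "dd e1 h22 u - dd e2 h12 u = 2 * p u * h12 u - r u * (h11 u - h22 u)"
proof -
  have sm': "sm (dd e1 E1)" "sm (dd e2 E1)" "sm (dd e1 E2)" "sm (dd e2 E2)" by (simp_all add: sm_dd_frame sm_E)
  have d: "dd v h11 u = dd e1 E1 u \<bullet> dd v N u + dd v (dd e1 E1) u \<bullet> N u"
      "dd v h12 u = dd e1 E2 u \<bullet> dd v N u + dd v (dd e1 E2) u \<bullet> N u"
      "dd v h22 u = dd e2 E2 u \<bullet> dd v N u + dd v (dd e2 E2) u \<bullet> N u" for v
    unfolding h11_def h12_def h22_def by (simp_all add: dd_inner[OF u] sm' sm_E)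
  have "dd v h12 u = dd v (\<lambda>w. dd e2 E1 w \<bullet> N w) u" for v
    by (rule dd_cong[OF u]; simp add: frame_structure sm_simps sm_dd_frame sm_E)
  then have d': "dd v h12 u = dd e2 E1 u \<bullet> dd v N u + dd v (dd e2 E1) u \<bullet> N u" for v
    by (simp add: dd_inner[OF u] sm' sm_E)
  have x: "dd e2 E1 u \<bullet> dd e1 N u = r u * h12 u" "dd e1 E1 u \<bullet> dd e2 N u = p u * h22 u"
    "dd e2 E2 u \<bullet> dd e1 N u = - r u * h11 u" "dd e1 E2 u \<bullet> dd e2 N u = - p u * h12 u"
    by (subst inner_expand[OF u]; simp add: frame_structure[OF u] power2_eq_square)+
  have y: "dd e1 (dd e2 E1) u \<bullet> N u - dd e2 (dd e1 E1) u \<bullet> N u = p u * h11 u + r u * h12 u"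
    "dd e1 (dd e2 E2) u \<bullet> N u - dd e2 (dd e1 E2) u \<bullet> N u = p u * h12 u + r u * h22 u"
    using frame_commutator[OF u sm_E(1), THEN arg_cong[where f="\<lambda>x. x \<bullet> N u"]]
      frame_commutator[OF u sm_E(2), THEN arg_cong[where f="\<lambda>x. x \<bullet> N u"]]
    by (simp_all add: inner_diff_left inner_add_left frame_structure[OF u] power2_eq_square)
  show "dd e1 h12 u - dd e2 h11 u = p u * (h11 u - h22 u) + 2 * r u * h12 u"
    unfolding d'[of e1] d(1) x using y(1) by (simp add: algebra_simps)
  show "dd e1 h22 u - dd e2 h12 u = 2 * p u * h12 u - r u * (h11 u - h22 u)"
    unfolding d(2)[of e2] d(3) x using y(2) by (simp add: algebra_simps)
qed

definition H :: "real^2 \<Rightarrow> real" where "H = (\<lambda>u. (h11 u + h22 u) / 2)"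

lemma sm_H: "sm H"
  by (simp add: H_def sm_simps sm_h)

lemma codazzi:
  assumes u: "u \<in> V"
  shows "Db q u = D (\<lambda>u. complex_of_real (H u)) u + 2 * cnj (c u) * q u"
proof -
  have Dq: "Db q u = complex_of_real ((dd e1 h11 u - dd e1 h22 u) / 2 + dd e2 h12 u)
     + \<i> * complex_of_real ((dd e2 h11 u - dd e2 h22 u) / 2 - dd e1 h12 u)"
    unfolding Db_def q_def using u by (simp add: dd_simps sm_simps sm_h field_simps)
  have DH: "dd v H u = (dd v h11 u + dd v h22 u) / 2" for v
    unfolding H_def using u by (simp add: dd_simps sm_simps sm_h)
  show ?thesis
    unfolding Dq Db_of_real(1)[OF u sm_H] DH
    using codazzi_equations[OF u] by (simp add: complex_eq_iff c_def q_def field_simps)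
qed

lemma norm_q: "(cmod (q u))\<^sup>2 = (H u)\<^sup>2 - (h11 u * h22 u - (h12 u)\<^sup>2)"
  unfolding cmod_power2 by (simp add: q_def H_def power2_eq_square field_simps)

text \<open>
  If \<open>m\<close> is the matrix with rows \<open>e\<^sub>1, e\<^sub>2\<close>, orthonormality says that the inverse of the first fundamental
  form is \<open>m\<^sup>T m\<close>, so the shape operator is conjugate to the matrix of the \<open>h\<^sub>i\<^sub>j\<close>.
\<close>

lemma curvatures_in_frame:
  assumes u: "u \<in> V"
  shows "unit_normal f u = N u" and "mean_curvature f u = H u" and "gauss_curvature f u = h11 u * h22 u - (h12 u)\<^sup>2"
proof -
  define m :: "real^2^2" where "m = vector [e1 u, e2 u]"
  have rows: "m $ 1 = e1 u" "m $ 2 = e2 u" by (simp_all add: m_def vector_2)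
  let ?I = "fund_form1 f u" and ?II = "fund_form2 f u"
  have detm: "det m > 0" using oriented[OF u] by (simp add: det_2 rows algebra_simps)
  have sym: "e2 u \<bullet> (?I *v e1 u) = 0"
    using orthonormal(2)[OF u] by (simp add: dd_inner_dd[OF u sm_f, symmetric] inner_commute)
  have "m ** (?I ** transpose m) = mat 1"
    using orthonormal[OF u] sym
    by (simp add: vec_eq_iff forall_2 matrix_sandwich_nth mat_def rows)
  then have "?I ** (transpose m ** m) = mat 1" using matrix_left_right_inverse by (metis matrix_mul_assoc)
  then have inv: "matrix_inv ?I = transpose m ** m" by (rule matrix_inv_eqI)
  have E: "E1 u = e1 u $ 1 *\<^sub>R pd 1 f u + e1 u $ 2 *\<^sub>R pd 2 f u" "E2 u = e2 u $ 1 *\<^sub>R pd 1 f u + e2 u $ 2 *\<^sub>R pd 2 f u"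
    unfolding E1_def E2_def by (rule dd_coords[OF u sm_f])+
  have Ncross: "N u = det m *\<^sub>R cross3 (pd 1 f u) (pd 2 f u)"
    unfolding N_def E
    by (simp add: cross3_combination det_2 rows algebra_simps)
  have "norm (N u) = 1" using inner_N(5)[OF u] by (simp add: norm_eq_sqrt_inner)
  then have "sgn (N u) = N u" by (simp add: sgn_div_norm)
  then show normal: "unit_normal f u = N u"
    unfolding unit_normal_def Ncross using detm by (simp add: sgn_scaleR)
  have tang: "pd i f u \<bullet> N u = 0" for i
    using exhaust_2[of i] by (auto simp: Ncross dot_cross_self)
  have h: "dd v (dd w f) u \<bullet> N u = v u $ 1 * (w u $ 1 * ?II $ 1 $ 1 + w u $ 2 * ?II $ 1 $ 2)
      + v u $ 2 * (w u $ 1 * ?II $ 2 $ 1 + w u $ 2 * ?II $ 2 $ 2)" if w: "sm w" for v w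
    unfolding dd_dd_coords[OF u w sm_f] dd_coords[OF u sm_pd[OF sm_f], of v]
    by (simp add: fund_form2_def normal inner_add_left tang algebra_simps)
  have symII: "?II $ 2 $ 1 = ?II $ 1 $ 2"
    by (simp add: fund_form2_def pd_commute[OF sm_f u, of 2 1])
  note hs = h[OF sm_frame(1), of e1] h[OF sm_frame(2), of e1] h[OF sm_frame(2), of e2]
  have shape: "shape_operator f u = transpose m ** m ** ?II" by (simp add: shape_operator_def inv)
  show "mean_curvature f u = H u"
    unfolding mean_curvature_def shape H_def h11_def h22_def E1_def E2_def hs
    by (simp add: trace_def sum_2 matrix_matrix_mult_def transpose_def rows symII algebra_simps)
  show "gauss_curvature f u = h11 u * h22 u - (h12 u)\<^sup>2"
    unfolding gauss_curvature_def shape det_mul det_transpose h11_def h22_def h12_def E1_def E2_def hs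
    by (simp add: det_2 rows symII power2_eq_square algebra_simps)
qed

lemma norm_q_curvatures: "u \<in> V \<Longrightarrow> (cmod (q u))\<^sup>2 = (mean_curvature f u)\<^sup>2 - gauss_curvature f u"
  by (simp add: norm_q curvatures_in_frame)

text \<open>
  The Gauss equation expresses \<open>K\<close> by the bracket coefficients alone, in the same way as the frame
  formula for the intrinsic curvature.
\<close>

lemma theorema_egregium:
  assumes u: "u \<in> V" shows "metric_curvature (fund_form1 f) u = gauss_curvature f u"
proof -
  have sym: "e2 w \<bullet> (fund_form1 f w *v e1 w) = 0" if "w \<in> V" for w
    using orthonormal(2)[OF that] by (simp add: dd_inner_dd[OF that sm_f, symmetric] inner_commute)
  show ?thesis
    unfolding curvatures_in_frame(3)[OF u] gauss_equation[OF u]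
    by (rule metric_curvature_frame[OF sm_frame independent orthonormal(1,2) sym orthonormal(3) bracket u])
qed

end

section \<open>Isometric surfaces with the same mean curvature\<close>

lemma (in plane_frame) derivative_in_frame:
  fixes g :: "real^2 \<Rightarrow> 'b::real_normed_vector"
  assumes u: "u \<in> V" and g: "sm g"
  shows "frechet_derivative g (at u) h =
     ((h $ 1 * e2 u $ 2 - h $ 2 * e2 u $ 1) / (wedge e1 e2 u)) *\<^sub>R dd e1 g u
   + ((h $ 2 * e1 u $ 1 - h $ 1 * e1 u $ 2) / (wedge e1 e2 u)) *\<^sub>R dd e2 g u"
proof -
  let ?d = "wedge e1 e2 u"
  have h: "h = ((h $ 1 * e2 u $ 2 - h $ 2 * e2 u $ 1) / ?d) *\<^sub>R e1 u + ((h $ 2 * e1 u $ 1 - h $ 1 * e1 u $ 2) / ?d) *\<^sub>R e2 u"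
  proof -
    have "(h $ 1 * e2 u $ 2 - h $ 2 * e2 u $ 1) * e1 u $ i + (h $ 2 * e1 u $ 1 - h $ 1 * e1 u $ 2) * e2 u $ i = ?d * h $ i" for i
      using exhaust_2[of i] by (auto simp: algebra_simps)
    then show ?thesis
      using independent[OF u] by (simp add: vec_eq_iff add_divide_distrib[symmetric])
  qed
  have lin: "linear (frechet_derivative g (at u))"
    by (rule linear_frechet_derivative[OF sm_differentiable[OF g u]])
  show ?thesis
    by (subst h) (simp only: linear_add[OF lin] linear_cmul[OF lin] dd_def)
qed

lemma (in plane_frame) constant_if_frame_derivatives_zero:
  fixes g :: "real^2 \<Rightarrow> 'b::real_normed_vector"
  assumes "sm g" "connected V" "\<And>u. u \<in> V \<Longrightarrow> dd e1 g u = 0" "\<And>u. u \<in> V \<Longrightarrow> dd e2 g u = 0"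
    and "u \<in> V" "w \<in> V"
  shows "g u = g w"
proof (rule has_derivative_zero_unique_connected[OF open_V assms(2) _ assms(5,6)])
  fix x assume x: "x \<in> V"
  have "frechet_derivative g (at x) = (\<lambda>h. 0)"
    using derivative_in_frame[OF x assms(1)] assms(3,4)[OF x] by (simp add: fun_eq_iff)
  then show "(g has_derivative (\<lambda>h. 0)) (at x)"
    using sm_differentiable[OF assms(1) x] frechet_derivative_works by metis
qed

text \<open>
  A uniqueness theorem of Gronwall type: on a closed ball of radius \<open>\<rho>\<close> with
  \<open>K \<rho> \<le> 1/2\<close> the mean value inequality gives \<open>max \<bar>\<delta>\<bar> \<le> 1/2 max \<bar>\<delta>\<bar>\<close>.
\<close>

lemma zero_near_if_derivative_bounded:
  fixes \<delta> :: "real^2 \<Rightarrow> 'b::real_normed_vector"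
  assumes V: "open V" "u0 \<in> V"
    and diff: "\<And>u. u \<in> V \<Longrightarrow> \<delta> differentiable (at u)"
    and C: "continuous_on V C"
    and bound: "\<And>u h. u \<in> V \<Longrightarrow> norm (frechet_derivative \<delta> (at u) h) \<le> C u * norm (\<delta> u) * norm h"
    and zero: "\<delta> u0 = 0"
  shows "\<exists>\<rho>>0. ball u0 \<rho> \<subseteq> V \<and> (\<forall>u\<in>ball u0 \<rho>. \<delta> u = 0)"
proof -
  obtain \<rho>0 where \<rho>0: "\<rho>0 > 0" "cball u0 \<rho>0 \<subseteq> V" using V open_contains_cball by blast
  have "compact (C ` cball u0 \<rho>0)"
    by (rule compact_continuous_image[OF continuous_on_subset[OF C \<rho>0(2)]]) simp
  from compact_imp_bounded[OF this] obtain K0 where "\<forall>x\<in>C ` cball u0 \<rho>0. norm x \<le> K0"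
    unfolding bounded_iff ..
  then have K0: "norm (C u) \<le> K0" if "u \<in> cball u0 \<rho>0" for u using that by (simp only: ball_simps)
  define K where "K = max K0 1"
  have Kpos: "K > 0" by (simp add: K_def)
  have K: "C u \<le> K" if "u \<in> cball u0 \<rho>0" for u
    using abs_ge_self[of "C u"] K0[OF that] by (simp add: K_def)
  define \<rho> where "\<rho> = min \<rho>0 (1 / (2 * K))"
  have \<rho>: "\<rho> > 0" "\<rho> \<le> \<rho>0" "K * \<rho> \<le> 1 / 2"
    using \<rho>0 Kpos by (auto simp: \<rho>_def min_def field_simps)
  have sub: "cball u0 \<rho> \<subseteq> cball u0 \<rho>0" using \<rho>(2) by auto
  have inV: "u \<in> V" if "u \<in> cball u0 \<rho>" for u using that sub \<rho>0(2) by blast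
  have "continuous_on (cball u0 \<rho>) (\<lambda>u. norm (\<delta> u))"
    using diff inV by (intro continuous_on_norm continuous_at_imp_continuous_on ballI differentiable_imp_continuous_within) blast
  then obtain w where w: "w \<in> cball u0 \<rho>" "\<And>u. u \<in> cball u0 \<rho> \<Longrightarrow> norm (\<delta> u) \<le> norm (\<delta> w)"
    using continuous_attains_sup[OF compact_cball, of u0 \<rho> "\<lambda>u. norm (\<delta> u)"] \<rho>(1) by auto
  have "norm (\<delta> w - \<delta> u0) \<le> (K * norm (\<delta> w)) * norm (w - u0)"
  proof (rule differentiable_bound[OF convex_cball])
    fix x assume x: "x \<in> cball u0 \<rho>"
    show "(\<delta> has_derivative frechet_derivative \<delta> (at x)) (at x within cball u0 \<rho>)"
      using diff[OF inV[OF x]] frechet_derivative_works has_derivative_at_withinI by blast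
    show "onorm (frechet_derivative \<delta> (at x)) \<le> K * norm (\<delta> w)"
    proof (rule onorm_le)
      fix h
      have "norm (frechet_derivative \<delta> (at x) h) \<le> C x * norm (\<delta> x) * norm h" by (rule bound[OF inV[OF x]])
      also have "\<dots> \<le> K * norm (\<delta> w) * norm h"
        using Kpos K w(2)[OF x] x sub by (intro mult_right_mono mult_mono) auto
      finally show "norm (frechet_derivative \<delta> (at x) h) \<le> K * norm (\<delta> w) * norm h" .
    qed
  qed (use w(1) \<rho>(1) in auto)
  also have "\<dots> \<le> K * norm (\<delta> w) * \<rho>"
    using w(1) Kpos by (intro mult_left_mono) (auto simp: dist_norm norm_minus_commute)
  also have "\<dots> = (K * \<rho>) * norm (\<delta> w)" by simp
  also have "\<dots> \<le> 1 / 2 * norm (\<delta> w)" by (intro mult_right_mono \<rho>(3)) simp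
  finally have "norm (\<delta> w) \<le> 0" using zero by simp
  then have "\<delta> u = 0" if "u \<in> cball u0 \<rho>" for u using w(2)[OF that] by simp
  then show ?thesis using \<rho>(1) inV by (intro exI[of _ \<rho>]) (auto simp: subset_iff)
qed

definition (in framed_surface) \<beta> :: "real^2 \<Rightarrow> complex" where
  "\<beta> u = D (\<lambda>u. complex_of_real (H u)) u / q u"

locale framed_pair =
  A: framed_surface V e1 e2 p r f + B: framed_surface V e1 e2 p r g
  for V e1 e2 p r f g +
  assumes same_H: "u \<in> V \<Longrightarrow> A.H u = B.H u"
    and q_nonzero: "u \<in> V \<Longrightarrow> A.q u \<noteq> 0"
begin

lemma cmod_q_eq: assumes "u \<in> V" shows "cmod (B.q u) = cmod (A.q u)"
proof -
  have "(cmod (B.q u))\<^sup>2 = (cmod (A.q u))\<^sup>2"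
    unfolding A.norm_q B.norm_q same_H[OF assms] A.gauss_equation[OF assms] B.gauss_equation[OF assms] ..
  then show ?thesis by simp
qed

definition quot :: "real^2 \<Rightarrow> complex" where
  "quot u = B.q u / A.q u"

lemma cmod_quot: "u \<in> V \<Longrightarrow> cmod (quot u) = 1"
  using cmod_q_eq q_nonzero by (simp add: quot_def norm_divide)

lemma sm_quot: "A.sm quot"
  unfolding quot_def[abs_def] by (simp add: A.sm_simps A.sm_q B.sm_q q_nonzero)

lemma sm_\<beta>: "A.sm A.\<beta>"
  unfolding A.\<beta>_def[abs_def] by (simp add: A.sm_simps A.sm_q A.sm_H A.sm_D q_nonzero)

text \<open>Both coefficients satisfy the Codazzi equation with the same \<open>D H\<close>.\<close>

lemma Db_quot:
  assumes u: "u \<in> V"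
  shows "A.Db quot u = (1 - quot u) * A.\<beta> u"
proof -
  have "A.D (\<lambda>u. complex_of_real (B.H u)) u = A.D (\<lambda>u. complex_of_real (A.H u)) u"
    by (rule A.D_cong[OF u]) (simp_all add: A.sm_simps A.sm_H same_H)
  then have "A.Db B.q u = A.D (\<lambda>u. complex_of_real (A.H u)) u + 2 * cnj (A.c u) * B.q u"
    using B.codazzi[OF u] by simp
  moreover have "A.Db quot u = (A.Db B.q u * A.q u - B.q u * A.Db A.q u) / (A.q u)\<^sup>2"
    unfolding quot_def[abs_def] by (rule A.D_divide(2)[OF u B.sm_q A.sm_q q_nonzero])
  ultimately show ?thesis
    unfolding quot_def A.\<beta>_def A.codazzi[OF u]
    using q_nonzero[OF u] by (simp add: field_simps power2_eq_square)
qed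

lemma cmod_D_quot:
  assumes u: "u \<in> V"
  shows "cmod (A.D quot u) = cmod (A.Db quot u)"
proof -
  have nz: "quot w \<noteq> 0" if "w \<in> V" for w using cmod_quot[OF that] by auto
  have "1 / quot w = cnj (quot w)" if "w \<in> V" for w
    using cmod_quot[OF that] nz[OF that] complex_norm_square[of "quot w"] by (simp add: field_simps)
  then have "A.Db (\<lambda>w. cnj (quot w)) u = A.Db (\<lambda>w. 1 / quot w) u"
    by (intro A.D_cong[OF u]) (simp_all add: A.sm_simps sm_quot nz)
  then have "cnj (A.D quot u) = - A.Db quot u / (quot u)\<^sup>2"
    by (simp add: A.D_cnj[OF u sm_quot] A.D_divide(2)[OF u smooth_on_const sm_quot nz] A.D_const[OF u])
  then have "cmod (A.D quot u) = cmod (- A.Db quot u / (quot u)\<^sup>2)" by (metis complex_mod_cnj)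
  then show ?thesis using cmod_quot[OF u] by (simp add: norm_divide norm_power)
qed

text \<open>
  The quotient of the two Hopf coefficients is unimodular, so \<open>Db quot\<close> determines its full
  differential, which is bounded by a multiple of \<open>\<bar>quot - 1\<bar>\<close>.
\<close>

lemma q_equal_near:
  assumes u0: "u0 \<in> V" and eq: "A.q u0 = B.q u0"
  shows "\<exists>\<rho>>0. ball u0 \<rho> \<subseteq> V \<and> (\<forall>u\<in>ball u0 \<rho>. A.q u = B.q u)"
proof -
  let ?d = "\<lambda>u. wedge e1 e2 u"
  let ?C = "\<lambda>u. 2 * (norm (e1 u) + norm (e2 u)) / ?d u * cmod (A.\<beta> u)"
  have smq1: "A.sm (\<lambda>u. quot u - 1)" by (simp add: A.sm_simps sm_quot)
  have "\<exists>\<rho>>0. ball u0 \<rho> \<subseteq> V \<and> (\<forall>u\<in>ball u0 \<rho>. quot u - 1 = 0)"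
  proof (rule zero_near_if_derivative_bounded[OF A.open_V u0, where C = ?C])
    show "\<And>u. u \<in> V \<Longrightarrow> (\<lambda>u. quot u - 1) differentiable at u"
      using A.sm_differentiable[OF smq1] .
    show "continuous_on V ?C"
      using A.independent
      by (intro continuous_intros smooth_on_continuous[OF A.sm_frame(1)] smooth_on_continuous[OF A.sm_frame(2)]
          smooth_on_continuous[OF sm_\<beta>]) auto
    show "quot u0 - 1 = 0" using eq q_nonzero[OF u0] by (simp add: quot_def)
    fix u h :: "real^2" assume u: "u \<in> V"
    have dd1: "dd v (\<lambda>u. quot u - 1) u = dd v quot u" for v
      by (simp add: A.dd_diff[OF u] A.dd_const[OF u] A.sm_simps sm_quot)
    have m: "cmod (A.Db quot u) = cmod (quot u - 1) * cmod (A.\<beta> u)"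
      unfolding Db_quot[OF u] by (simp add: norm_mult norm_minus_commute)
    have "A.Db quot u + A.D quot u = 2 * dd e1 quot u" "A.Db quot u - A.D quot u = 2 * \<i> * dd e2 quot u"
      by (simp_all add: A.D_def A.Db_def)
    then have "2 * cmod (dd e1 quot u) \<le> cmod (A.Db quot u) + cmod (A.D quot u)"
      "2 * cmod (dd e2 quot u) \<le> cmod (A.Db quot u) + cmod (A.D quot u)"
      using norm_triangle_ineq[of "A.Db quot u" "A.D quot u"] norm_triangle_ineq4[of "A.Db quot u" "A.D quot u"]
      by (simp_all add: norm_mult)
    then have n: "cmod (dd e1 quot u) \<le> cmod (quot u - 1) * cmod (A.\<beta> u)"
      "cmod (dd e2 quot u) \<le> cmod (quot u - 1) * cmod (A.\<beta> u)"
      unfolding cmod_D_quot[OF u] m by (simp_all add: mult.commute)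
    have d: "?d u > 0" by (rule A.oriented[OF u])
    have coef: "\<bar>(h $ i * e u $ j - h $ k * e u $ l) / ?d u\<bar> \<le> 2 * norm (e u) / ?d u * norm h" for i j k l and e :: "real^2 \<Rightarrow> real^2"
    proof -
      have "\<bar>h $ i * e u $ j - h $ k * e u $ l\<bar> \<le> \<bar>h $ i\<bar> * \<bar>e u $ j\<bar> + \<bar>h $ k\<bar> * \<bar>e u $ l\<bar>"
        using abs_triangle_ineq4[of "h $ i * e u $ j" "h $ k * e u $ l"] by (simp add: abs_mult)
      also have "\<dots> \<le> norm h * norm (e u) + norm h * norm (e u)"
        by (intro add_mono mult_mono component_le_norm_cart) auto
      also have "\<dots> = 2 * norm (e u) * norm h" by simp
      finally have "\<bar>h $ i * e u $ j - h $ k * e u $ l\<bar> / ?d u \<le> 2 * norm (e u) * norm h / ?d u"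
        using d by (intro divide_right_mono) auto
      then show ?thesis using abs_of_pos[OF d] by (simp only: abs_divide times_divide_eq_left)
    qed
    have scale: "cmod (x *\<^sub>R y) \<le> a * b" if "\<bar>x\<bar> \<le> a" "cmod y \<le> b" for x a b and y :: complex
      using that by (simp add: mult_mono' order_trans[OF abs_ge_zero])
    have "cmod (frechet_derivative (\<lambda>u. quot u - 1) (at u) h) \<le>
       2 * norm (e2 u) / ?d u * norm h * (cmod (quot u - 1) * cmod (A.\<beta> u)) + 2 * norm (e1 u) / ?d u * norm h * (cmod (quot u - 1) * cmod (A.\<beta> u))"
      unfolding A.derivative_in_frame[OF u smq1] dd1
      by (rule order_trans[OF norm_triangle_ineq])
        (intro add_mono scale coef n)
    also have "\<dots> = ?C u * cmod (quot u - 1) * norm h" by (simp add: add_divide_distrib algebra_simps)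
    finally show "cmod (frechet_derivative (\<lambda>u. quot u - 1) (at u) h) \<le> ?C u * cmod (quot u - 1) * norm h" .
  qed
  then obtain \<rho> where \<rho>: "\<rho> > 0" "ball u0 \<rho> \<subseteq> V" "\<forall>u\<in>ball u0 \<rho>. quot u - 1 = 0" by blast
  then have "A.q u = B.q u" if "u \<in> ball u0 \<rho>" for u
    using that q_nonzero[of u] by (auto simp: quot_def field_simps)
  then show ?thesis using \<rho> by blast
qed

end

section \<open>Proper motions\<close>

definition proper_motion :: "(real^3 \<Rightarrow> real^3) \<Rightarrow> bool" where
  "proper_motion \<Phi> \<longleftrightarrow> (\<exists>L w. orthogonal_transformation L \<and> (\<forall>a b. cross3 (L a) (L b) = L (cross3 a b)) \<and> \<Phi> = (\<lambda>x. L x + w))"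

context framed_surface
begin

lemma frame_equations:
  assumes u: "u \<in> V"
  shows "dd e1 E1 u = - p u *\<^sub>R E2 u + h11 u *\<^sub>R N u" "dd e1 E2 u = p u *\<^sub>R E1 u + h12 u *\<^sub>R N u"
    "dd e2 E1 u = - r u *\<^sub>R E2 u + h12 u *\<^sub>R N u" "dd e2 E2 u = r u *\<^sub>R E1 u + h22 u *\<^sub>R N u"
    "dd e1 N u = - h11 u *\<^sub>R E1 u - h12 u *\<^sub>R E2 u" "dd e2 N u = - h12 u *\<^sub>R E1 u - h22 u *\<^sub>R E2 u"
  by (subst expand[OF u]; simp add: frame_structure[OF u])+

end

context framed_pair
begin

lemma second_form_eq:
  assumes "u \<in> V" "A.q u = B.q u"
  shows "A.h11 u = B.h11 u" "A.h12 u = B.h12 u" "A.h22 u = B.h22 u"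
  using assms(2) same_H[OF assms(1)] by (simp_all add: A.q_def B.q_def A.H_def B.H_def complex_eq_iff)

text \<open>
  The rotation that carries the adapted frame of the first surface to that of the second one is
  constant, because both frames satisfy the same linear differential equations.
\<close>

lemma congruent_if_q_equal:
  assumes conn: "connected V" and ne: "u0 \<in> V" and eq: "\<And>u. u \<in> V \<Longrightarrow> A.q u = B.q u"
  shows "\<exists>\<Phi>. proper_motion \<Phi> \<and> (\<forall>u\<in>V. g u = \<Phi> (f u))"
proof -
  define R where "R u x = (x \<bullet> A.E1 u) *\<^sub>R B.E1 u + (x \<bullet> A.E2 u) *\<^sub>R B.E2 u + (x \<bullet> A.N u) *\<^sub>R B.N u" for u x
  have smR: "A.sm (\<lambda>u. R u x)" for x
    unfolding R_def by (simp add: A.sm_simps A.sm_E B.sm_E)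
  have R_const: "R u x = R u0 x" if u: "u \<in> V" for u x
  proof (rule A.constant_if_frame_derivatives_zero[OF smR conn _ _ u ne])
    fix w assume w: "w \<in> V"
    have dd: "dd v (\<lambda>u. R u x) w = (x \<bullet> A.E1 w) *\<^sub>R dd v B.E1 w + (x \<bullet> dd v A.E1 w) *\<^sub>R B.E1 w
      + ((x \<bullet> A.E2 w) *\<^sub>R dd v B.E2 w + (x \<bullet> dd v A.E2 w) *\<^sub>R B.E2 w)
      + ((x \<bullet> A.N w) *\<^sub>R dd v B.N w + (x \<bullet> dd v A.N w) *\<^sub>R B.N w)" for v
      unfolding R_def using w by (simp add: A.dd_simps A.sm_simps A.sm_E B.sm_E)
    show "dd e1 (\<lambda>u. R u x) w = 0" "dd e2 (\<lambda>u. R u x) w = 0"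
      unfolding dd A.frame_equations[OF w] B.frame_equations[OF w] second_form_eq[OF w eq[OF w]]
      by (simp_all add: inner_add_right inner_diff_right algebra_simps)
  qed
  define L where "L = R u0"
  have LE: "L (A.E1 u) = B.E1 u" "L (A.E2 u) = B.E2 u" "L (A.N u) = B.N u" if u: "u \<in> V" for u
    unfolding L_def R_const[OF u, symmetric] by (simp_all add: R_def A.inner_E[OF u] A.inner_N[OF u])
  have lin: "linear L"
    unfolding L_def R_def by (intro linearI) (simp_all add: inner_add_left algebra_simps)
  have orth: "orthogonal_transformation L"
    unfolding orthogonal_transformation_def
  proof (intro conjI allI lin)
    fix x y
    show "L x \<bullet> L y = x \<bullet> y"
      unfolding A.inner_expand[OF ne, of x y] L_def R_def
      by (simp add: inner_add_left inner_add_right B.inner_E[OF ne] B.inner_N[OF ne])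
  qed
  have blL: "bounded_linear L" using lin by (simp add: linear_conv_bounded_linear)
  have cr: "cross3 (L a) (L b) = L (cross3 a b)" for a b
  proof -
    note det = cross_orthogonal_transformation[OF orth]
    have "cross3 (B.E1 u0) (B.E2 u0) = det (matrix L) *\<^sub>R L (A.N u0)"
      unfolding LE(1,2)[OF ne, symmetric] det A.N_def ..
    then have "B.N u0 = det (matrix L) *\<^sub>R B.N u0" unfolding LE(3)[OF ne] by (simp add: B.N_def)
    moreover have "B.N u0 \<noteq> 0" using B.inner_N(5)[OF ne] by auto
    ultimately have "det (matrix L) = 1" by (metis scaleR_cancel_right scaleR_one)
    then show ?thesis by (simp add: det)
  qed
  have smd: "A.sm (\<lambda>u. g u - L (f u))"
    using smooth_on_bounded_linear[OF A.open_V blL A.sm_f] by (simp add: A.sm_simps B.sm_f)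
  have "g u - L (f u) = g u0 - L (f u0)" if u: "u \<in> V" for u
  proof (rule A.constant_if_frame_derivatives_zero[OF smd conn _ _ u ne])
    fix w assume w: "w \<in> V"
    have dd: "dd v (\<lambda>u. g u - L (f u)) w = dd v g w - L (dd v f w)" for v
      using smooth_on_bounded_linear[OF A.open_V blL A.sm_f]
      by (simp add: A.dd_diff[OF w B.sm_f] dd_bounded_linear[OF blL A.sm_differentiable[OF A.sm_f w]])
    show "dd e1 (\<lambda>u. g u - L (f u)) w = 0" "dd e2 (\<lambda>u. g u - L (f u)) w = 0"
      unfolding dd using LE[OF w] by (simp_all add: A.E1_def A.E2_def B.E1_def B.E2_def)
  qed
  then have "\<forall>u\<in>V. g u = (\<lambda>x. L x + (g u0 - L (f u0))) (f u)" by (simp add: algebra_simps)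
  then show ?thesis unfolding proper_motion_def using orth cr by blast
qed

lemma q_equal_if_congruent:
  assumes \<Phi>: "proper_motion \<Phi>" and eq: "\<And>u. u \<in> V \<Longrightarrow> g u = \<Phi> (f u)" and u: "u \<in> V"
  shows "A.q u = B.q u"
proof -
  obtain L w where L: "orthogonal_transformation L" "\<And>a b. cross3 (L a) (L b) = L (cross3 a b)" "\<Phi> = (\<lambda>x. L x + w)"
    using \<Phi> unfolding proper_motion_def by blast
  have blL: "bounded_linear L" using L(1) by (simp add: orthogonal_transformation_def linear_conv_bounded_linear)
  have in_L: "L a \<bullet> L b = a \<bullet> b" for a b using L(1) by (simp add: orthogonal_transformation_def)
  note smL = smooth_on_bounded_linear[OF A.open_V blL]
  have d: "dd v (\<lambda>u. L (F u)) x = L (dd v F x)" if "A.sm F" "x \<in> V" for v F x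
    by (rule dd_bounded_linear[OF blL A.sm_differentiable[OF that]])
  have "dd v g x = dd v (\<lambda>u. L (f u) + w) x" if "x \<in> V" for v x
    by (rule A.dd_cong[OF that]) (simp_all add: A.sm_simps smL A.sm_f eq L(3))
  then have E: "B.E1 x = L (A.E1 x)" "B.E2 x = L (A.E2 x)" if "x \<in> V" for x
    using that by (simp_all add: B.E1_def B.E2_def A.E1_def A.E2_def A.dd_simps A.sm_simps smL A.sm_f d)
  then have N: "B.N u = L (A.N u)" using u by (simp add: B.N_def A.N_def L(2))
  have dE: "dd v B.E1 u = L (dd v A.E1 u)" "dd v B.E2 u = L (dd v A.E2 u)" for v
    using A.dd_cong[OF u smL[OF A.sm_E(1)], of B.E1 v] A.dd_cong[OF u smL[OF A.sm_E(2)], of B.E2 v] E d A.sm_E u by auto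
  show ?thesis
    unfolding A.q_def B.q_def A.h11_def B.h11_def A.h12_def B.h12_def A.h22_def B.h22_def dE N in_L ..
qed

end

lemma (in framed_surface) proper_motion_unique:
  assumes \<Phi>: "proper_motion \<Phi>" "proper_motion \<Psi>" and eq: "\<And>u. u \<in> V \<Longrightarrow> \<Phi> (f u) = \<Psi> (f u)" and u: "u \<in> V"
  shows "\<Phi> = \<Psi>"
proof -
  obtain L a where L: "linear L" "\<And>a b. cross3 (L a) (L b) = L (cross3 a b)" "\<Phi> = (\<lambda>x. L x + a)"
    using \<Phi>(1) unfolding proper_motion_def orthogonal_transformation_def by blast
  obtain K b where K: "linear K" "\<And>a b. cross3 (K a) (K b) = K (cross3 a b)" "\<Psi> = (\<lambda>x. K x + b)"
    using \<Phi>(2) unfolding proper_motion_def orthogonal_transformation_def by blast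
  have bl: "bounded_linear (\<lambda>x. L x - K x)"
    using L(1) K(1) by (simp add: linear_conv_bounded_linear bounded_linear_sub)
  have "L (dd v f u) - K (dd v f u) = 0" for v
  proof -
    have "dd v (\<lambda>u. L (f u) - K (f u)) u = dd v (\<lambda>u. b - a) u"
      using eq L(3) K(3) by (intro dd_cong[OF u] smooth_on_const) (simp add: algebra_simps)
    then show ?thesis
      by (simp add: dd_bounded_linear[OF bl sm_differentiable[OF sm_f u]] dd_const[OF u])
  qed
  then have E: "L (E1 u) = K (E1 u)" "L (E2 u) = K (E2 u)" by (simp_all add: E1_def E2_def)
  then have N: "L (N u) = K (N u)" by (simp add: N_def flip: L(2) K(2))
  have "L x = K x" for x
    by (subst (1 2) expand[OF u, of x]) (simp add: linear_add[OF L(1)] linear_cmul[OF L(1)] linear_add[OF K(1)] linear_cmul[OF K(1)] E N)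
  moreover from this have "a = b" using eq[OF u] L(3) K(3) by simp
  ultimately show ?thesis using L(3) K(3) by simp
qed

section \<open>The structure equation of a Bonnet surface\<close>

context framed_pair
begin

text \<open>The angle \<open>\<phi>\<close> with \<open>quot = exp (\<i> \<phi>)\<close>, in the form \<open>cot (\<phi> / 2)\<close>: this is real valued, and
  its differential equation is linear.\<close>

definition cot_half :: "real^2 \<Rightarrow> complex" where
  "cot_half u = \<i> * (quot u + 1) / (quot u - 1)"

context
  assumes distinct: "\<And>u. u \<in> V \<Longrightarrow> A.q u \<noteq> B.q u"
begin

lemma quot_not_1: "u \<in> V \<Longrightarrow> quot u - 1 \<noteq> 0"
  using distinct[of u] q_nonzero[of u] by (auto simp: quot_def)

lemma quot_neq_1: "u \<in> V \<Longrightarrow> quot u \<noteq> 1"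
  using quot_not_1 by auto

lemma sm_cot_half: "A.sm cot_half"
  unfolding cot_half_def[abs_def] by (simp add: A.sm_simps sm_quot quot_neq_1)

lemma cnj_cot_half: assumes u: "u \<in> V" shows "cnj (cot_half u) = cot_half u"
proof -
  have nz: "quot u \<noteq> 0" using cmod_quot[OF u] by auto
  have nz1: "quot u - 1 \<noteq> 0" "1 - quot u \<noteq> 0" using quot_not_1[OF u] by auto
  have "cnj (quot u) = 1 / quot u"
    using cmod_quot[OF u] nz complex_norm_square[of "quot u"] by (simp add: field_simps)
  then show ?thesis
    using nz nz1 by (simp add: cot_half_def divide_simps) (simp add: algebra_simps)
qed

lemma D_cot_half:
  assumes u: "u \<in> V"
  shows "A.Db cot_half u = A.\<beta> u * (cot_half u - \<i>)" "A.D cot_half u = cnj (A.\<beta> u) * (cot_half u + \<i>)"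
proof -
  show 1: "A.Db cot_half u = A.\<beta> u * (cot_half u - \<i>)"
  proof -
    have "A.Db cot_half u = (\<i> * A.Db quot u * (quot u - 1) - \<i> * (quot u + 1) * A.Db quot u) / (quot u - 1)\<^sup>2"
      unfolding cot_half_def[abs_def] using u
      by (simp add: A.D_simps A.sm_simps sm_quot quot_neq_1)
    moreover obtain d where d: "quot u = d + 1" by (metis diff_add_cancel)
    moreover have "d \<noteq> 0" using quot_not_1[OF u] d by simp
    ultimately show ?thesis
      unfolding Db_quot[OF u] cot_half_def by (simp add: field_simps power2_eq_square)
  qed
  have "A.D cot_half u = A.D (\<lambda>w. cnj (cot_half w)) u"
    by (rule A.D_cong[OF u]) (simp_all add: A.sm_simps sm_cot_half cnj_cot_half)
  then show "A.D cot_half u = cnj (A.\<beta> u) * (cot_half u + \<i>)"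
    by (simp add: A.D_cnj[OF u sm_cot_half] 1 cnj_cot_half[OF u])
qed

text \<open>
  The commutator of \<open>D\<close> and \<open>Db\<close> applied to \<open>cot_half\<close>; the relation is affine in \<open>cot_half\<close>.
\<close>

lemma cot_half_integrability:
  assumes u: "u \<in> V"
  defines "Y \<equiv> A.D A.\<beta> u - A.c u * A.\<beta> u"
  shows "Y * (cot_half u - \<i>) - cnj Y * (cot_half u + \<i>) + 2 * \<i> * (A.\<beta> u * cnj (A.\<beta> u)) = 0"
proof -
  note sm = sm_cot_half sm_\<beta>
  have 1: "A.D (A.Db cot_half) u = A.\<beta> u * (cnj (A.\<beta> u) * (cot_half u + \<i>)) + A.D A.\<beta> u * (cot_half u - \<i>)"
  proof -
    have "A.D (A.Db cot_half) u = A.D (\<lambda>w. A.\<beta> w * (cot_half w - \<i>)) u"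
      by (rule A.D_cong[OF u]) (simp_all add: A.sm_simps sm D_cot_half)
    then show ?thesis using u by (simp add: A.D_simps A.sm_simps sm D_cot_half)
  qed
  have 2: "A.Db (A.D cot_half) u = cnj (A.\<beta> u) * (A.\<beta> u * (cot_half u - \<i>)) + cnj (A.D A.\<beta> u) * (cot_half u + \<i>)"
  proof -
    have "A.Db (A.D cot_half) u = A.Db (\<lambda>w. cnj (A.\<beta> w) * (cot_half w + \<i>)) u"
      by (rule A.D_cong[OF u]) (simp_all add: A.sm_simps sm D_cot_half)
    then show ?thesis using u by (simp add: A.D_simps A.sm_simps sm D_cot_half)
  qed
  show ?thesis
    using A.D_commutator[OF u sm(1)] unfolding 1 2 D_cot_half[OF u] Y_def by (simp add: algebra_simps)
qed

end

end

text \<open>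
  The affine relation of \<open>cot_half_integrability\<close> has two different real solutions at every point, so
  both of its coefficients vanish.
\<close>

lemma structure_equation:
  assumes "framed_pair V e1 e2 p r f g" "framed_pair V e1 e2 p r f g'"
    and "\<And>u. u \<in> V \<Longrightarrow> framed_surface.q e1 e2 f u \<noteq> framed_surface.q e1 e2 g u"
    and "\<And>u. u \<in> V \<Longrightarrow> framed_surface.q e1 e2 f u \<noteq> framed_surface.q e1 e2 g' u"
    and "\<And>u. u \<in> V \<Longrightarrow> framed_surface.q e1 e2 g u \<noteq> framed_surface.q e1 e2 g' u"
    and u: "u \<in> V"
  shows "plane_frame.D e1 e2 (framed_surface.\<beta> e1 e2 f) u =
     plane_frame.c p r u * framed_surface.\<beta> e1 e2 f u + framed_surface.\<beta> e1 e2 f u * cnj (framed_surface.\<beta> e1 e2 f u)"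
proof -
  interpret P1: framed_pair V e1 e2 p r f g by fact
  interpret P2: framed_pair V e1 e2 p r f g' by fact
  define Y where "Y = P1.A.D P1.A.\<beta> u - P1.A.c u * P1.A.\<beta> u"
  have 1: "Y * (P1.cot_half u - \<i>) - cnj Y * (P1.cot_half u + \<i>) + 2 * \<i> * (P1.A.\<beta> u * cnj (P1.A.\<beta> u)) = 0"
    unfolding Y_def by (rule P1.cot_half_integrability[OF assms(3) u])
  have 2: "Y * (P2.cot_half u - \<i>) - cnj Y * (P2.cot_half u + \<i>) + 2 * \<i> * (P1.A.\<beta> u * cnj (P1.A.\<beta> u)) = 0"
    unfolding Y_def by (rule P2.cot_half_integrability[OF assms(4) u])
  have nz: "P1.quot u - 1 \<noteq> 0" "P2.quot u - 1 \<noteq> 0"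
    using P1.quot_not_1[OF assms(3) u] P2.quot_not_1[OF assms(4) u] by auto
  have "P1.quot u \<noteq> P2.quot u"
    using assms(5)[OF u] P1.q_nonzero[OF u] by (auto simp: P1.quot_def P2.quot_def)
  moreover have "P1.quot u = P2.quot u" if "P1.cot_half u = P2.cot_half u"
  proof -
    have "\<i> * (P1.quot u + 1) * (P2.quot u - 1) = \<i> * (P2.quot u + 1) * (P1.quot u - 1)"
      using that nz unfolding P1.cot_half_def P2.cot_half_def by (simp add: frac_eq_eq)
    then have "2 * P1.quot u = 2 * P2.quot u" by (simp add: algebra_simps)
    then show ?thesis by simp
  qed
  ultimately have ne: "P1.cot_half u - P2.cot_half u \<noteq> 0" by auto
  have "(Y - cnj Y) * (P1.cot_half u - P2.cot_half u) = 0" using 1 2 by algebra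
  then have "cnj Y = Y" using ne by simp
  then have "Y = P1.A.\<beta> u * cnj (P1.A.\<beta> u)" using 1 by (simp add: algebra_simps)
  then show ?thesis unfolding Y_def by (simp add: algebra_simps)
qed

section \<open>Reduction to ordinary differential equations\<close>

text \<open>
  The structure equation and the Codazzi equation make \<open>q / cnj \<beta>\<close> a solution of \<open>Db k = cnj c k\<close>, that
  is, the form \<open>k (\<omega>\<^sub>1 + \<i> \<omega>\<^sub>2)\<close> is closed; the fields \<open>X, Y\<close> below are dual to its real and imaginary
  parts.
\<close>

locale bonnet_frame = framed_surface +
  assumes q_nonzero: "u \<in> V \<Longrightarrow> q u \<noteq> 0"
    and structure_eq: "u \<in> V \<Longrightarrow> D \<beta> u = c u * \<beta> u + \<beta> u * cnj (\<beta> u)"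
    and noncritical: "u \<in> V \<Longrightarrow> D (\<lambda>w. complex_of_real (H w)) u \<noteq> 0"
begin

lemma sm_\<beta>: "sm \<beta>"
  unfolding \<beta>_def[abs_def] by (simp add: sm_simps sm_q sm_H sm_D q_nonzero)

lemma \<beta>_nonzero: "u \<in> V \<Longrightarrow> \<beta> u \<noteq> 0"
  using q_nonzero noncritical by (simp add: \<beta>_def)

definition m :: "real^2 \<Rightarrow> real" where "m u = Re (q u * cnj (q u))"
definition P :: "real^2 \<Rightarrow> real" where "P u = Re (\<beta> u * cnj (\<beta> u))"
definition \<kappa> :: "real^2 \<Rightarrow> complex" where "\<kappa> u = cnj (\<beta> u) / q u"

text \<open>\<open>X\<close> is the gradient of \<open>H\<close> in the Moebius metric, and \<open>Y\<close> is \<open>X\<close> rotated by a right angle.\<close>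

definition X :: "real^2 \<Rightarrow> real^2" where "X = rot1 \<kappa>"
definition Y :: "real^2 \<Rightarrow> real^2" where "Y = rot2 \<kappa>"

lemma m_cmod: "m u = (cmod (q u))\<^sup>2" and P_cmod: "P u = (cmod (\<beta> u))\<^sup>2"
  by (simp_all only: m_def P_def complex_norm_square[symmetric]) simp_all

lemma m_pos: "u \<in> V \<Longrightarrow> m u > 0" and P_pos: "u \<in> V \<Longrightarrow> P u > 0"
  using q_nonzero \<beta>_nonzero by (simp_all add: m_cmod P_cmod)

lemma m_P_nonzero: "u \<in> V \<Longrightarrow> m u \<noteq> 0" "u \<in> V \<Longrightarrow> P u \<noteq> 0"
  using m_pos P_pos by force+

lemma sm_fields: "sm m" "sm P" "sm \<kappa>" "sm X" "sm Y"
proof -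
  show "sm m" "sm P" unfolding m_def[abs_def] P_def[abs_def] by (simp_all add: sm_simps sm_q sm_\<beta>)
  show "sm \<kappa>" unfolding \<kappa>_def[abs_def] by (simp add: sm_simps sm_q sm_\<beta> q_nonzero)
  then show "sm X" "sm Y" unfolding X_def Y_def by (rule sm_rot)+
qed

lemma cmod_\<kappa>: "(Re (\<kappa> u))\<^sup>2 + (Im (\<kappa> u))\<^sup>2 = P u / m u"
  by (simp add: \<kappa>_def cmod_power2[symmetric] norm_divide power_divide m_cmod P_cmod)

lemma DH: "u \<in> V \<Longrightarrow> D (\<lambda>w. complex_of_real (H w)) u = \<beta> u * q u"
  using q_nonzero by (simp add: \<beta>_def)

lemma Db_\<kappa>: assumes u: "u \<in> V" shows "Db \<kappa> u + cnj (c u) * \<kappa> u = 0"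
proof -
  have "Db \<kappa> u = (cnj (D \<beta> u) * q u - cnj (\<beta> u) * Db q u) / (q u)\<^sup>2"
    unfolding \<kappa>_def[abs_def] using u by (simp add: D_divide sm_simps sm_q sm_\<beta> q_nonzero D_cnj)
  then show ?thesis
    unfolding structure_eq[OF u] codazzi[OF u] DH[OF u] \<kappa>_def using q_nonzero[OF u]
    by (simp add: field_simps power2_eq_square)
qed

lemma XY_commute: "u \<in> V \<Longrightarrow> dd X Y u = dd Y X u"
  using rot_bracket[OF _ sm_fields(3) refl] Db_\<kappa> unfolding X_def Y_def by simp

lemma dd_XY_commute:
  fixes F :: "real^2 \<Rightarrow> real"
  assumes u: "u \<in> V" and F: "sm F"
  shows "dd X (dd Y F) u = dd Y (dd X F) u"
proof -
  have "dd X (dd Y F) u - dd Y (dd X F) u = dd (\<lambda>x. dd X Y x - dd Y X x) F u"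
    by (rule dd_commutator[OF u sm_fields(4,5) F])
  also have "\<dots> = dd (\<lambda>x. 0) F u" unfolding dd_def[of _ F] using XY_commute[OF u] by simp
  also have "\<dots> = 0" using dd_minus_field[OF u F, of "\<lambda>x. 0"] by simp
  finally show ?thesis by simp
qed

lemma dd_H: assumes u: "u \<in> V" shows "dd X H u = P u" "dd Y H u = 0"
proof -
  have \<kappa>DH: "\<kappa> u * D (\<lambda>w. complex_of_real (H w)) u = complex_of_real (P u)"
    unfolding DH[OF u] \<kappa>_def P_cmod complex_norm_square using q_nonzero[OF u] by simp
  have "dd X H u = Re (\<kappa> u * D (\<lambda>w. complex_of_real (H w)) u)" "dd Y H u = - Im (\<kappa> u * D (\<lambda>w. complex_of_real (H w)) u)"
    by (simp_all add: X_def Y_def dd_rot[OF u sm_H] Db_of_real[OF u sm_H])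
  then show "dd X H u = P u" "dd Y H u = 0" unfolding \<kappa>DH by simp_all
qed

lemma dd_zeroI: "u \<in> V \<Longrightarrow> (\<And>x. x \<in> V \<Longrightarrow> F x = k) \<Longrightarrow> dd v F u = 0"
  by (rule trans[OF dd_cong[of u "\<lambda>x. k" F v] dd_const[of u v k]]) (simp_all add: smooth_on_const)

lemma dd_Y_P: assumes u: "u \<in> V" shows "dd Y P u = 0"
proof -
  have "dd Y P u = dd Y (dd X H) u"
    by (rule dd_cong[OF u]) (simp_all add: dd_H sm_dd sm_fields sm_H)
  also have "\<dots> = dd X (dd Y H) u" by (rule dd_XY_commute[OF u sm_H, symmetric])
  also have "\<dots> = 0" by (rule dd_zeroI[OF u]) (simp add: dd_H)
  finally show ?thesis .
qed

lemma XY_conformal: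
  assumes u: "u \<in> V"
  shows "X u \<bullet> (fund_form1 f u *v X u) = P u / m u" "X u \<bullet> (fund_form1 f u *v Y u) = 0"
    "Y u \<bullet> (fund_form1 f u *v X u) = 0" "Y u \<bullet> (fund_form1 f u *v Y u) = P u / m u"
proof -
  have d: "dd X f u = Re (\<kappa> u) *\<^sub>R E1 u + Im (\<kappa> u) *\<^sub>R E2 u" "dd Y f u = - Im (\<kappa> u) *\<^sub>R E1 u + Re (\<kappa> u) *\<^sub>R E2 u"
    by (simp_all add: X_def Y_def dd_rot[OF u sm_f] E1_def E2_def)
  show "X u \<bullet> (fund_form1 f u *v X u) = P u / m u" "X u \<bullet> (fund_form1 f u *v Y u) = 0"
    "Y u \<bullet> (fund_form1 f u *v X u) = 0" "Y u \<bullet> (fund_form1 f u *v Y u) = P u / m u"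
    unfolding dd_inner_dd[OF u sm_f, symmetric] d cmod_\<kappa>[symmetric]
    by (simp_all add: inner_add_left inner_add_right inner_diff_left inner_diff_right inner_E[OF u] power2_eq_square)
qed

lemma XY_oriented: assumes u: "u \<in> V" shows "wedge X Y u > 0"
proof -
  have "wedge X Y u = (P u / m u) * (wedge e1 e2 u)"
    unfolding cmod_\<kappa>[symmetric] by (simp add: X_def Y_def rot1_def rot2_def power2_eq_square algebra_simps)
  then show ?thesis using m_pos[OF u] P_pos[OF u] oriented[OF u] by simp
qed

text \<open>This serves the Moebius metric (\<open>s = m\<close>), the first fundamental form (\<open>s = 1\<close>) and the hyperbolic
  metric (\<open>s = P\<close>).\<close>

lemma curvature_XY:
  assumes g: "\<And>w. w \<in> V \<Longrightarrow> g w = s w *\<^sub>R fund_form1 f w" and s: "\<And>w. w \<in> V \<Longrightarrow> s w * (P w / m w) = \<rho> w"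
    and \<rho>: "sm \<rho>" "\<And>w. w \<in> V \<Longrightarrow> \<rho> w > 0" and u: "u \<in> V"
  shows "metric_curvature g u = - (dd X (\<lambda>w. dd X \<rho> w / \<rho> w) u + dd Y (\<lambda>w. dd Y \<rho> w / \<rho> w) u) / (2 * \<rho> u)"
proof -
  have gv: "x \<bullet> (g w *v y) = s w * (x \<bullet> (fund_form1 f w *v y))" if "w \<in> V" for w x y
    unfolding g[OF that] by (simp add: scaleR_matrix_vector_assoc[symmetric])
  show ?thesis
    by (rule metric_curvature_conformal[OF sm_fields(4,5) \<rho> XY_oriented _ _ _ _ XY_commute u])
      (simp_all add: gv XY_conformal s[unfolded times_divide_eq_right])
qed

definition y :: "real^2 \<Rightarrow> real" where "y u = dd X P u / P u"
definition L :: "real^2 \<Rightarrow> real" where "L = dd X y"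

lemma sm_y: "sm y" unfolding y_def[abs_def] by (simp add: sm_simps sm_dd sm_fields m_P_nonzero)
lemma sm_L: "sm L" unfolding L_def by (simp add: sm_dd sm_fields sm_y)

lemma dd_X_P: "u \<in> V \<Longrightarrow> dd X P u = P u * y u"
  using m_P_nonzero by (simp add: y_def)

lemma m_curvatures: "u \<in> V \<Longrightarrow> m u = (mean_curvature f u)\<^sup>2 - gauss_curvature f u"
  by (simp add: m_cmod norm_q_curvatures)

lemma moebius: assumes u: "u \<in> V" shows "moebius_curvature f u = - L u / (2 * P u)"
proof -
  have "moebius_curvature f u = - (dd X (\<lambda>w. dd X P w / P w) u + dd Y (\<lambda>w. dd Y P w / P w) u) / (2 * P u)"
    unfolding moebius_curvature_def
    by (rule curvature_XY[OF _ _ sm_fields(2) P_pos u, where s = m]) (simp_all add: moebius_metric_def m_curvatures[symmetric] m_P_nonzero)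
  moreover have "dd Y (\<lambda>w. dd Y P w / P w) u = 0" by (rule dd_zeroI[OF u]) (simp add: dd_Y_P)
  ultimately show ?thesis by (simp add: L_def y_def[abs_def])
qed

text \<open>
  In the frame \<open>1 / cnj \<beta>\<close>, orthonormal for \<open>P I\<close>, the structure equation reads \<open>[E\<^sub>1, E\<^sub>2] = - E\<^sub>2\<close>:
  this metric is hyperbolic.
\<close>

lemma hyperbolic:
  assumes u: "u \<in> V" shows "metric_curvature (\<lambda>w. P w *\<^sub>R fund_form1 f w) u = - 1"
proof -
  define k where "k w = 1 / cnj (\<beta> w)" for w
  have smk: "sm k" unfolding k_def[abs_def] by (simp add: sm_simps sm_\<beta> \<beta>_nonzero)
  have br: "dd (rot1 k) (rot2 k) w - dd (rot2 k) (rot1 k) w = 0 *\<^sub>R rot1 k w + (- 1) *\<^sub>R rot2 k w" if w: "w \<in> V" for w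
  proof -
    have Dbk: "Db k w = - cnj (D \<beta> w) / (cnj (\<beta> w))\<^sup>2"
      unfolding k_def[abs_def] using w by (simp add: D_divide sm_simps sm_\<beta> \<beta>_nonzero D_cnj D_const)
    have "cnj (k w) * (Db k w + cnj (c w) * k w) = - k w"
      unfolding Dbk structure_eq[OF w] k_def using \<beta>_nonzero[OF w] by (simp add: field_simps power2_eq_square)
    then show ?thesis using rot_bracket[OF w smk refl] by (simp add: rot2_def)
  qed
  have k2: "P w * ((Re (k w))\<^sup>2 + (Im (k w))\<^sup>2) = 1" if "w \<in> V" for w
    using \<beta>_nonzero[OF that] by (simp add: cmod_power2[symmetric] P_cmod k_def norm_divide power_divide)
  have g: "x \<bullet> ((P w *\<^sub>R fund_form1 f w) *v y) = P w * (x \<bullet> (fund_form1 f w *v y))" for w x y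
    by (simp add: scaleR_matrix_vector_assoc[symmetric])
  have d: "dd (rot1 k) f w = Re (k w) *\<^sub>R E1 w + Im (k w) *\<^sub>R E2 w" "dd (rot2 k) f w = - Im (k w) *\<^sub>R E1 w + Re (k w) *\<^sub>R E2 w"
    if "w \<in> V" for w
    by (simp_all add: dd_rot[OF that sm_f] E1_def E2_def)
  have "metric_curvature (\<lambda>w. P w *\<^sub>R fund_form1 f w) u = dd (rot1 k) (\<lambda>w. - 1) u - dd (rot2 k) (\<lambda>w. 0) u - 0\<^sup>2 - (- 1)\<^sup>2"
  proof (rule metric_curvature_frame[OF sm_rot[OF smk] smooth_on_const smooth_on_const _ _ _ _ _ br u])
    fix w assume w: "w \<in> V"
    have "P w * (rot1 k w $ 1 * rot2 k w $ 2 - rot1 k w $ 2 * rot2 k w $ 1) =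
      P w * ((Re (k w))\<^sup>2 + (Im (k w))\<^sup>2) * (wedge e1 e2 w)"
      by (simp add: rot1_def rot2_def power2_eq_square algebra_simps)
    then show "rot1 k w $ 1 * rot2 k w $ 2 - rot1 k w $ 2 * rot2 k w $ 1 \<noteq> 0"
      unfolding k2[OF w] using independent[OF w] by auto
    show "rot1 k w \<bullet> ((P w *\<^sub>R fund_form1 f w) *v rot1 k w) = 1" "rot1 k w \<bullet> ((P w *\<^sub>R fund_form1 f w) *v rot2 k w) = 0"
      "rot2 k w \<bullet> ((P w *\<^sub>R fund_form1 f w) *v rot1 k w) = 0" "rot2 k w \<bullet> ((P w *\<^sub>R fund_form1 f w) *v rot2 k w) = 1"
      unfolding g dd_inner_dd[OF w sm_f, symmetric] d[OF w] using k2[OF w]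
      by (simp_all add: inner_add_left inner_add_right inner_diff_left inner_diff_right inner_E[OF w] power2_eq_square add.commute)
  qed
  then show ?thesis by (simp add: dd_const[OF u])
qed

text \<open>
  The theorema egregium expresses \<open>K\<close> by the Laplacian of \<open>log (P / m)\<close>.  Adding \<open>log P\<close>, whose Laplacian is
  \<open>L\<close>, gives the logarithm of the conformal factor of the hyperbolic metric, whose Laplacian is known.
\<close>

lemma gauss_P:
  assumes u: "u \<in> V" shows "2 * P u * ((H u)\<^sup>2 + P u) = m u * (L u + 2 * P u)"
proof -
  define \<sigma> where "\<sigma> w = P w / m w" for w
  define \<tau> where "\<tau> w = P w * \<sigma> w" for w
  have sm\<sigma>: "sm \<sigma>" "sm \<tau>" unfolding \<sigma>_def[abs_def] \<tau>_def[abs_def] \<sigma>_def by (simp_all add: sm_simps sm_fields m_P_nonzero)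
  have pos: "\<sigma> w > 0" "\<tau> w > 0" if "w \<in> V" for w using m_pos[OF that] P_pos[OF that] by (simp_all add: \<sigma>_def \<tau>_def)
  have nz: "\<sigma> w \<noteq> 0" if "w \<in> V" for w using pos[OF that] by simp
  have K: "gauss_curvature f u = - (dd X (\<lambda>w. dd X \<sigma> w / \<sigma> w) u + dd Y (\<lambda>w. dd Y \<sigma> w / \<sigma> w) u) / (2 * \<sigma> u)"
    unfolding theorema_egregium[OF u, symmetric]
    by (rule curvature_XY[OF _ _ sm\<sigma>(1) pos(1) u, where s = "\<lambda>_. 1"]) (simp_all add: \<sigma>_def)
  have h: "- 1 = - (dd X (\<lambda>w. dd X \<tau> w / \<tau> w) u + dd Y (\<lambda>w. dd Y \<tau> w / \<tau> w) u) / (2 * \<tau> u)"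
    unfolding hyperbolic[OF u, symmetric]
    by (rule curvature_XY[OF _ _ sm\<sigma>(2) pos(2) u, where s = P]) (simp_all add: \<tau>_def \<sigma>_def)
  have log: "dd v \<tau> w / \<tau> w = dd v P w / P w + dd v \<sigma> w / \<sigma> w" if w: "w \<in> V" for v w
    using pos[OF w] m_P_nonzero[OF w] unfolding \<tau>_def[abs_def] by (simp add: dd_mult[OF w] sm_fields sm\<sigma> field_simps)
  have dX: "dd X (\<lambda>w. dd X \<tau> w / \<tau> w) u = L u + dd X (\<lambda>w. dd X \<sigma> w / \<sigma> w) u"
  proof -
    have "dd X (\<lambda>w. dd X \<tau> w / \<tau> w) u = dd X (\<lambda>w. y w + dd X \<sigma> w / \<sigma> w) u"
      by (rule dd_cong[OF u]) (simp_all add: log y_def sm_simps sm_y[unfolded y_def[abs_def]] sm_dd sm_fields sm\<sigma> nz m_P_nonzero)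
    also have "\<dots> = dd X y u + dd X (\<lambda>w. dd X \<sigma> w / \<sigma> w) u"
      by (rule dd_add[OF u sm_y]) (simp add: sm_simps sm_dd sm_fields sm\<sigma> nz)
    finally show ?thesis by (simp add: L_def)
  qed
  have dY: "dd Y (\<lambda>w. dd Y \<tau> w / \<tau> w) u = dd Y (\<lambda>w. dd Y \<sigma> w / \<sigma> w) u"
    by (rule dd_cong[OF u]) (simp_all add: log dd_Y_P sm_simps sm_dd sm_fields sm\<sigma> nz)
  have "2 * \<tau> u = L u - 2 * \<sigma> u * gauss_curvature f u"
    using K h pos[OF u] unfolding dX dY by (simp add: field_simps)
  moreover have "gauss_curvature f u = (H u)\<^sup>2 - m u" using m_curvatures[OF u] curvatures_in_frame(2)[OF u] by simp
  ultimately have "2 * (P u * (P u / m u)) = L u - 2 * (P u / m u) * ((H u)\<^sup>2 - m u)" by (simp add: \<tau>_def \<sigma>_def)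
  then show ?thesis using m_P_nonzero[OF u] by (simp add: field_simps power2_eq_square)
qed

text \<open>
  \<open>Y\<close> annihilates \<open>H\<close>, \<open>P\<close> and \<open>L\<close>, and the factor of \<open>m\<close> in \<open>gauss_P\<close> is positive.
\<close>

lemma dd_Y_m: assumes u: "u \<in> V" shows "dd Y m u = 0"
proof -
  have Yy: "dd Y y w = 0" if w: "w \<in> V" for w
  proof -
    have "dd Y (dd X P) w = 0"
      unfolding dd_XY_commute[OF w sm_fields(2), symmetric] by (rule dd_zeroI[OF w]) (rule dd_Y_P)
    then show ?thesis unfolding y_def[abs_def] by (simp add: dd_divide[OF w] sm_dd sm_fields m_P_nonzero dd_Y_P[OF w])
  qed
  have YL: "dd Y L u = 0"
    unfolding L_def dd_XY_commute[OF u sm_y, symmetric] by (rule dd_zeroI[OF u Yy])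
  have "dd Y (\<lambda>w. 2 * P w * ((H w)\<^sup>2 + P w) - m w * (L w + 2 * P w)) u = 0"
    by (rule dd_zeroI[OF u]) (simp add: gauss_P)
  then have "dd Y m u * (L u + 2 * P u) = 0"
    using u by (simp add: dd_simps sm_simps sm_fields sm_H sm_L dd_Y_P dd_H YL)
  moreover have "m u * (L u + 2 * P u) \<noteq> 0"
    unfolding gauss_P[OF u, symmetric] using P_pos[OF u] by (simp add: add_nonneg_pos[THEN less_imp_neq, symmetric])
  ultimately show ?thesis by simp
qed

text \<open>
  The hyperbolic metric once more, now that its conformal factor \<open>P\<^sup>2 / m\<close> is known to depend on the
  direction \<open>X\<close> only.
\<close>

lemma liouville:
  assumes u: "u \<in> V" shows "dd X (\<lambda>w. 2 * y w - dd X m w / m w) u = 2 * (P u)\<^sup>2 / m u"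
proof -
  define \<tau> where "\<tau> w = (P w)\<^sup>2 / m w" for w
  have sm\<tau>: "sm \<tau>" unfolding \<tau>_def[abs_def] by (simp_all add: sm_simps sm_fields m_P_nonzero)
  have pos: "\<tau> w > 0" if "w \<in> V" for w using m_pos[OF that] P_pos[OF that] by (simp_all add: \<tau>_def)
  have h: "- 1 = - (dd X (\<lambda>w. dd X \<tau> w / \<tau> w) u + dd Y (\<lambda>w. dd Y \<tau> w / \<tau> w) u) / (2 * \<tau> u)"
    unfolding hyperbolic[OF u, symmetric]
    by (rule curvature_XY[OF _ _ sm\<tau> pos u, where s = P]) (simp_all add: \<tau>_def power2_eq_square)
  have "dd Y (\<lambda>w. dd Y \<tau> w / \<tau> w) u = 0"
    by (rule dd_zeroI[OF u]) (simp add: \<tau>_def[abs_def] dd_divide dd_power2 sm_simps sm_fields m_P_nonzero dd_Y_P dd_Y_m)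
  moreover have "dd X (\<lambda>w. dd X \<tau> w / \<tau> w) u = dd X (\<lambda>w. 2 * y w - dd X m w / m w) u"
  proof (rule dd_cong[OF u])
    show "sm (\<lambda>w. 2 * y w - dd X m w / m w)" by (simp add: sm_simps sm_y sm_dd sm_fields m_P_nonzero)
    fix w assume w: "w \<in> V"
    have "dd X \<tau> w = (2 * P w * (P w * y w) * m w - (P w)\<^sup>2 * dd X m w) / (m w)\<^sup>2"
      using w by (simp add: \<tau>_def[abs_def] dd_divide dd_power2 sm_simps sm_fields m_P_nonzero dd_X_P)
    then show "2 * y w - dd X m w / m w = dd X \<tau> w / \<tau> w"
      using m_P_nonzero[OF w] by (simp add: \<tau>_def field_simps power2_eq_square)
  qed
  ultimately show ?thesis using h pos[OF u] m_P_nonzero[OF u] by (simp add: \<tau>_def field_simps)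
qed

end

section \<open>Constant curvature ratio and constant Moebius curvature\<close>

context bonnet_frame
begin

text \<open>
  With \<open>h = P / H\<close> and \<open>e = 1 - \<rho>\<close> the Gauss equation becomes linear in \<open>y\<close>; its derivative is a second
  linear relation between \<open>y\<close>, \<open>h\<close> and \<open>H\<close>, and a third one contradicts these unless \<open>e = 1\<close>.
\<close>

lemma curvature_ratio_zero:
  assumes K: "\<And>u. u \<in> V \<Longrightarrow> gauss_curvature f u = \<rho> * (mean_curvature f u)\<^sup>2" and u0: "u0 \<in> V"
  shows "\<rho> = 0"
proof (rule ccontr)
  assume "\<rho> \<noteq> 0"
  define e where "e = 1 - \<rho>"
  have e1: "e \<noteq> 1" using \<open>\<rho> \<noteq> 0\<close> by (simp add: e_def)
  have m: "m w = e * (H w)\<^sup>2" if "w \<in> V" for w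
    using m_curvatures[OF that] K[OF that] curvatures_in_frame(2)[OF that] by (simp add: e_def algebra_simps)
  have e0: "e \<noteq> 0" and H0: "H w \<noteq> 0" if "w \<in> V" for w
    using m[OF that] m_P_nonzero(1)[OF that] by auto
  note e0 = e0[OF u0]
  define h where "h w = P w / H w" for w
  have smh: "sm h" unfolding h_def[abs_def] by (simp add: sm_simps sm_fields sm_H H0)
  have h0: "h w \<noteq> 0" and P: "P w = h w * H w" if "w \<in> V" for w
    using that by (simp_all add: h_def H0 m_P_nonzero)
  have dh: "dd X h w = h w * (y w - h w)" if w: "w \<in> V" for w
    unfolding h_def[abs_def] using w H0[OF w] by (simp add: dd_divide sm_fields sm_H H0 dd_H dd_X_P field_simps power2_eq_square)
  have L: "e * L w = e * h w * (y w - h w) + (h w)\<^sup>2" if w: "w \<in> V" for w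
  proof -
    have z: "2 * y v - dd X m v / m v = 2 * y v - 2 * h v" if v: "v \<in> V" for v
    proof -
      have "dd X m v = dd X (\<lambda>w. e * (H w)\<^sup>2) v" by (rule dd_cong[OF v]) (simp_all add: m sm_simps sm_H)
      also have "\<dots> = e * (2 * H v * P v)" using v by (simp add: dd_simps sm_simps sm_H dd_H)
      finally show ?thesis using e0 H0[OF v] by (simp add: m[OF v] h_def power2_eq_square)
    qed
    have "dd X (\<lambda>w. 2 * y w - dd X m w / m w) w = dd X (\<lambda>w. 2 * y w - 2 * h w) w"
      by (rule dd_cong[OF w]) (simp_all add: z sm_simps sm_y smh)
    also have "\<dots> = 2 * L w - 2 * (h w * (y w - h w))" using w by (simp add: dd_simps sm_simps sm_y smh dh L_def)
    finally have "2 * L w - 2 * (h w * (y w - h w)) = 2 * (h w)\<^sup>2 / e"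
      unfolding liouville[OF w] m[OF w] P[OF w] using e0 H0[OF w] by (simp add: power2_eq_square)
    then show ?thesis using e0 by (simp add: field_simps)
  qed
  have r1: "e * y w = 2 * (1 - e) * H w + (1 + e) * h w" if w: "w \<in> V" for w
  proof -
    have "(h w * (H w)\<^sup>2) * (e * y w - 2 * (1 - e) * H w - (1 + e) * h w) = 0"
      using gauss_P[OF w] L[OF w] unfolding m[OF w] P[OF w] by algebra
    then show ?thesis using h0[OF w] H0[OF w] by simp
  qed
  have r2: "y w = 2 * h w - 2 * (1 - e) * H w" if w: "w \<in> V" for w
  proof -
    have "dd X (\<lambda>w. e * y w) w = dd X (\<lambda>w. 2 * (1 - e) * H w + (1 + e) * h w) w"
      by (rule dd_cong[OF w]) (simp_all add: r1 sm_simps sm_H smh)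
    then have "e * L w = 2 * (1 - e) * (h w * H w) + (1 + e) * (h w * (y w - h w))"
      using w by (simp add: dd_simps sm_simps sm_y smh sm_H dh dd_H P L_def)
    then have "h w * (y w - 2 * h w + 2 * (1 - e) * H w) = 0" using L[OF w] by algebra
    then show ?thesis using h0[OF w] by simp
  qed
  have r3: "h w = - 2 * (1 + e) * H w" if w: "w \<in> V" for w
  proof -
    have "(1 - e) * (h w + 2 * (1 + e) * H w) = 0" using r1[OF w] r2[OF w] by algebra
    then have "h w + 2 * (1 + e) * H w = 0" using e1 by (simp only: mult_eq_0_iff) simp
    then show ?thesis by algebra
  qed
  have "dd X h u0 = dd X (\<lambda>w. - 2 * (1 + e) * H w) u0"
    by (rule dd_cong[OF u0]) (simp_all add: r3 sm_simps sm_H)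
  then have "h u0 * (y u0 - h u0) = - 2 * (1 + e) * (h u0 * H u0)"
    using u0 by (simp add: dd_simps sm_simps sm_H dh dd_H P)
  then have "h u0 * (y u0 - 2 * h u0) = 0" using r3[OF u0] by algebra
  then have "(1 - e) * H u0 = 0" using h0[OF u0] r2[OF u0] by simp
  then show False using e1 H0[OF u0] by simp
qed

text \<open>
  Constant Moebius curvature \<open>k\<close> makes \<open>P + H\<^sup>2\<close> a quadratic polynomial \<open>e H\<^sup>2 + b H + a\<close> in \<open>H\<close>
  with \<open>e = 1 - k\<close>; Liouville's equation then forces \<open>a = b = 0\<close>.
\<close>

lemma constant_moebius_curvature_imp_flat:
  assumes K: "\<And>u. u \<in> V \<Longrightarrow> moebius_curvature f u = k" and u: "u \<in> V"
  shows "gauss_curvature f u = 0" "P u = - k * (H u)\<^sup>2"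
proof -
  define e where "e = 1 - k"
  have L: "L w = - 2 * k * P w" if "w \<in> V" for w
    using moebius[OF that] K[OF that] m_P_nonzero[OF that] by (simp add: field_simps)
  define S where "S w = P w + (H w)\<^sup>2" for w
  have smS: "sm S" unfolding S_def[abs_def] by (simp add: sm_simps sm_fields sm_H)
  have Spos: "S w > 0" if "w \<in> V" for w unfolding S_def using P_pos[OF that] by (simp add: add_pos_nonneg)
  have S: "S w = e * m w" if w: "w \<in> V" for w
  proof -
    have "2 * P w * (S w - e * m w) = 0"
      using gauss_P[OF w] unfolding L[OF w] S_def e_def by algebra
    then show ?thesis using m_P_nonzero[OF w] by simp
  qed
  have e0: "e \<noteq> 0" using S[OF u] Spos[OF u] by auto
  have S0: "S w \<noteq> 0" if "w \<in> V" for w using Spos[OF that] by simp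
  define v where "v w = 2 * H w + y w" for w
  have smv: "sm v" unfolding v_def[abs_def] by (simp add: sm_simps sm_H sm_y)
  have dS: "dd X S w = P w * v w" if "w \<in> V" for w
    unfolding S_def[abs_def] v_def using that by (simp add: dd_simps sm_simps sm_fields sm_H dd_H dd_X_P algebra_simps)
  have dv: "dd X v w = 2 * e * P w" if "w \<in> V" for w
    unfolding v_def[abs_def] e_def using that
    by (simp add: dd_simps sm_simps sm_y sm_H dd_H L_def[symmetric] L algebra_simps)
  have clear: "A * s\<^sup>2 - N = Q * s" if "A - N / s\<^sup>2 = Q / s" "s \<noteq> 0" for A N Q s :: real
  proof -
    have "(A - N / s\<^sup>2) * s\<^sup>2 = Q / s * s\<^sup>2" using that(1) by simp
    then show ?thesis using that(2) by (simp add: left_diff_distrib power2_eq_square)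
  qed
  \<comment> \<open>Liouville's equation, multiplied by \<open>S\<^sup>2 / P\<close>\<close>
  have \<Phi>: "- 4 * (S w)\<^sup>2 + 4 * e * (H w)\<^sup>2 * S w + 2 * H w * S w * v w - (H w)\<^sup>2 * (v w)\<^sup>2 = 0" if w: "w \<in> V" for w
  proof -
    have z: "2 * y x - dd X m x / m x = 2 * y x - P x * v x / S x" if x: "x \<in> V" for x
    proof -
      have "dd X m x = dd X (\<lambda>w. S w / e) x" by (rule dd_cong[OF x]) (simp_all add: S e0 sm_simps smS)
      also have "\<dots> = P x * v x / e" using x by (simp add: dd_divide dd_const sm_simps smS e0 dS power2_eq_square)
      finally show ?thesis using S[OF x] e0 by simp
    qed
    have "dd X (\<lambda>w. 2 * y w - dd X m w / m w) w = dd X (\<lambda>w. 2 * y w - P w * v w / S w) w"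
      by (rule dd_cong[OF w]) (simp_all add: z sm_simps sm_y sm_fields smv smS S0)
    also have "\<dots> = 2 * L w - ((P w * (2 * e * P w) + P w * y w * v w) * S w - P w * v w * (P w * v w)) / (S w)\<^sup>2"
      using w by (simp add: dd_simps sm_simps sm_y sm_fields smv smS S0 dS dv dd_X_P L_def)
    finally have "2 * L w - ((P w * (2 * e * P w) + P w * y w * v w) * S w - P w * v w * (P w * v w)) / (S w)\<^sup>2 = 2 * e * (P w)\<^sup>2 / S w"
      unfolding liouville[OF w] S[OF w] using e0 m_P_nonzero[OF w] by simp
    from clear[OF this S0[OF w]] have "- 4 * k * P w * (S w)\<^sup>2 - ((P w * (2 * e * P w) + P w * y w * v w) * S w - P w * v w * (P w * v w)) = 2 * e * (P w)\<^sup>2 * S w"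
      using L[OF w] by algebra
    then have "P w * (- 4 * (S w)\<^sup>2 + 4 * e * (H w)\<^sup>2 * S w + 2 * H w * S w * v w - (H w)\<^sup>2 * (v w)\<^sup>2) = 0"
      using S_def[of w] v_def[of w] e_def by algebra
    then show ?thesis using m_P_nonzero[OF w] by simp
  qed
  define b where "b w = v w - 2 * e * H w" for w
  define a where "a w = S w - e * (H w)\<^sup>2 - b w * H w" for w
  have smb: "sm b" unfolding b_def[abs_def] by (simp add: sm_simps sm_H smv)
  have sma: "sm a" unfolding a_def[abs_def] by (simp add: sm_simps sm_H smb smS)
  have db: "dd X b w = 0" if "w \<in> V" for w
    unfolding b_def[abs_def] using that by (simp add: dd_simps sm_simps sm_H smv dv dd_H)
  have da: "dd X a w = 0" if w: "w \<in> V" for w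
    unfolding a_def[abs_def] using w by (simp add: dd_simps sm_simps sm_H smb smS dS db dd_H) (simp add: b_def algebra_simps)
  have \<Psi>: "- 2 * e * b w * (H w * (H w)\<^sup>2) - 3 * (b w)\<^sup>2 * (H w)\<^sup>2 - 6 * a w * b w * H w - 4 * (a w)\<^sup>2 = 0" if w: "w \<in> V" for w
  proof -
    have "S w = a w + b w * H w + e * (H w)\<^sup>2" "v w = b w + 2 * e * H w" by (simp_all add: a_def b_def)
    with \<Phi>[OF w] show ?thesis by algebra
  qed
  \<comment> \<open>Differentiating \<open>\<Psi>\<close> along \<open>X\<close> reproduces the positive function \<open>S\<close> as a factor.\<close>
  have b: "b w = 0" if w: "w \<in> V" for w
  proof -
    have "dd X (\<lambda>w. - 2 * e * b w * (H w * (H w)\<^sup>2) - 3 * (b w)\<^sup>2 * (H w)\<^sup>2 - 6 * a w * b w * H w - 4 * (a w)\<^sup>2) w = - 6 * P w * b w * (e * (H w)\<^sup>2 + b w * H w + a w)"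
      using w by (simp add: dd_simps sm_simps sm_H smb sma db da dd_H algebra_simps power2_eq_square)
    moreover have "dd X (\<lambda>w. - 2 * e * b w * (H w * (H w)\<^sup>2) - 3 * (b w)\<^sup>2 * (H w)\<^sup>2 - 6 * a w * b w * H w - 4 * (a w)\<^sup>2) w = 0"
      by (rule dd_zeroI[OF w \<Psi>])
    ultimately have "- 6 * P w * b w * (e * (H w)\<^sup>2 + b w * H w + a w) = 0" by metis
    then have "P w * b w * S w = 0" by (simp add: a_def)
    then show ?thesis using m_P_nonzero[OF w] S0[OF w] by simp
  qed
  have "a u = 0" using \<Psi>[OF u] b[OF u] by simp
  then have Se: "S u = e * (H u)\<^sup>2" using b[OF u] by (simp add: a_def)
  then show "P u = - k * (H u)\<^sup>2" by (simp add: S_def e_def algebra_simps)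
  have "m u = (H u)\<^sup>2" using S[OF u] Se e0 by simp
  then show "gauss_curvature f u = 0" using m_curvatures[OF u] curvatures_in_frame(2)[OF u] by simp
qed

end

section \<open>Existence of adapted frames, and independence of the parametrization\<close>

lemma frechet_derivative_cong_open:
  assumes "open S" "u \<in> S" "\<And>w. w \<in> S \<Longrightarrow> f w = g w"
  shows "frechet_derivative f (at u) = frechet_derivative g (at u)"
proof -
  have "(f has_derivative f') (at u) \<longleftrightarrow> (g has_derivative f') (at u)" for f'
    using has_derivative_transform_within_open[OF _ assms(1,2), of f f' UNIV g]
      has_derivative_transform_within_open[OF _ assms(1,2), of g f' UNIV f] assms(3) by auto
  then show ?thesis unfolding frechet_derivative_def by simp
qed

lemma pd_cong:
  assumes "open S" "u \<in> S" "\<And>w. w \<in> S \<Longrightarrow> f w = g w"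
  shows "pd i f u = pd i g u"
  using frechet_derivative_cong_open[OF assms] by (simp add: pd_def)

lemma metric_curvature_cong:
  assumes S: "open S" "u \<in> S" and eq: "\<And>w. w \<in> S \<Longrightarrow> g w = g' w"
  shows "metric_curvature g u = metric_curvature g' u"
proof -
  have pd: "pd i (\<lambda>w. g w $ j $ l) w = pd i (\<lambda>w. g' w $ j $ l) w" if "w \<in> S" for i j l w
    by (rule pd_cong[OF S(1) that]) (simp add: eq)
  have "christoffel g k i j w = christoffel g' k i j w" if "w \<in> S" for k i j w
    unfolding christoffel_def pd[OF that] eq[OF that] ..
  then have "riemann g l i j k u = riemann g' l i j k u" for l i j k
    unfolding riemann_def using S by (simp add: pd_cong[OF S, of "christoffel g a b c" "christoffel g' a b c" for a b c])
  then show ?thesis unfolding metric_curvature_def eq[OF S(2)] by simp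
qed

text \<open>
  The bracket coefficients are given by Cramer's rule.
\<close>

lemma (in plane_domain) plane_frameI:
  assumes sm: "sm e1" "sm e2" and oriented: "\<And>u. u \<in> V \<Longrightarrow> wedge e1 e2 u > 0"
  defines "d \<equiv> \<lambda>u. wedge e1 e2 u" and "b \<equiv> \<lambda>u. dd e1 e2 u - dd e2 e1 u"
  shows "plane_frame V e1 e2 (\<lambda>u. (wedge b e2 u) / d u) (\<lambda>u. (wedge e1 b u) / d u)"
proof unfold_locales
  have d: "d u \<noteq> 0" if "u \<in> V" for u using oriented[OF that] by (simp add: d_def)
  have smd: "sm d" and smb: "sm b" unfolding d_def b_def by (simp_all add: sm_simps sm sm_dd)
  show "sm (\<lambda>u. (wedge b e2 u) / d u)" "sm (\<lambda>u. (wedge e1 b u) / d u)"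
    using d by (simp_all add: sm_simps sm smd smb)
  fix u assume u: "u \<in> V"
  have "b u $ i * d u = (wedge b e2 u) * e1 u $ i + (wedge e1 b u) * e2 u $ i" for i
    using exhaust_2[of i] by (auto simp: d_def algebra_simps)
  then have "b u = ((wedge b e2 u) / d u) *\<^sub>R e1 u + ((wedge e1 b u) / d u) *\<^sub>R e2 u"
    using d[OF u] by (simp add: vec_eq_iff add_divide_distrib[symmetric] eq_divide_eq)
  then show "dd e1 e2 u - dd e2 e1 u = ((wedge b e2 u) / d u) *\<^sub>R e1 u + ((wedge e1 b u) / d u) *\<^sub>R e2 u"
    unfolding b_def .
qed (use sm oriented in auto)

lemma fund_form1_pos:
  assumes diff: "f differentiable (at u)" and inj: "inj (frechet_derivative f (at u))"
  shows "fund_form1 f u $ 1 $ 1 > 0" "fund_form1 f u $ 1 $ 1 * det (fund_form1 f u) > 0"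
proof -
  let ?L = "frechet_derivative f (at u)"
  have lin: "linear ?L" by (rule linear_frechet_derivative[OF diff])
  have nz: "?L h \<noteq> 0" if "h \<noteq> 0" for h
    using injD[OF inj, of h 0] that linear_0[OF lin] by auto
  let ?a = "?L (axis 1 1)" and ?b = "?L (axis 2 1)"
  have I: "fund_form1 f u $ 1 $ 1 = ?a \<bullet> ?a" "fund_form1 f u $ 1 $ 2 = ?a \<bullet> ?b" "fund_form1 f u $ 2 $ 1 = ?a \<bullet> ?b" "fund_form1 f u $ 2 $ 2 = ?b \<bullet> ?b"
    by (simp_all add: fund_form1_def pd_def inner_commute)
  show 1: "fund_form1 f u $ 1 $ 1 > 0" unfolding I using nz[of "axis 1 1"] by (simp add: axis_eq_0_iff)
  define h :: "real^2" where "h = (?a \<bullet> ?a) *\<^sub>R axis 2 1 - (?a \<bullet> ?b) *\<^sub>R axis 1 1"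
  have "h $ 2 = ?a \<bullet> ?a" by (simp add: h_def axis_def)
  then have "h \<noteq> 0" using 1 unfolding I by (auto simp: zero_vec_def)
  from nz[OF this] have "?L h \<bullet> ?L h > 0" by simp
  moreover have "?L h = (?a \<bullet> ?a) *\<^sub>R ?b - (?a \<bullet> ?b) *\<^sub>R ?a"
    by (simp add: h_def linear_diff[OF lin] linear_cmul[OF lin])
  ultimately show "fund_form1 f u $ 1 $ 1 * det (fund_form1 f u) > 0"
    unfolding det_2 I by (simp add: inner_diff_left inner_diff_right inner_commute[of ?b ?a] algebra_simps)
qed

text \<open>Gram-Schmidt orthonormalization of the coordinate fields.\<close>

lemma framed_surface_exists:
  assumes V: "open V" and f: "smooth_on V f" and inj: "\<And>u. u \<in> V \<Longrightarrow> inj (frechet_derivative f (at u))"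
  shows "\<exists>e1 e2 p r. framed_surface V e1 e2 p r f"
proof -
  interpret plane_domain V by unfold_locales (rule V)
  define E where "E u = fund_form1 f u $ 1 $ 1" for u
  define F where "F u = fund_form1 f u $ 1 $ 2" for u
  define W where "W u = E u * det (fund_form1 f u)" for u
  have pos: "E u > 0" "W u > 0" if "u \<in> V" for u
    using fund_form1_pos[OF smooth_on_differentiable[OF f that] inj[OF that]] by (simp_all add: E_def W_def)
  have smI: "sm (\<lambda>u. fund_form1 f u $ i $ j)" for i j by (simp add: fund_form1_def sm_simps sm_pd f)
  have sm: "sm E" "sm F" "sm W" unfolding E_def[abs_def] F_def[abs_def] W_def[abs_def] E_def det_2 by (simp_all add: sm_simps smI)
  have sq: "sqrt (E u) \<noteq> 0" "sqrt (W u) \<noteq> 0" if "u \<in> V" for u using pos[OF that] by simp_all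
  define e1 :: "real^2 \<Rightarrow> real^2" where "e1 u = (1 / sqrt (E u)) *\<^sub>R axis 1 1" for u
  define e2 :: "real^2 \<Rightarrow> real^2" where "e2 u = (E u / sqrt (W u)) *\<^sub>R axis 2 1 - (F u / sqrt (W u)) *\<^sub>R axis 1 1" for u
  have sme: "sm e1" "sm e2" unfolding e1_def[abs_def] e2_def[abs_def] using pos sq by (simp_all add: sm_simps sm)
  have comps: "e1 u $ 1 = 1 / sqrt (E u)" "e1 u $ 2 = 0" "e2 u $ 1 = - F u / sqrt (W u)" "e2 u $ 2 = E u / sqrt (W u)" for u
    by (simp_all add: e1_def e2_def axis_def)
  have "wedge e1 e2 u > 0" if "u \<in> V" for u
    using pos[OF that] by (simp add: comps)
  from plane_frameI[OF sme this] obtain p r where frame: "plane_frame V e1 e2 p r" by blast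
  have sym: "fund_form1 f u $ 2 $ 1 = F u" for u by (simp add: F_def fund_form1_def inner_commute)
  have W: "W u = E u * (E u * fund_form1 f u $ 2 $ 2 - F u * F u)" for u
    by (simp add: W_def det_2 sym E_def F_def)
  have "e1 u \<bullet> (fund_form1 f u *v e1 u) = 1" "e1 u \<bullet> (fund_form1 f u *v e2 u) = 0" "e2 u \<bullet> (fund_form1 f u *v e2 u) = 1" if u: "u \<in> V" for u
  proof -
    have s: "sqrt (E u) * sqrt (E u) = E u" "sqrt (W u) * sqrt (W u) = W u" using pos[OF u] by simp_all
    show "e1 u \<bullet> (fund_form1 f u *v e1 u) = 1" "e1 u \<bullet> (fund_form1 f u *v e2 u) = 0"
      using pos[OF u] s by (simp_all add: inner_real2 matrix_vector_mult_def sum_2 comps sym E_def[symmetric] F_def[symmetric])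
    define t where "t = 1 / sqrt (W u)"
    have t: "t * t * W u = 1" using s(2) sq(2)[OF u] by (simp add: t_def)
    have "e2 u $ 1 = - F u * t" "e2 u $ 2 = E u * t" by (simp_all add: comps t_def)
    then have "e2 u \<bullet> (fund_form1 f u *v e2 u) = t * t * W u"
      unfolding W by (simp add: inner_real2 matrix_vector_mult_def sum_2 sym E_def[symmetric] F_def[symmetric] algebra_simps)
    then show "e2 u \<bullet> (fund_form1 f u *v e2 u) = 1" unfolding t .
  qed
  then have "framed_surface V e1 e2 p r f"
    using frame f by (simp add: framed_surface_def framed_surface_axioms_def)
  then show ?thesis by blast
qed

lemma framed_surface_isometric:
  assumes "framed_surface V e1 e2 p r f" "smooth_on V g" "\<And>u. u \<in> V \<Longrightarrow> fund_form1 g u = fund_form1 f u"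
  shows "framed_surface V e1 e2 p r g"
  using assms by (simp add: framed_surface_def framed_surface_axioms_def)

lemma framed_surface_subset:
  assumes "framed_surface V e1 e2 p r f" "open S" "S \<subseteq> V"
  shows "framed_surface S e1 e2 p r f"
proof -
  interpret framed_surface V e1 e2 p r f by fact
  show ?thesis
    using assms(2,3) sm_frame sm_f oriented bracket orthonormal
    by unfold_locales (auto intro: smooth_on_subset)
qed

lemma framed_pair_subset:
  assumes "framed_pair V e1 e2 p r f g" "open S" "S \<subseteq> V"
  shows "framed_pair S e1 e2 p r f g"
proof -
  interpret framed_pair V e1 e2 p r f g by fact
  interpret A': framed_surface S e1 e2 p r f by (rule framed_surface_subset[OF A.framed_surface_axioms assms(2,3)])
  interpret B': framed_surface S e1 e2 p r g by (rule framed_surface_subset[OF B.framed_surface_axioms assms(2,3)])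
  show ?thesis using assms(3) same_H q_nonzero by unfold_locales auto
qed

text \<open>
  Under a change of parameters both fundamental forms are conjugated by the Jacobian matrix; the
  derivative of the Jacobian contributes tangential terms only, and the unit normal is preserved
  because the determinant is positive.
\<close>

lemma mean_curvature_reparametrize:
  fixes \<tau> :: "real^2 \<Rightarrow> real^2"
  assumes S: "open S" "u \<in> S" and W: "open W" "\<And>w. w \<in> S \<Longrightarrow> \<tau> w \<in> W"
    and \<tau>: "smooth_on S \<tau>" and g: "smooth_on W g" and f: "\<And>w. w \<in> S \<Longrightarrow> f w = g (\<tau> w)"
    and det_pos: "det (matrix (frechet_derivative \<tau> (at u))) > 0"
    and inj: "inj (frechet_derivative g (at (\<tau> u)))"
  shows "mean_curvature f u = mean_curvature g (\<tau> u)"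
proof -
  interpret S: plane_domain S by unfold_locales (rule S(1))
  interpret W: plane_domain W by unfold_locales (rule W(1))
  have chain: "pd i (\<lambda>w. h (\<tau> w)) w = (pd i \<tau> w $ 1) *\<^sub>R pd 1 h (\<tau> w) + (pd i \<tau> w $ 2) *\<^sub>R pd 2 h (\<tau> w)"
    if h: "W.sm h" and w: "w \<in> S" for h :: "real^2 \<Rightarrow> real^3" and i w
  proof -
    have "((\<lambda>w. h (\<tau> w)) has_derivative (\<lambda>v. frechet_derivative h (at (\<tau> w)) (frechet_derivative \<tau> (at w) v))) (at w)"
      by (rule has_derivative_compose[OF S.sm_differentiable[OF \<tau> w, unfolded frechet_derivative_works]
            W.sm_differentiable[OF h W(2)[OF w], unfolded frechet_derivative_works]])
    then have "pd i (\<lambda>w. h (\<tau> w)) w = dd (\<lambda>_. pd i \<tau> w) h (\<tau> w)"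
      unfolding pd_def dd_def by (simp add: frechet_derivative_at[symmetric])
    then show ?thesis by (simp add: W.dd_coords[OF W(2)[OF w] h])
  qed
  have dcomp: "(\<lambda>w. h (\<tau> w)) differentiable (at u)" if h: "W.sm h" for h :: "real^2 \<Rightarrow> real^3"
    using differentiable_chain_at[OF S.sm_differentiable[OF \<tau> S(2)] W.sm_differentiable[OF h W(2)[OF S(2)]]] by (simp add: o_def)
  define j where "j a i w = pd i \<tau> w $ a" for a i w
  have smj: "S.sm (j a i)" for a i unfolding j_def[abs_def] by (simp add: S.sm_simps S.sm_pd \<tau>)
  have f1: "pd i f w = j 1 i w *\<^sub>R pd 1 g (\<tau> w) + j 2 i w *\<^sub>R pd 2 g (\<tau> w)" if w: "w \<in> S" for i w
    using pd_cong[OF S(1) w, of f "\<lambda>w. g (\<tau> w)" i] f chain[OF g w] by (simp add: j_def)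
  define J where "J = matrix (frechet_derivative \<tau> (at u))"
  have J: "J $ a $ i = j a i u" for a i
    by (simp add: J_def matrix_def j_def pd_def)
  have cross: "cross3 (pd 1 f u) (pd 2 f u) = det J *\<^sub>R cross3 (pd 1 g (\<tau> u)) (pd 2 g (\<tau> u))"
    unfolding f1[OF S(2)] cross3_combination by (simp add: det_2 J algebra_simps)
  have normal: "unit_normal f u = unit_normal g (\<tau> u)"
    unfolding unit_normal_def cross using det_pos by (simp add: sgn_scaleR J_def)
  have tang: "pd i g (\<tau> u) \<bullet> unit_normal g (\<tau> u) = 0" for i
    using exhaust_2[of i] by (auto simp: unit_normal_def sgn_div_norm dot_cross_self)
  have f2: "pd i (pd k f) u \<bullet> unit_normal g (\<tau> u) =
     (\<Sum>a\<in>UNIV. \<Sum>b\<in>UNIV. J $ a $ i * (fund_form2 g (\<tau> u) $ a $ b * J $ b $ k))" for i k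
  proof -
    have summand: "pd i (\<lambda>w. j a k w *\<^sub>R pd a g (\<tau> w)) u = j a k u *\<^sub>R (j 1 i u *\<^sub>R pd 1 (pd a g) (\<tau> u) + j 2 i u *\<^sub>R pd 2 (pd a g) (\<tau> u))
      + pd i (j a k) u *\<^sub>R pd a g (\<tau> u)" for a
      unfolding pd_eq_dd[of i "\<lambda>w. j a k w *\<^sub>R pd a g (\<tau> w)"]
        dd_bounded_bilinear[OF bounded_bilinear_scaleR S.sm_differentiable[OF smj S(2)] dcomp[OF W.sm_pd[OF g]]]
      by (simp add: pd_eq_dd[symmetric] chain[OF W.sm_pd[OF g] S(2)] j_def)
    have diff: "(\<lambda>w. j a k w *\<^sub>R pd a g (\<tau> w)) differentiable (at u)" for a
      by (intro differentiable_scaleR S.sm_differentiable[OF smj S(2)] dcomp[OF W.sm_pd[OF g]])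
    have "pd i (pd k f) u = pd i (\<lambda>w. j 1 k w *\<^sub>R pd 1 g (\<tau> w) + j 2 k w *\<^sub>R pd 2 g (\<tau> w)) u"
      by (rule pd_cong[OF S f1])
    also have "\<dots> = pd i (\<lambda>w. j 1 k w *\<^sub>R pd 1 g (\<tau> w)) u + pd i (\<lambda>w. j 2 k w *\<^sub>R pd 2 g (\<tau> w)) u"
      unfolding pd_eq_dd[of i]
      by (rule trans[OF dd_eqI[OF has_derivative_add[OF diff[unfolded frechet_derivative_works] diff[unfolded frechet_derivative_works]]]])
        (simp add: dd_def)
    finally show ?thesis
      unfolding summand by (simp add: inner_add_left tang sum_2 J fund_form2_def normal algebra_simps)
  qed
  let ?I = "fund_form1 g (\<tau> u)" and ?II = "fund_form2 g (\<tau> u)"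
  have I: "fund_form1 f u = transpose J ** (?I ** J)"
    by (simp add: vec_eq_iff forall_2 fund_form1_def f1[OF S(2)] matrix_matrix_mult_def transpose_def sum_2 J inner_add_left inner_add_right algebra_simps)
  have II: "fund_form2 f u = transpose J ** (?II ** J)"
    by (simp add: vec_eq_iff fund_form2_def[of f] normal f2 matrix_matrix_mult_def transpose_def sum_2 algebra_simps)
  have "invertible J" using det_pos by (simp add: J_def invertible_det_nz)
  then obtain J' where J': "J ** J' = mat 1" "J' ** J = mat 1" unfolding invertible_def by blast
  have "det ?I \<noteq> 0" using fund_form1_pos(2)[OF W.sm_differentiable[OF g W(2)[OF S(2)]] inj] by auto
  then have "invertible ?I" by (simp add: invertible_det_nz)
  then obtain I' where I': "?I ** I' = mat 1" "I' ** ?I = mat 1" unfolding invertible_def by blast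
  have tJ: "transpose J ** transpose J' = mat 1" "transpose J' ** transpose J = mat 1"
    unfolding matrix_transpose_mul[symmetric] J' by (simp_all add: transpose_mat)
  have "fund_form1 f u ** (J' ** (I' ** transpose J')) = transpose J ** (?I ** ((J ** J') ** (I' ** transpose J')))"
    unfolding I by (simp only: matrix_mul_assoc)
  also have "\<dots> = transpose J ** ((?I ** I') ** transpose J')" unfolding J' by (simp add: matrix_mul_assoc)
  also have "\<dots> = mat 1" unfolding I' by (simp add: tJ)
  finally have invf: "matrix_inv (fund_form1 f u) = J' ** (I' ** transpose J')" by (rule matrix_inv_eqI)
  have "shape_operator f u = J' ** (I' ** ((transpose J' ** transpose J) ** (?II ** J)))"
    unfolding shape_operator_def invf II by (simp only: matrix_mul_assoc)
  also have "\<dots> = J' ** ((shape_operator g (\<tau> u)) ** J)"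
    unfolding tJ shape_operator_def matrix_inv_eqI[OF I'(1)] by (simp add: matrix_mul_assoc)
  finally have "trace (shape_operator f u) = trace ((shape_operator g (\<tau> u) ** J) ** J')"
    by (simp only: trace_mul_sym[of J'])
  then show ?thesis unfolding mean_curvature_def by (simp add: matrix_mul_assoc[symmetric] J')
qed

section \<open>Families of surfaces on a manifold\<close>

lemma locally_constant_imp_constant:
  assumes M: "connected_space M" and loc: "\<And>a. a \<in> topspace M \<Longrightarrow> \<exists>U. openin M U \<and> a \<in> U \<and> (\<forall>b\<in>U. h b = h a)"
    and ab: "a \<in> topspace M" "b \<in> topspace M"
  shows "h a = h b"
proof (rule ccontr)
  assume ne: "h a \<noteq> h b"
  have op: "openin M {b \<in> topspace M. Q (h b)}" for Q
  proof (subst openin_subopen, intro ballI)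
    fix d assume d: "d \<in> {b \<in> topspace M. Q (h b)}"
    then obtain U where U: "openin M U" "d \<in> U" "\<forall>b\<in>U. h b = h d" using loc by blast
    have "b \<in> {b \<in> topspace M. Q (h b)}" if "b \<in> U" for b
      using d openin_subset[OF U(1)] that bspec[OF U(3) that] by auto
    then show "\<exists>T. openin M T \<and> d \<in> T \<and> T \<subseteq> {b \<in> topspace M. Q (h b)}"
      using U(1,2) by blast
  qed
  have "{b \<in> topspace M. h b = h a} \<inter> {b \<in> topspace M. h b \<noteq> h a} = {}"
    "topspace M \<subseteq> {b \<in> topspace M. h b = h a} \<union> {b \<in> topspace M. h b \<noteq> h a}"
    "{b \<in> topspace M. h b = h a} \<noteq> {}" "{b \<in> topspace M. h b \<noteq> h a} \<noteq> {}"
    using ab ne by auto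
  with M op[of "\<lambda>c. c = h a"] op[of "\<lambda>c. c \<noteq> h a"] show False
    unfolding connected_space_def by blast
qed

lemma pd_slice:
  fixes h :: "real \<times> (real^2) \<Rightarrow> 'b::real_normed_vector"
  assumes "h differentiable (at (t, u))"
  shows "pd i (\<lambda>u. h (t, u)) u = frechet_derivative h (at (t, u)) (0, axis i 1)"
proof -
  have "((\<lambda>u. (t, u)) has_derivative (\<lambda>v. (0, v))) (at u)"
    by (auto intro!: derivative_eq_intros)
  from has_derivative_compose[OF this assms[unfolded frechet_derivative_works]]
  have "((\<lambda>u. h (t, u)) has_derivative (\<lambda>v. frechet_derivative h (at (t, u)) (0, v))) (at u)" .
  then show ?thesis unfolding pd_def by (simp add: frechet_derivative_at[symmetric])
qed

locale surface_family =
  fixes M :: "'a topology" and A :: "'a atlas" and F :: "'a \<Rightarrow> real^3" and J :: "real set" and G :: "real \<Rightarrow> 'a \<Rightarrow> real^3"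
  assumes surface: "oriented_surface M A" and connected: "connected_space M"
    and immersed: "immersion A F" and umbilic_free: "umbilic_free A F"
    and J: "open J" "is_interval J"
    and smooth_G: "\<And>V x. (V, x) \<in> A \<Longrightarrow> smooth_on (J \<times> V) (\<lambda>(t, u). G t (x u))"
    and G: "\<And>t. t \<in> J \<Longrightarrow> immersion A (G t)" "\<And>t. t \<in> J \<Longrightarrow> isometric A F (G t)"
      "\<And>t. t \<in> J \<Longrightarrow> same_mean_curvature A F (G t)"
begin

definition chart_frame :: "(real^2) set \<Rightarrow> (real^2 \<Rightarrow> 'a) \<Rightarrow> (real^2 \<Rightarrow> real^2) \<Rightarrow> (real^2 \<Rightarrow> real^2) \<Rightarrow> (real^2 \<Rightarrow> real) \<Rightarrow> (real^2 \<Rightarrow> real) \<Rightarrow> bool" where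
  "chart_frame V x e1 e2 p r \<longleftrightarrow> (V, x) \<in> A \<and> framed_surface V e1 e2 p r (F \<circ> x)"

lemma chart:
  assumes "(V, x) \<in> A"
  shows "open V" "openin M (x ` V)" "embedding_map (top_of_set V) M x" "u \<in> V \<Longrightarrow> x u \<in> topspace M"
    and "inj_on x V"
proof -
  have "\<forall>(V, x)\<in>A. open V \<and> openin M (x ` V) \<and> embedding_map (top_of_set V) M x"
    using surface unfolding oriented_surface_def by (elim conjE)
  from bspec[OF this assms] show 1: "open V" "openin M (x ` V)" "embedding_map (top_of_set V) M x"
    by simp_all
  show "u \<in> V \<Longrightarrow> x u \<in> topspace M" using openin_subset[OF 1(2)] by auto
  show "inj_on x V" using 1(3) homeomorphic_imp_injective_map by (fastforce simp: embedding_map_def)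
qed

lemma open_chart_image: assumes "(V, x) \<in> A" "open B" "B \<subseteq> V" shows "openin M (x ` B)"
proof -
  have "homeomorphic_map (top_of_set V) (subtopology M (x ` V)) x"
    using chart(3)[OF assms(1)] by (simp add: embedding_map_def)
  then have "open_map (top_of_set V) (subtopology M (x ` V)) x" by (rule homeomorphic_imp_open_map)
  moreover have "openin (top_of_set V) B" using assms(2,3) by (simp add: open_subset)
  ultimately have "openin (subtopology M (x ` V)) (x ` B)" unfolding open_map_def by blast
  then show ?thesis by (rule openin_trans_full[OF _ chart(2)[OF assms(1)]])
qed

lemma open_chart_preimage: assumes "(V, x) \<in> A" "openin M U" shows "open {u \<in> V. x u \<in> U}"
proof -
  have "homeomorphic_map (top_of_set V) (subtopology M (x ` V)) x"
    using chart(3)[OF assms(1)] by (simp add: embedding_map_def)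
  then have "continuous_map (top_of_set V) (subtopology M (x ` V)) x" by (rule homeomorphic_imp_continuous_map)
  then have "continuous_map (top_of_set V) M x" by (simp add: continuous_map_in_subtopology)
  from openin_continuous_map_preimage[OF this assms(2)] have "openin (top_of_set V) {u \<in> V. x u \<in> U}" by simp
  then show ?thesis by (rule openin_open_trans[OF _ chart(1)[OF assms(1)]])
qed

lemma charts_cover: assumes "a \<in> topspace M" obtains V x u where "(V, x) \<in> A" "u \<in> V" "x u = a"
proof -
  have "(\<Union>(V, x)\<in>A. x ` V) = topspace M" using surface unfolding oriented_surface_def by (elim conjE)
  then have "a \<in> (\<Union>(V, x)\<in>A. x ` V)" using assms by simp
  then show ?thesis using that by (auto split: prod.splits)
qed

lemma chart_frame_exists: assumes "(V, x) \<in> A" obtains e1 e2 p r where "chart_frame V x e1 e2 p r"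
proof -
  have "\<exists>e1 e2 p r. framed_surface V e1 e2 p r (F \<circ> x)"
    using immersed assms by (intro framed_surface_exists[OF chart(1)[OF assms]]) (auto simp: immersion_def)
  then show ?thesis using assms that unfolding chart_frame_def by blast
qed

context
  fixes V x e1 e2 p r assumes frame: "chart_frame V x e1 e2 p r"
begin

lemma in_atlas: "(V, x) \<in> A" using frame by (simp add: chart_frame_def)

lemma framed_F: "framed_surface V e1 e2 p r (F \<circ> x)" using frame by (simp add: chart_frame_def)

lemma fund_form1_G: "t \<in> J \<Longrightarrow> u \<in> V \<Longrightarrow> fund_form1 (G t \<circ> x) u = fund_form1 (F \<circ> x) u"
  using G(2)[of t] in_atlas by (auto simp: isometric_def)

lemma framed_G: assumes "t \<in> J" shows "framed_surface V e1 e2 p r (G t \<circ> x)"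
  using G(1)[OF assms] in_atlas
  by (intro framed_surface_isometric[OF framed_F] fund_form1_G[OF assms]) (auto simp: immersion_def)

lemma mean_curvature_G: "t \<in> J \<Longrightarrow> u \<in> V \<Longrightarrow> mean_curvature (G t \<circ> x) u = mean_curvature (F \<circ> x) u"
  using G(3)[of t] in_atlas by (auto simp: same_mean_curvature_def)

lemma gauss_curvature_G: assumes "t \<in> J" "u \<in> V" shows "gauss_curvature (G t \<circ> x) u = gauss_curvature (F \<circ> x) u"
proof -
  have "metric_curvature (fund_form1 (G t \<circ> x)) u = metric_curvature (fund_form1 (F \<circ> x)) u"
    by (rule metric_curvature_cong[OF chart(1)[OF in_atlas] assms(2) fund_form1_G[OF assms(1)]])
  then show ?thesis
    using framed_surface.theorema_egregium[OF framed_G[OF assms(1)] assms(2)] framed_surface.theorema_egregium[OF framed_F assms(2)] by simp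
qed

lemma moebius_curvature_G: assumes "t \<in> J" "u \<in> V" shows "moebius_curvature (G t \<circ> x) u = moebius_curvature (F \<circ> x) u"
  unfolding moebius_curvature_def
  by (rule metric_curvature_cong[OF chart(1)[OF in_atlas] assms(2)])
    (simp add: moebius_metric_def gauss_curvature_G mean_curvature_G fund_form1_G assms)

lemma not_umbilic: "u \<in> V \<Longrightarrow> (mean_curvature (F \<circ> x) u)\<^sup>2 \<noteq> gauss_curvature (F \<circ> x) u"
  using umbilic_free in_atlas by (auto simp: umbilic_free_def)

lemma q_G_nonzero:
  assumes "t \<in> J" "u \<in> V" shows "framed_surface.q e1 e2 (G t \<circ> x) u \<noteq> 0"
  using framed_surface.norm_q_curvatures[OF framed_G[OF assms(1)] assms(2)] not_umbilic[OF assms(2)]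
    mean_curvature_G[OF assms] gauss_curvature_G[OF assms] by auto

lemma framed_pair_G: assumes "s \<in> J" "t \<in> J" shows "framed_pair V e1 e2 p r (G s \<circ> x) (G t \<circ> x)"
proof -
  interpret s: framed_surface V e1 e2 p r "G s \<circ> x" by (rule framed_G[OF assms(1)])
  interpret t: framed_surface V e1 e2 p r "G t \<circ> x" by (rule framed_G[OF assms(2)])
  show ?thesis
  proof unfold_locales
    fix u assume u: "u \<in> V"
    show "s.H u = t.H u"
      using s.curvatures_in_frame(2)[OF u] t.curvatures_in_frame(2)[OF u] mean_curvature_G[OF _ u] assms by simp
    show "s.q u \<noteq> 0" by (rule q_G_nonzero[OF assms(1) u])
  qed
qed

end

text \<open>
  Equality of the second fundamental forms of two members at a point is equivalent to this condition
  (\<open>agree_iff\<close>).  It does not mention charts, so the connectedness of \<open>M\<close> applies to it directly.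
\<close>

definition agree :: "real \<Rightarrow> real \<Rightarrow> (real^3 \<Rightarrow> real^3) \<Rightarrow> 'a \<Rightarrow> bool" where
  "agree s t \<Phi> a \<longleftrightarrow> proper_motion \<Phi> \<and> (\<exists>U. openin M U \<and> a \<in> U \<and> (\<forall>b\<in>U. G t b = \<Phi> (G s b)))"

lemma agree_nearby: assumes "agree s t \<Phi> a" shows "\<exists>U. openin M U \<and> a \<in> U \<and> (\<forall>b\<in>U. agree s t \<Phi> b)"
  using assms unfolding agree_def by blast

text \<open>
  From left to right, proper motions preserve the second fundamental form.  From right to left, equality
  at a point propagates to a ball by \<open>q_equal_near\<close>, and there the surfaces are congruent.
\<close>

lemma agree_iff:
  assumes frame: "chart_frame V x e1 e2 p r" and st: "s \<in> J" "t \<in> J" and u: "u \<in> V"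
  shows "(\<exists>\<Phi>. agree s t \<Phi> (x u)) \<longleftrightarrow> framed_surface.q e1 e2 (G s \<circ> x) u = framed_surface.q e1 e2 (G t \<circ> x) u"
proof
  note pair = framed_pair_G[OF frame st]
  have xV: "(V, x) \<in> A" by (rule in_atlas[OF frame])
  show "framed_surface.q e1 e2 (G s \<circ> x) u = framed_surface.q e1 e2 (G t \<circ> x) u" if "\<exists>\<Phi>. agree s t \<Phi> (x u)"
  proof -
    obtain \<Phi> U where U: "proper_motion \<Phi>" "openin M U" "x u \<in> U" "\<forall>b\<in>U. G t b = \<Phi> (G s b)"
      using \<open>\<exists>\<Phi>. agree s t \<Phi> (x u)\<close> unfolding agree_def by blast
    have "framed_pair {u \<in> V. x u \<in> U} e1 e2 p r (G s \<circ> x) (G t \<circ> x)"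
      by (rule framed_pair_subset[OF pair open_chart_preimage[OF xV U(2)]]) blast
    from framed_pair.q_equal_if_congruent[OF this U(1), of u] show ?thesis using U u by simp
  qed
  show "\<exists>\<Phi>. agree s t \<Phi> (x u)" if "framed_surface.q e1 e2 (G s \<circ> x) u = framed_surface.q e1 e2 (G t \<circ> x) u"
  proof -
    from framed_pair.q_equal_near[OF pair u that] obtain \<rho> where \<rho>: "\<rho> > 0" "ball u \<rho> \<subseteq> V"
      "\<And>w. w \<in> ball u \<rho> \<Longrightarrow> framed_surface.q e1 e2 (G s \<circ> x) w = framed_surface.q e1 e2 (G t \<circ> x) w" by blast
    have "framed_pair (ball u \<rho>) e1 e2 p r (G s \<circ> x) (G t \<circ> x)"
      by (rule framed_pair_subset[OF pair open_ball \<rho>(2)])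
    from framed_pair.congruent_if_q_equal[OF this connected_ball, of u] \<rho>
    obtain \<Phi> where "proper_motion \<Phi>" "\<forall>w\<in>ball u \<rho>. (G t \<circ> x) w = \<Phi> ((G s \<circ> x) w)" by auto
    then have "agree s t \<Phi> (x u)" unfolding agree_def
      using \<rho>(1) by (intro conjI exI[of _ "x ` ball u \<rho>"] open_chart_image[OF xV open_ball \<rho>(2)]) auto
    then show ?thesis by blast
  qed
qed

lemma agree_unique:
  assumes s: "s \<in> J" and a: "a \<in> topspace M" and ag: "agree s t \<Phi> a" "agree s t \<Psi> a"
  shows "\<Phi> = \<Psi>"
proof -
  obtain V x u where xV: "(V, x) \<in> A" and u: "u \<in> V" "x u = a" using charts_cover[OF a] .
  obtain e1 e2 p r where frame: "chart_frame V x e1 e2 p r" using chart_frame_exists[OF xV] .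
  obtain U U' where U: "openin M U" "a \<in> U" "\<forall>b\<in>U. G t b = \<Phi> (G s b)" "openin M U'" "a \<in> U'" "\<forall>b\<in>U'. G t b = \<Psi> (G s b)"
    and pm: "proper_motion \<Phi>" "proper_motion \<Psi>"
    using ag unfolding agree_def by blast
  have "framed_surface {u \<in> V. x u \<in> U \<inter> U'} e1 e2 p r (G s \<circ> x)"
    by (rule framed_surface_subset[OF framed_G[OF frame s] open_chart_preimage[OF xV openin_Int[OF U(1,4)]]]) blast
  from framed_surface.proper_motion_unique[OF this pm, of u] show ?thesis using U u by force
qed

lemma agree_everywhere_or_nowhere:
  assumes st: "s \<in> J" "t \<in> J" and ab: "a \<in> topspace M" "b \<in> topspace M"
  shows "(\<exists>\<Phi>. agree s t \<Phi> a) = (\<exists>\<Phi>. agree s t \<Phi> b)"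
proof (rule locally_constant_imp_constant[OF connected _ ab, of "\<lambda>a. \<exists>\<Phi>. agree s t \<Phi> a"])
  fix a assume a: "a \<in> topspace M"
  show "\<exists>U. openin M U \<and> a \<in> U \<and> (\<forall>b\<in>U. (\<exists>\<Phi>. agree s t \<Phi> b) = (\<exists>\<Phi>. agree s t \<Phi> a))"
  proof (cases "\<exists>\<Phi>. agree s t \<Phi> a")
    case True
    then show ?thesis using agree_nearby by meson
  next
    case False
    obtain V x u where xV: "(V, x) \<in> A" and u: "u \<in> V" "x u = a" using charts_cover[OF a] .
    obtain e1 e2 p r where frame: "chart_frame V x e1 e2 p r" using chart_frame_exists[OF xV] .
    let ?q = "\<lambda>t. framed_surface.q e1 e2 (G t \<circ> x)"
    have cont: "continuous_on V (?q t)" if "t \<in> J" for t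
      using framed_surface.sm_q[OF framed_G[OF frame that]] by (rule smooth_on_continuous)
    define B where "B = {w \<in> V. ?q s w \<noteq> ?q t w}"
    have "open (V \<inter> (\<lambda>w. ?q s w - ?q t w) -` (- {0}))"
      by (rule continuous_open_preimage[OF continuous_on_diff[OF cont[OF st(1)] cont[OF st(2)]] chart(1)[OF xV]]) auto
    also have "V \<inter> (\<lambda>w. ?q s w - ?q t w) -` (- {0}) = B" by (auto simp: B_def)
    finally have "open B" .
    then have "openin M (x ` B)" by (rule open_chart_image[OF xV]) (auto simp: B_def)
    moreover have "a \<in> x ` B" using False agree_iff[OF frame st u(1)] u by (auto simp: B_def)
    moreover have "\<not> (\<exists>\<Phi>. agree s t \<Phi> b)" if "b \<in> x ` B" for b
      using that agree_iff[OF frame st] by (auto simp: B_def)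
    ultimately show ?thesis using False by (intro exI[of _ "x ` B"]) blast
  qed
qed

text \<open>
  The local motions are unique, since the adapted frame and the position at one point determine them;
  hence they depend on the point in a locally constant way.
\<close>

lemma congruent_if_agree:
  assumes st: "s \<in> J" "t \<in> J" and ag: "\<And>a. a \<in> topspace M \<Longrightarrow> \<exists>\<Phi>. agree s t \<Phi> a"
  shows "congruent_on (topspace M) (G s) (G t)"
proof (cases "topspace M = {}")
  case True
  then show ?thesis unfolding congruent_on_def by (intro exI[of _ "\<lambda>x. x"]) simp
next
  case False
  then obtain a where a: "a \<in> topspace M" by blast
  define \<Phi> where "\<Phi> a = (SOME \<Phi>. agree s t \<Phi> a)" for a
  have \<Phi>: "agree s t (\<Phi> a) a" if "a \<in> topspace M" for a
    unfolding \<Phi>_def using ag[OF that] by (rule someI_ex)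
  have "\<Phi> b = \<Phi> a" if b: "b \<in> topspace M" for b
  proof (rule locally_constant_imp_constant[OF connected _ b a, of \<Phi>])
    fix d assume d: "d \<in> topspace M"
    obtain U where U: "openin M U" "d \<in> U" "\<forall>b\<in>U. agree s t (\<Phi> d) b" using agree_nearby[OF \<Phi>[OF d]] by blast
    then have "\<Phi> b = \<Phi> d" if "b \<in> U" for b
      using agree_unique[OF st(1) _ \<Phi>, of b] openin_subset[OF U(1)] that by blast
    then show "\<exists>U. openin M U \<and> d \<in> U \<and> (\<forall>b\<in>U. \<Phi> b = \<Phi> d)" using U by blast
  qed
  then have "G t b = \<Phi> a (G s b)" if "b \<in> topspace M" for b
    using \<Phi>[OF that] that unfolding agree_def by auto
  moreover have "dist (\<Phi> a y) (\<Phi> a z) = dist y z" for y z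
  proof -
    obtain L w where L: "orthogonal_transformation L" "\<Phi> a = (\<lambda>x. L x + w)"
      using \<Phi>[OF a] unfolding agree_def proper_motion_def by blast
    show ?thesis unfolding L(2) using orthogonal_transformation_isometry L(1) by (simp add: dist_norm orthogonal_transformation_norm flip: linear_diff[OF orthogonal_transformation_linear[OF L(1)]])
  qed
  ultimately show ?thesis unfolding congruent_on_def by blast
qed

lemma continuous_in_parameter:
  assumes frame: "chart_frame V x e1 e2 p r" and u: "u \<in> V"
  shows "continuous_on J (\<lambda>t. framed_surface.q e1 e2 (G t \<circ> x) u)"
proof -
  have xV: "(V, x) \<in> A" by (rule in_atlas[OF frame])
  let ?G = "\<lambda>(t, u). G t (x u)"
  let ?Gi = "\<lambda>i z. frechet_derivative ?G (at z) (0, axis i 1)"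
  have op: "open (J \<times> V)" by (rule open_Times[OF J(1) chart(1)[OF xV]])
  have smi: "smooth_on (J \<times> V) (?Gi i)" for i using smooth_G[OF xV] smooth_on_iff_derivative by blast
  have slice: "continuous_on J (\<lambda>t. k (t, u))" if "smooth_on (J \<times> V) k" for k :: "_ \<Rightarrow> real^3"
  proof (rule continuous_on_compose2[OF smooth_on_continuous[OF that]])
    show "continuous_on J (\<lambda>t. (t, u))" by (intro continuous_on_Pair continuous_on_const continuous_on_id)
  qed (use u in auto)
  have 1: "pd i (G t \<circ> x) w = ?Gi i (t, w)" if "t \<in> J" "w \<in> V" for i t w
    using pd_slice[OF smooth_on_differentiable[OF smooth_G[OF xV]], of t w i] that by (simp add: o_def)
  have c1: "continuous_on J (\<lambda>t. pd i (G t \<circ> x) u)" for i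
    using slice[OF smi[of i]] by (rule continuous_on_eq) (simp add: 1 u)
  have c2: "continuous_on J (\<lambda>t. pd j (pd i (G t \<circ> x)) u)" for i j
  proof -
    have "smooth_on (J \<times> V) (\<lambda>z. frechet_derivative (?Gi i) (at z) (0, axis j 1))"
      using smi[of i] smooth_on_iff_derivative by blast
    from slice[OF this] show ?thesis
    proof (rule continuous_on_eq)
      fix t assume t: "t \<in> J"
      have "pd j (pd i (G t \<circ> x)) u = pd j (\<lambda>w. ?Gi i (t, w)) u"
        by (rule pd_cong[OF chart(1)[OF xV] u]) (simp add: 1 t)
      then show "frechet_derivative (?Gi i) (at (t, u)) (0, axis j 1) = pd j (pd i (G t \<circ> x)) u"
        using pd_slice[OF smooth_on_differentiable[OF smi[of i]], of t u j] t u by simp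
    qed
  qed
  interpret framed_surface V e1 e2 p r "F \<circ> x" by (rule framed_F[OF frame])
  have smt: "sm (G t \<circ> x)" if "t \<in> J" for t using framed_surface.sm_f[OF framed_G[OF frame that]] .
  have e: "continuous_on J (\<lambda>t. dd v (G t \<circ> x) u)" for v
  proof (rule continuous_on_eq)
    show "continuous_on J (\<lambda>t. v u $ 1 *\<^sub>R pd 1 (G t \<circ> x) u + v u $ 2 *\<^sub>R pd 2 (G t \<circ> x) u)"
      by (intro continuous_intros c1)
  qed (simp add: dd_coords[OF u smt])
  have ee: "continuous_on J (\<lambda>t. dd v (dd w (G t \<circ> x)) u)" if w: "sm w" for v w
  proof (rule continuous_on_eq)
    show "continuous_on J (\<lambda>t. w u $ 1 *\<^sub>R (v u $ 1 *\<^sub>R pd 1 (pd 1 (G t \<circ> x)) u + v u $ 2 *\<^sub>R pd 2 (pd 1 (G t \<circ> x)) u) + dd v w u $ 1 *\<^sub>R pd 1 (G t \<circ> x) u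
     + (w u $ 2 *\<^sub>R (v u $ 1 *\<^sub>R pd 1 (pd 2 (G t \<circ> x)) u + v u $ 2 *\<^sub>R pd 2 (pd 2 (G t \<circ> x)) u) + dd v w u $ 2 *\<^sub>R pd 2 (G t \<circ> x) u))"
      by (intro continuous_intros c1 c2)
  qed (simp add: dd_dd_coords[OF u w smt] dd_coords[OF u sm_pd[OF smt]])
  have *: "framed_surface.q e1 e2 f u =
     complex_of_real ((dd e1 (dd e1 f) u \<bullet> cross3 (dd e1 f u) (dd e2 f u) - dd e2 (dd e2 f) u \<bullet> cross3 (dd e1 f u) (dd e2 f u)) / 2)
     - \<i> * complex_of_real (dd e1 (dd e2 f) u \<bullet> cross3 (dd e1 f u) (dd e2 f u))" if "framed_surface V e1 e2 p r f" for f
  proof -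
    interpret f: framed_surface V e1 e2 p r f by fact
    show ?thesis by (simp add: f.q_def f.h11_def f.h12_def f.h22_def f.N_def f.E1_def f.E2_def)
  qed
  show ?thesis
  proof (rule continuous_on_eq[OF _ *[OF framed_G[OF frame], symmetric]])
    show "continuous_on J (\<lambda>t. complex_of_real ((dd e1 (dd e1 (G t \<circ> x)) u \<bullet> cross3 (dd e1 (G t \<circ> x) u) (dd e2 (G t \<circ> x) u) - dd e2 (dd e2 (G t \<circ> x)) u \<bullet> cross3 (dd e1 (G t \<circ> x) u) (dd e2 (G t \<circ> x) u)) / 2)
     - \<i> * complex_of_real (dd e1 (dd e2 (G t \<circ> x)) u \<bullet> cross3 (dd e1 (G t \<circ> x) u) (dd e2 (G t \<circ> x) u)))"
      by (intro continuous_intros continuous_on_cross e ee sm_frame) auto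
  qed
qed

text \<open>
  The Hopf coefficients of the members at a point form a connected set.  It has two elements and
  therefore a third one, and members that differ at one point differ everywhere.
\<close>

lemma three_members:
  assumes st: "s \<in> J" "t \<in> J" and nc: "\<not> congruent_on (topspace M) (G s) (G t)"
  obtains t' where "t' \<in> J" and "\<And>a \<Phi>. a \<in> topspace M \<Longrightarrow> \<not> agree s t \<Phi> a"
    "\<And>a \<Phi>. a \<in> topspace M \<Longrightarrow> \<not> agree s t' \<Phi> a" "\<And>a \<Phi>. a \<in> topspace M \<Longrightarrow> \<not> agree t t' \<Phi> a"
proof -
  obtain a where a: "a \<in> topspace M" "\<not> (\<exists>\<Phi>. agree s t \<Phi> a)" using congruent_if_agree[OF st] nc by blast
  obtain V x u where xV: "(V, x) \<in> A" and u: "u \<in> V" "x u = a" using charts_cover[OF a(1)] .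
  obtain e1 e2 p r where frame: "chart_frame V x e1 e2 p r" using chart_frame_exists[OF xV] .
  let ?q = "\<lambda>t. framed_surface.q e1 e2 (G t \<circ> x) u"
  have ne: "?q s \<noteq> ?q t" using a(2) agree_iff[OF frame st u(1)] u by simp
  have conn: "connected (?q ` J)"
    by (rule connected_continuous_image[OF continuous_in_parameter[OF frame u(1)] is_interval_connected[OF J(2)]])
  have "\<not> ?q ` J \<subseteq> {?q s, ?q t}"
  proof
    assume "?q ` J \<subseteq> {?q s, ?q t}"
    then have "finite (?q ` J)" by (rule finite_subset) simp
    then obtain z where "?q ` J = {z}" using conn connected_finite_iff_sing st by blast
    then have "?q s = z" "?q t = z" using st by (metis imageI singletonD)+
    then show False using ne by simp
  qed
  then obtain t' where t': "t' \<in> J" "?q t' \<noteq> ?q s" "?q t' \<noteq> ?q t" by blast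
  have "\<not> (\<exists>\<Phi>. agree s t' \<Phi> a)" "\<not> (\<exists>\<Phi>. agree t t' \<Phi> a)"
    using agree_iff[OF frame st(1) t'(1) u(1)] agree_iff[OF frame st(2) t'(1) u(1)] t' u by auto
  then show ?thesis
    using that[OF t'(1)] a agree_everywhere_or_nowhere[OF st _ a(1)] agree_everywhere_or_nowhere[OF st(1) t'(1) _ a(1)]
      agree_everywhere_or_nowhere[OF st(2) t'(1) _ a(1)] by metis
qed

end

section \<open>Critical points of the mean curvature\<close>

context surface_family
begin

text \<open>Both charts at a point carry the same orientation, so the mean curvature is a function on \<open>M\<close>.\<close>

lemma mean_curvature_charts:
  assumes xV: "(V, x) \<in> A" and yW: "(W, y) \<in> A"
  defines "S \<equiv> {u \<in> V. x u \<in> y ` W}" and "\<tau> \<equiv> inv_into W y \<circ> x"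
  shows "open S" "smooth_on S \<tau>"
    and "u \<in> S \<Longrightarrow> mean_curvature (F \<circ> x) u = mean_curvature (F \<circ> y) (\<tau> u)"
    and "u \<in> V \<Longrightarrow> w \<in> W \<Longrightarrow> x u = y w \<Longrightarrow> u \<in> S \<and> \<tau> u = w"
proof -
  show S: "open S" unfolding S_def by (rule open_chart_preimage[OF xV chart(2)[OF yW]])
  have "\<forall>(V, x)\<in>A. \<forall>(W, y)\<in>A.
        smooth_on {u\<in>V. x u \<in> y ` W} (inv_into W y \<circ> x) \<and>
        (\<forall>u\<in>V. x u \<in> y ` W \<longrightarrow> det (matrix (frechet_derivative (inv_into W y \<circ> x) (at u))) > 0)"
    using surface unfolding oriented_surface_def by (elim conjE)
  from bspec[OF bspec[OF this xV, simplified] yW]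
  have 1: "smooth_on S \<tau>" and det: "\<And>u. u \<in> S \<Longrightarrow> det (matrix (frechet_derivative \<tau> (at u))) > 0"
    by (auto simp: S_def \<tau>_def)
  show "smooth_on S \<tau>" by (rule 1)
  have \<tau>: "\<tau> w \<in> W" "y (\<tau> w) = x w" if "w \<in> S" for w
    using that by (auto simp: S_def \<tau>_def inv_into_into f_inv_into_f)
  show "u \<in> S \<Longrightarrow> mean_curvature (F \<circ> x) u = mean_curvature (F \<circ> y) (\<tau> u)"
    by (rule mean_curvature_reparametrize[OF S _ chart(1)[OF yW] \<tau>(1) 1 _ _ det])
      (use immersed yW \<tau> in \<open>auto simp: immersion_def\<close>)
  show "u \<in> V \<Longrightarrow> w \<in> W \<Longrightarrow> x u = y w \<Longrightarrow> u \<in> S \<and> \<tau> u = w"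
    using chart(5)[OF yW] by (auto simp: S_def \<tau>_def)
qed

definition critical :: "(real^2 \<Rightarrow> 'a) \<Rightarrow> real^2 \<Rightarrow> bool" where
  "critical x u \<longleftrightarrow> frechet_derivative (mean_curvature (F \<circ> x)) (at u) = (\<lambda>h. 0)"

lemma smooth_mean_curvature: assumes "(V, x) \<in> A" shows "smooth_on V (mean_curvature (F \<circ> x))"
proof -
  obtain e1 e2 p r where frame: "chart_frame V x e1 e2 p r" using chart_frame_exists[OF assms] .
  interpret framed_surface V e1 e2 p r "F \<circ> x" by (rule framed_F[OF frame])
  show ?thesis by (rule smooth_on_cong[OF open_V _ sm_H]) (simp add: curvatures_in_frame(2))
qed

lemma critical_charts:
  assumes xV: "(V, x) \<in> A" and yW: "(W, y) \<in> A" and uw: "u \<in> V" "w \<in> W" "x u = y w" and crit: "critical y w"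
  shows "critical x u"
proof -
  let ?\<tau> = "inv_into W y \<circ> x"
  let ?S = "{u \<in> V. x u \<in> y ` W}"
  note ch = mean_curvature_charts[OF xV yW]
  have u: "u \<in> ?S" "?\<tau> u = w" using ch(4)[OF uw] by auto
  have "(mean_curvature (F \<circ> y) has_derivative (\<lambda>h. 0)) (at w)"
    using smooth_on_differentiable[OF smooth_mean_curvature[OF yW] uw(2)] crit
    unfolding critical_def frechet_derivative_works by simp
  then have "(mean_curvature (F \<circ> y) has_derivative (\<lambda>h. 0)) (at (?\<tau> u))" using u(2) by simp
  from has_derivative_compose[OF smooth_on_differentiable[OF ch(2) u(1), unfolded frechet_derivative_works] this]
  have "frechet_derivative (\<lambda>v. mean_curvature (F \<circ> y) (?\<tau> v)) (at u) = (\<lambda>h. 0)"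
    by (simp add: frechet_derivative_at[symmetric])
  moreover have "frechet_derivative (mean_curvature (F \<circ> x)) (at u) = frechet_derivative (\<lambda>v. mean_curvature (F \<circ> y) (?\<tau> v)) (at u)"
    by (rule frechet_derivative_cong_open[OF ch(1) u(1) ch(3)])
  ultimately show ?thesis unfolding critical_def by simp
qed

lemma constant_if_all_critical:
  assumes crit: "\<And>V x u. (V, x) \<in> A \<Longrightarrow> u \<in> V \<Longrightarrow> critical x u"
  shows "constant_mean_curvature A F"
proof (cases "topspace M = {}")
  case True
  then have "V = {}" if "(V, x) \<in> A" for V x using chart(4)[OF that] by blast
  then show ?thesis unfolding constant_mean_curvature_def by blast
next
  case False
  then obtain a where a: "a \<in> topspace M" by blast
  define h where "h a = (SOME c. \<exists>V x u. (V, x) \<in> A \<and> u \<in> V \<and> x u = a \<and> c = mean_curvature (F \<circ> x) u)" for a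
  have h: "h (x u) = mean_curvature (F \<circ> x) u" if xV: "(V, x) \<in> A" and u: "u \<in> V" for V x u
  proof -
    have "\<exists>c. \<exists>W y w. (W, y) \<in> A \<and> w \<in> W \<and> y w = x u \<and> c = mean_curvature (F \<circ> y) w" using that by blast
    from someI_ex[OF this] obtain W y w where w: "(W, y) \<in> A" "w \<in> W" "y w = x u" "h (x u) = mean_curvature (F \<circ> y) w"
      unfolding h_def by blast
    then show ?thesis
      using mean_curvature_charts(3)[OF xV w(1), of u] mean_curvature_charts(4)[OF xV w(1) u w(2)] by simp
  qed
  have loc: "\<exists>U. openin M U \<and> b \<in> U \<and> (\<forall>d\<in>U. h d = h b)" if b: "b \<in> topspace M" for b
  proof -
    obtain V x u where xV: "(V, x) \<in> A" and u: "u \<in> V" "x u = b" using charts_cover[OF b] .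
    obtain \<rho> where \<rho>: "\<rho> > 0" "ball u \<rho> \<subseteq> V" using chart(1)[OF xV] u(1) open_contains_ball by blast
    have "mean_curvature (F \<circ> x) w = mean_curvature (F \<circ> x) u" if w: "w \<in> ball u \<rho>" for w
    proof (rule has_derivative_zero_unique_connected[OF open_ball connected_ball _ w])
      show "u \<in> ball u \<rho>" using \<rho>(1) by simp
      fix v assume "v \<in> ball u \<rho>"
      then have v: "v \<in> V" using \<rho>(2) by blast
      show "(mean_curvature (F \<circ> x) has_derivative (\<lambda>h. 0)) (at v)"
        using smooth_on_differentiable[OF smooth_mean_curvature[OF xV] v] crit[OF xV v]
        unfolding critical_def frechet_derivative_works by simp
    qed
    then have "\<forall>d\<in>x ` ball u \<rho>. h d = h b" using h[OF xV] \<rho>(2) u by auto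
    moreover have "openin M (x ` ball u \<rho>)" by (rule open_chart_image[OF xV open_ball \<rho>(2)])
    moreover have "b \<in> x ` ball u \<rho>" using \<rho>(1) u(2) by auto
    ultimately show ?thesis by blast
  qed
  have "mean_curvature (F \<circ> x) u = h a" if xV: "(V, x) \<in> A" and u: "u \<in> V" for V x u
    using locally_constant_imp_constant[OF connected loc chart(4)[OF xV u] a] h[OF xV u] by simp
  then show ?thesis unfolding constant_mean_curvature_def by (intro exI[of _ "h a"]) auto
qed

lemma critical_iff:
  assumes frame: "chart_frame V x e1 e2 p r" and s: "s \<in> J" and u: "u \<in> V"
  shows "critical x u \<longleftrightarrow> plane_frame.D e1 e2 (\<lambda>w. complex_of_real (framed_surface.H e1 e2 (G s \<circ> x) w)) u = 0"
proof -
  interpret framed_surface V e1 e2 p r "G s \<circ> x" by (rule framed_G[OF frame s])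
  have H: "mean_curvature (F \<circ> x) w = H w" if "w \<in> V" for w
    using curvatures_in_frame(2)[OF that] mean_curvature_G[OF frame s that] by simp
  have "frechet_derivative (mean_curvature (F \<circ> x)) (at u) = frechet_derivative H (at u)"
    by (rule frechet_derivative_cong_open[OF open_V u H])
  moreover have "frechet_derivative H (at u) = (\<lambda>h. 0) \<longleftrightarrow> dd e1 H u = 0 \<and> dd e2 H u = 0"
  proof
    show "dd e1 H u = 0 \<and> dd e2 H u = 0" if "frechet_derivative H (at u) = (\<lambda>h. 0)"
      unfolding dd_def that by simp
    show "frechet_derivative H (at u) = (\<lambda>h. 0)" if "dd e1 H u = 0 \<and> dd e2 H u = 0"
      by (rule ext, subst derivative_in_frame[OF u sm_H]) (simp add: that)
  qed
  ultimately have "critical x u \<longleftrightarrow> dd e1 H u = 0 \<and> dd e2 H u = 0" unfolding critical_def by simp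
  then show ?thesis unfolding Db_of_real(1)[OF u sm_H] by (auto simp: complex_eq_iff)
qed

end

section \<open>Bonnet surfaces\<close>

locale bonnet_family = surface_family +
  fixes s assumes s: "s \<in> J"
    and structure_eq: "\<And>V x e1 e2 p r u. chart_frame V x e1 e2 p r \<Longrightarrow> u \<in> V \<Longrightarrow>
      plane_frame.D e1 e2 (framed_surface.\<beta> e1 e2 (G s \<circ> x)) u =
     plane_frame.c p r u * framed_surface.\<beta> e1 e2 (G s \<circ> x) u + framed_surface.\<beta> e1 e2 (G s \<circ> x) u * cnj (framed_surface.\<beta> e1 e2 (G s \<circ> x) u)"
begin

lemma open_noncritical:
  assumes xV: "(V, x) \<in> A" shows "open {u \<in> V. \<not> critical x u}"
proof -
  obtain e1 e2 p r where frame: "chart_frame V x e1 e2 p r" using chart_frame_exists[OF xV] .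
  interpret framed_surface V e1 e2 p r "G s \<circ> x" by (rule framed_G[OF frame s])
  have "sm (D (\<lambda>w. complex_of_real (H w)))" by (simp add: sm_D sm_simps sm_H)
  then have "open (V \<inter> D (\<lambda>w. complex_of_real (H w)) -` (- {0}))"
    by (intro continuous_open_preimage smooth_on_continuous open_V) auto
  also have "V \<inter> D (\<lambda>w. complex_of_real (H w)) -` (- {0}) = {u \<in> V. \<not> critical x u}"
    using critical_iff[OF frame s] by auto
  finally show ?thesis .
qed

lemma bonnet_frame_noncritical:
  assumes frame: "chart_frame V x e1 e2 p r"
  shows "bonnet_frame {u \<in> V. \<not> critical x u} e1 e2 p r (G s \<circ> x)"
proof -
  interpret framed_surface "{u \<in> V. \<not> critical x u}" e1 e2 p r "G s \<circ> x"
    by (rule framed_surface_subset[OF framed_G[OF frame s] open_noncritical[OF in_atlas[OF frame]]]) blast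
  show ?thesis
    using q_G_nonzero[OF frame s] structure_eq[OF frame] critical_iff[OF frame s] by unfold_locales auto
qed

lemma ratio_zero:
  assumes ratio: "\<And>V x u. (V, x) \<in> A \<Longrightarrow> u \<in> V \<Longrightarrow> gauss_curvature (F \<circ> x) u = \<rho> * (mean_curvature (F \<circ> x) u)\<^sup>2"
    and xV: "(V, x) \<in> A" and u: "u \<in> V" "\<not> critical x u"
  shows "\<rho> = 0"
proof -
  obtain e1 e2 p r where frame: "chart_frame V x e1 e2 p r" using chart_frame_exists[OF xV] .
  show ?thesis
    by (rule bonnet_frame.curvature_ratio_zero[OF bonnet_frame_noncritical[OF frame], of _ u])
      (use u ratio[OF xV] in \<open>auto simp: gauss_curvature_G[OF frame s] mean_curvature_G[OF frame s]\<close>)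
qed

context
  fixes k assumes moebius_k: "\<And>V x u. (V, x) \<in> A \<Longrightarrow> u \<in> V \<Longrightarrow> moebius_curvature (F \<circ> x) u = k"
begin

text \<open>
  The last claim is the identity \<open>P = - k H\<^sup>2\<close> multiplied by \<open>m = H\<^sup>2\<close>; in this form it has a limit at
  critical points.
\<close>

lemma flat_at_noncritical:
  assumes frame: "chart_frame V x e1 e2 p r" and u: "u \<in> V" "\<not> critical x u"
  shows "gauss_curvature (F \<circ> x) u = 0" and "k \<noteq> 0"
    and "(cmod (plane_frame.D e1 e2 (\<lambda>w. complex_of_real (framed_surface.H e1 e2 (G s \<circ> x) w)) u))\<^sup>2 = - k * (mean_curvature (F \<circ> x) u)^4"
proof -
  interpret bonnet_frame "{u \<in> V. \<not> critical x u}" e1 e2 p r "G s \<circ> x" by (rule bonnet_frame_noncritical[OF frame])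
  have u': "u \<in> {u \<in> V. \<not> critical x u}" using u by simp
  have mk: "moebius_curvature (G s \<circ> x) w = k" if "w \<in> {u \<in> V. \<not> critical x u}" for w
    using moebius_k[OF in_atlas[OF frame]] moebius_curvature_G[OF frame s] that by simp
  have K0: "gauss_curvature (G s \<circ> x) u = 0" by (rule constant_moebius_curvature_imp_flat(1)[OF mk u'])
  have Pk: "P u = - k * (H u)\<^sup>2" by (rule constant_moebius_curvature_imp_flat(2)[OF mk u'])
  have H: "H u = mean_curvature (F \<circ> x) u" using curvatures_in_frame(2)[OF u'] mean_curvature_G[OF frame s u(1)] by simp
  show "gauss_curvature (F \<circ> x) u = 0" using K0 gauss_curvature_G[OF frame s u(1)] by simp
  show "k \<noteq> 0" using Pk m_P_nonzero(2)[OF u'] by auto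
  have m: "m u = (H u)\<^sup>2" using m_curvatures[OF u'] K0 curvatures_in_frame(2)[OF u'] by simp
  have "(cmod (D (\<lambda>w. complex_of_real (H w)) u))\<^sup>2 = P u * m u"
    unfolding DH[OF u'] by (simp add: norm_mult power_mult_distrib m_cmod P_cmod)
  also have "\<dots> = - k * (mean_curvature (F \<circ> x) u)^4"
    unfolding Pk m H by (simp add: power2_eq_square power4_eq_xxxx)
  finally show "(cmod (D (\<lambda>w. complex_of_real (H w)) u))\<^sup>2 = - k * (mean_curvature (F \<circ> x) u)^4" .
qed

text \<open>
  A critical point in the closure of the noncritical ones would satisfy \<open>K = 0\<close> and \<open>H = 0\<close> by
  continuity, and so be umbilic.
\<close>

lemma critical_nearby:
  assumes xV: "(V, x) \<in> A" and u: "u \<in> V" "critical x u"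
  shows "\<exists>B. open B \<and> u \<in> B \<and> B \<subseteq> V \<and> (\<forall>w\<in>B. critical x w)"
proof (cases "\<forall>w\<in>V. critical x w")
  case True
  then show ?thesis using chart(1)[OF xV] u(1) by blast
next
  case False
  obtain e1 e2 p r where frame: "chart_frame V x e1 e2 p r" using chart_frame_exists[OF xV] .
  interpret framed_surface V e1 e2 p r "G s \<circ> x" by (rule framed_G[OF frame s])
  have k: "k \<noteq> 0" using False flat_at_noncritical(2)[OF frame] by blast
  let ?D = "D (\<lambda>w. complex_of_real (H w))"
  define \<phi> where "\<phi> w = \<bar>h11 w * h22 w - (h12 w)\<^sup>2\<bar> + \<bar>(cmod (?D w))\<^sup>2 + k * (H w)^4\<bar>" for w
  have H: "H w = mean_curvature (F \<circ> x) w" "h11 w * h22 w - (h12 w)\<^sup>2 = gauss_curvature (F \<circ> x) w" if "w \<in> V" for w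
    using curvatures_in_frame[OF that] mean_curvature_G[OF frame s that] gauss_curvature_G[OF frame s that] by simp_all
  have "sm ?D" by (simp add: sm_D sm_simps sm_H)
  then have "continuous_on V \<phi>"
    unfolding \<phi>_def[abs_def] by (intro continuous_intros smooth_on_continuous sm_h sm_H)
  then have "open (V \<inter> \<phi> -` (- {0}))" by (intro continuous_open_preimage open_V) auto
  moreover have "\<phi> w = 0" if "w \<in> V" "\<not> critical x w" for w
    using flat_at_noncritical(1,3)[OF frame that] H[OF that(1)] by (simp add: \<phi>_def)
  moreover have "\<phi> u \<noteq> 0"
  proof
    assume "\<phi> u = 0"
    moreover have "?D u = 0" using critical_iff[OF frame s u(1)] u(2) by simp
    ultimately have "gauss_curvature (F \<circ> x) u = 0" "H u = 0" using k H[OF u(1)] by (auto simp: \<phi>_def add_nonneg_eq_0_iff)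
    then show False using not_umbilic[OF frame u(1)] H[OF u(1)] by simp
  qed
  ultimately show ?thesis using u(1) by (intro exI[of _ "V \<inter> \<phi> -` (- {0})"]) auto
qed

lemma flat_if_noncritical_point:
  assumes yW: "(W, y) \<in> A" "w \<in> W" "\<not> critical y w"
  shows "flat A F"
proof -
  define h where "h a \<longleftrightarrow> (\<exists>V x u. (V, x) \<in> A \<and> u \<in> V \<and> x u = a \<and> critical x u)" for a
  have h: "h (x u) \<longleftrightarrow> critical x u" if "(V, x) \<in> A" "u \<in> V" for V x u
    using critical_charts[OF that(1) _ that(2)] that unfolding h_def by metis
  have loc: "\<exists>U. openin M U \<and> a \<in> U \<and> (\<forall>b\<in>U. h b = h a)" if a: "a \<in> topspace M" for a
  proof -
    obtain V x u where xV: "(V, x) \<in> A" and u: "u \<in> V" "x u = a" using charts_cover[OF a] .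
    have "\<exists>B. open B \<and> u \<in> B \<and> B \<subseteq> V \<and> (\<forall>w\<in>B. critical x w = critical x u)"
    proof (cases "critical x u")
      case True
      then show ?thesis using critical_nearby[OF xV u(1)] by auto
    next
      case False
      then show ?thesis using open_noncritical[OF xV] u(1) by (intro exI[of _ "{u \<in> V. \<not> critical x u}"]) auto
    qed
    then obtain B where B: "open B" "u \<in> B" "B \<subseteq> V" "\<forall>w\<in>B. critical x w = critical x u" by blast
    have "\<forall>b\<in>x ` B. h b = h a" using B(3,4) h[OF xV] u by auto
    then show ?thesis using open_chart_image[OF xV B(1,3)] B(2) u(2) by blast
  qed
  have "gauss_curvature (F \<circ> x) u = 0" if xV: "(V, x) \<in> A" and u: "u \<in> V" for V x u
  proof -
    obtain e1 e2 p r where frame: "chart_frame V x e1 e2 p r" using chart_frame_exists[OF xV] .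
    have "h (x u) = h (y w)"
      by (rule locally_constant_imp_constant[OF connected loc chart(4)[OF xV u] chart(4)[OF yW(1,2)]])
    then have "\<not> critical x u" using h[OF xV u] h[OF yW(1,2)] yW(3) by simp
    then show ?thesis by (rule flat_at_noncritical(1)[OF frame u])
  qed
  then show ?thesis unfolding flat_def by blast
qed

end

end

theorem theorem2p6:
  fixes M :: "'a topology" and A :: "'a atlas" and F :: "'a \<Rightarrow> real^3"
  assumes "oriented_surface M A"
    and "connected_space M"
    and "bonnet_surface M A F"
    and "umbilic_free A F"
    and "\<not> constant_mean_curvature A F"
  shows "flat A F \<longleftrightarrow> constant_moebius_curvature A F \<or> constant_curvature_ratio A F"
proof
  assume "flat A F"
  then have "constant_curvature_ratio A F"
    unfolding flat_def constant_curvature_ratio_def by (intro exI[of _ 0]) simp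
  then show "constant_moebius_curvature A F \<or> constant_curvature_ratio A F" ..
next
  assume const: "constant_moebius_curvature A F \<or> constant_curvature_ratio A F"
  obtain J and G :: "real \<Rightarrow> 'a \<Rightarrow> real^3" where JG: "open J" "is_interval J"
      "\<forall>(V, x)\<in>A. smooth_on (J \<times> V) (\<lambda>(t, u). G t (x u))"
      "\<forall>t\<in>J. immersion A (G t) \<and> isometric A F (G t) \<and> same_mean_curvature A F (G t)"
      "\<exists>s\<in>J. \<exists>t\<in>J. \<not> congruent_on (topspace M) (G s) (G t)"
    and imm: "immersion A F"
    using assms(3) unfolding bonnet_surface_def by blast
  interpret surface_family M A F J G
    using assms(1,2,4) imm JG by unfold_locales auto
  obtain s t where st: "s \<in> J" "t \<in> J" "\<not> congruent_on (topspace M) (G s) (G t)" using JG(5) by blast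
  obtain t' where t': "t' \<in> J" "\<And>a \<Phi>. a \<in> topspace M \<Longrightarrow> \<not> agree s t \<Phi> a"
    "\<And>a \<Phi>. a \<in> topspace M \<Longrightarrow> \<not> agree s t' \<Phi> a" "\<And>a \<Phi>. a \<in> topspace M \<Longrightarrow> \<not> agree t t' \<Phi> a"
    by (rule three_members[OF st]) blast
  interpret bonnet_family M A F J G s
  proof unfold_locales
    fix V x e1 e2 p r u
    assume frame: "chart_frame V x e1 e2 p r" and u: "u \<in> V"
    note top = chart(4)[OF in_atlas[OF frame]]
    show "plane_frame.D e1 e2 (framed_surface.\<beta> e1 e2 (G s \<circ> x)) u =
     plane_frame.c p r u * framed_surface.\<beta> e1 e2 (G s \<circ> x) u + framed_surface.\<beta> e1 e2 (G s \<circ> x) u * cnj (framed_surface.\<beta> e1 e2 (G s \<circ> x) u)"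
      by (rule structure_equation[OF framed_pair_G[OF frame st(1,2)] framed_pair_G[OF frame st(1) t'(1)] _ _ _ u])
        (use agree_iff[OF frame st(1,2)] agree_iff[OF frame st(1) t'(1)] agree_iff[OF frame st(2) t'(1)] t'(2-4) top in blast)+
  qed (rule st(1))
  obtain W y w where w: "(W, y) \<in> A" "w \<in> W" "\<not> critical y w"
    using constant_if_all_critical assms(5) by blast
  from const show "flat A F"
  proof
    assume "constant_moebius_curvature A F"
    then obtain k where "\<And>V x u. (V, x) \<in> A \<Longrightarrow> u \<in> V \<Longrightarrow> moebius_curvature (F \<circ> x) u = k"
      unfolding constant_moebius_curvature_def by blast
    then show ?thesis using flat_if_noncritical_point w by blast
  next
    assume "constant_curvature_ratio A F"
    then obtain \<rho> where \<rho>: "\<And>V x u. (V, x) \<in> A \<Longrightarrow> u \<in> V \<Longrightarrow> gauss_curvature (F \<circ> x) u = \<rho> * (mean_curvature (F \<circ> x) u)\<^sup>2"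
      unfolding constant_curvature_ratio_def by blast
    have "\<rho> = 0" by (rule ratio_zero[OF \<rho> w])
    then show ?thesis unfolding flat_def using \<rho> by auto
  qed
qed

end
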